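(* Let $k\geqslant 3$ be a fixed integer. Each of the following two decision problems is NP-complete. (1) Given a finite simple graph $G$, decide whether $G$ admits a local $k$-coloring. (2) Given a finite simple graph $G$, decide whether $G$ admits a semi-matching $k$-coloring.
   Context: Let $G=(V,E)$ be a finite simple graph and $k$ a positive integer. A proper $k$-coloring of $G$ is a mapping $\varphi:V\to\{1,\ldots,k\}$ such that adjacent vertices get different colors. A semi-matching $k$-coloring is a proper $k$-coloring $\varphi$ such that for every $i\in\{1,\ldots,k-1\}$ the union of the color classes $\varphi^{-1}(i)\cup\varphi^{-1}(i+1)$ induces a matching, that is, an induced subgraph in which every vertex has degree at most $1$. A local $k$-coloring is a mapping $\varphi:V\to\{1,\ldots,k\}$ such that for every set $S\subseteq V$ with $|S|\in\{2,3\}$ there exist $u,v\in S$ such that $|\varphi(u)-\varphi(v)|$ is greater than or equal to the number of edges of $G$ between vertices of $S$. The integer $k$ is not part of the input. NP-completeness is with respect to polynomial-time many-one reductions. *)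

theory Defs
  imports
    "HOL-Library.FuncSet"
    "HOL-Library.Ramsey"
    "HOL-Computational_Algebra.Polynomial"
begin

definition simple_graph :: "'a set \<Rightarrow> 'a set set \<Rightarrow> bool" where
  "simple_graph V E \<longleftrightarrow> finite V \<and> E \<subseteq> nsets V 2"

definition proper_coloring :: "'a set \<Rightarrow> 'a set set \<Rightarrow> nat \<Rightarrow> ('a \<Rightarrow> nat) \<Rightarrow> bool" where
  "proper_coloring V E k \<phi> \<longleftrightarrow>
     \<phi> \<in> V \<rightarrow> {1..k} \<and> (\<forall>u\<in>V. \<forall>v\<in>V. {u, v} \<in> E \<longrightarrow> \<phi> u \<noteq> \<phi> v)"

definition induces_matching :: "'a set set \<Rightarrow> 'a set \<Rightarrow> bool" where
  "induces_matching E W \<longleftrightarrow> (\<forall>v\<in>W. card {e \<in> E. e \<subseteq> W \<and> v \<in> e} \<le> 1)"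

definition semi_matching_coloring :: "'a set \<Rightarrow> 'a set set \<Rightarrow> nat \<Rightarrow> ('a \<Rightarrow> nat) \<Rightarrow> bool" where
  "semi_matching_coloring V E k \<phi> \<longleftrightarrow>
     proper_coloring V E k \<phi> \<and>
     (\<forall>i\<in>{1..k - 1}. induces_matching E ({v \<in> V. \<phi> v = i} \<union> {v \<in> V. \<phi> v = i + 1}))"

definition local_coloring :: "'a set \<Rightarrow> 'a set set \<Rightarrow> nat \<Rightarrow> ('a \<Rightarrow> nat) \<Rightarrow> bool" where
  "local_coloring V E k \<phi> \<longleftrightarrow>
     \<phi> \<in> V \<rightarrow> {1..k} \<and>
     (\<forall>S. S \<subseteq> V \<and> card S \<in> {2, 3} \<longrightarrow>
        (\<exists>u\<in>S. \<exists>v\<in>S. \<bar>int (\<phi> u) - int (\<phi> v)\<bar> \<ge> int (card {e \<in> E. e \<subseteq> S})))"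

text \<open>
  States, tape symbols and tapes of a machine are initial segments of the natural numbers.
  The tapes are infinite in both directions; symbol 0 is the blank, symbols 1 and 2 are the
  bits 0 and 1, and a machine may use any finite number of further symbols.
\<close>

datatype move = Move_Left | Stay | Move_Right

record tm =
  num_tapes :: nat
  num_symbols :: nat
  num_states :: nat
  start_state :: nat
  accept_state :: nat
  reject_state :: nat
  transition :: "nat \<Rightarrow> nat list \<Rightarrow> nat \<times> (nat \<times> move) list"

definition wf_tm :: "tm \<Rightarrow> bool" where
  "wf_tm M \<longleftrightarrow>
     num_tapes M \<ge> 2 \<and> num_symbols M \<ge> 3 \<and>
     start_state M < num_states M \<and>
     accept_state M < num_states M \<and>
     reject_state M < num_states M \<and>
     accept_state M \<noteq> reject_state M \<and>
     (\<forall>q ss. q < num_states M \<and> length ss = num_tapes M \<and> set ss \<subseteq> {..<num_symbols M} \<longrightarrow>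
        (case transition M q ss of (q', as) \<Rightarrow>
           q' < num_states M \<and> length as = num_tapes M \<and> fst ` set as \<subseteq> {..<num_symbols M}))"

text \<open>A tape consists of its contents and the position of the head.\<close>

type_synonym tape = "(int \<Rightarrow> nat) \<times> int"
type_synonym config = "nat \<times> tape list"

fun read_tape :: "tape \<Rightarrow> nat" where
  "read_tape (f, h) = f h"

fun offset :: "move \<Rightarrow> int" where
  "offset Move_Left = -1"
| "offset Stay = 0"
| "offset Move_Right = 1"

fun act_on_tape :: "nat \<times> move \<Rightarrow> tape \<Rightarrow> tape" where
  "act_on_tape (a, d) (f, h) = (f(h := a), h + offset d)"

definition halted :: "tm \<Rightarrow> config \<Rightarrow> bool" where
  "halted M c \<longleftrightarrow> fst c = accept_state M \<or> fst c = reject_state M"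

definition step :: "tm \<Rightarrow> config \<Rightarrow> config" where
  "step M c =
     (if halted M c then c
      else case transition M (fst c) (map read_tape (snd c)) of
             (q', as) \<Rightarrow> (q', map2 act_on_tape as (snd c)))"

fun bit_symbol :: "bool \<Rightarrow> nat" where
  "bit_symbol False = 1"
| "bit_symbol True = 2"

definition input_tape :: "bool list \<Rightarrow> tape" where
  "input_tape x =
     ((\<lambda>p. if 0 \<le> p \<and> p < int (length x) then bit_symbol (x ! nat p) else 0), 0)"

text \<open>Each input word gets its own tape, starting with tape 0; the other tapes are blank.\<close>

definition initial_config :: "tm \<Rightarrow> bool list list \<Rightarrow> config" where
  "initial_config M xs =
     (start_state M, map input_tape (xs @ replicate (num_tapes M - length xs) []))"

definition config_after :: "tm \<Rightarrow> bool list list \<Rightarrow> nat \<Rightarrow> config" where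
  "config_after M xs t = (step M ^^ t) (initial_config M xs)"

text \<open>The output is the word from cell 0 of tape 1 up to the first blank.\<close>

definition outputs :: "config \<Rightarrow> bool list \<Rightarrow> bool" where
  "outputs c y \<longleftrightarrow>
     (\<forall>i < length y. fst (snd c ! 1) (int i) = bit_symbol (y ! i)) \<and>
     fst (snd c ! 1) (int (length y)) = 0"

text \<open>
  A halted machine does not change its configuration any more, so looking at the configuration
  after exactly p(n) steps expresses a running time of at most p(n).
\<close>

definition poly_time_computable :: "(bool list \<Rightarrow> bool list) \<Rightarrow> bool" where
  "poly_time_computable f \<longleftrightarrow>
     (\<exists>M (p :: nat poly). wf_tm M \<and>
        (\<forall>x. let c = config_after M [x] (poly p (length x))
             in halted M c \<and> outputs c (f x)))"

definition poly_time_decidable :: "(bool list \<Rightarrow> bool list \<Rightarrow> bool) \<Rightarrow> bool" where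
  "poly_time_decidable R \<longleftrightarrow>
     (\<exists>M (p :: nat poly). wf_tm M \<and>
        (\<forall>x w. fst (config_after M [x, w] (poly p (length x + length w))) =
               (if R x w then accept_state M else reject_state M)))"

type_synonym language = "bool list set"

definition NP :: "language set" where
  "NP = {L. \<exists>R (q :: nat poly). poly_time_decidable R \<and>
              (\<forall>x. x \<in> L \<longleftrightarrow> (\<exists>w. length w \<le> poly q (length x) \<and> R x w))}"

definition poly_time_reducible :: "language \<Rightarrow> language \<Rightarrow> bool" where
  "poly_time_reducible A B \<longleftrightarrow> (\<exists>f. poly_time_computable f \<and> (\<forall>x. x \<in> A \<longleftrightarrow> f x \<in> B))"

definition NP_hard :: "language \<Rightarrow> bool" where
  "NP_hard L \<longleftrightarrow> (\<forall>A\<in>NP. poly_time_reducible A L)"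

definition NP_complete :: "language \<Rightarrow> bool" where
  "NP_complete L \<longleftrightarrow> L \<in> NP \<and> NP_hard L"

text \<open>
  Inputs are graphs on the vertices 0, ..., n - 1, encoded by n in unary, a separating False,
  and the adjacency matrix row by row.
\<close>

definition encode_graph :: "nat \<Rightarrow> nat set set \<Rightarrow> bool list" where
  "encode_graph n E =
     replicate n True @ [False] @ concat (map (\<lambda>u. map (\<lambda>v. {u, v} \<in> E) [0..<n]) [0..<n])"

lemma encode_graph_inject:
  assumes "simple_graph {..<n} E" "simple_graph {..<m} F"
    and eq: "encode_graph n E = encode_graph m F"
  shows "n = m \<and> E = F"
proof -
  have tw: "takeWhile id (encode_graph n E) = replicate n True" for n E
    unfolding encode_graph_def by (subst takeWhile_append2) auto
  have nm: "n = m"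
    using tw[of n E] tw[of m F] eq by (metis length_replicate)
  have rows: "concat (map (\<lambda>u. map (\<lambda>v. {u, v} \<in> E) [0..<n]) [0..<n]) =
              concat (map (\<lambda>u. map (\<lambda>v. {u, v} \<in> F) [0..<n]) [0..<n])"
    using eq nm by (simp add: encode_graph_def)
  have "map (\<lambda>u. map (\<lambda>v. {u, v} \<in> E) [0..<n]) [0..<n] =
        map (\<lambda>u. map (\<lambda>v. {u, v} \<in> F) [0..<n]) [0..<n]"
    by (rule concat_injective[OF rows]) (auto simp: set_zip)
  then have *: "{u, v} \<in> E \<longleftrightarrow> {u, v} \<in> F" if "u < n" "v < n" for u v
    using that by auto
  have "e \<in> E \<longleftrightarrow> e \<in> F" for e
  proof (cases "e \<in> nsets {..<n} 2")
    case True
    then obtain u v where "e = {u, v}" "u < n" "v < n"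
      by (auto simp: nsets_2_eq)
    then show ?thesis using * by simp
  next
    case False
    then show ?thesis using assms(1,2) nm by (auto simp: simple_graph_def)
  qed
  with nm show ?thesis by blast
qed

definition graph_problem :: "(nat set \<Rightarrow> nat set set \<Rightarrow> bool) \<Rightarrow> language" where
  "graph_problem P = {encode_graph n E | n E. simple_graph {..<n} E \<and> P {..<n} E}"

definition local_coloring_problem :: "nat \<Rightarrow> language" where
  "local_coloring_problem k = graph_problem (\<lambda>V E. \<exists>\<phi>. local_coloring V E k \<phi>)"

definition semi_matching_coloring_problem :: "nat \<Rightarrow> language" where
  "semi_matching_coloring_problem k = graph_problem (\<lambda>V E. \<exists>\<phi>. semi_matching_coloring V E k \<phi>)"

end

(* A local coloring is the same as a semi-matching coloring in which every triangle contains two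
   colors at distance at least 3. Both notions are first-order statements about the graph and the
   coloring, so a coloring is a certificate. One reduction shows hardness of both problems: the
   graph has a local coloring if a given set of clauses is satisfiable, and the clauses are
   satisfiable if it has a semi-matching coloring.

   Replace a vertex by k + 1 copies. Some color c occurs twice among the copies, and a common
   neighbour of all copies cannot have color c - 1, c or c + 1. Joining k' - 2 such blown-up vertices
   to everything and to each other, where k' is half of k rounded up, leaves a set of colors without
   three elements at pairwise distance at least 2. It splits into two classes of close colors, which
   are the truth values, and every vertex has at most one neighbour of its own class. A gadget that
   charges disagreements to this one neighbour enforces that x is y or z. A chain of such gadgets
   evaluates a clause literal by literal.

   The clauses describe a computation of the verifying machine. The adjacency matrix is computed by a
   machine because it is built from arithmetic, bounded sums and bits of the input; such functions are
   computed in polynomial time by programs with counters, and a counter is the position of a head. *)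

theory Submission
  imports Defs
begin

section \<open>Programs\<close>

text \<open>Pairwise apart colors take at most one color from each of the pairs 1-2, 3-4 and so on,
  so there are at most k' of them, and k' - 2 blown-up vertices leave room for only two. The parity
  of k shapes the rest. For even k a truth value may own two consecutive colors, so that a middle
  vertex of a gadget can be close to either of its ends. For odd k a remaining color that is apart
  from another one is odd, and a middle vertex between different values is forced into the even
  color between them. This is why the gadget depends on the parity and its soundness is argued
  twice. Local colorings ask for more only at triangles. Every triangle of the graph contains a
  universal vertex, and in the coloring built from an assignment its color is at least two above all
  truth values, so that coloring is local without further care. One number \<open>Y\<close> bounds
  literals, clauses, clause lengths and gadget positions alike, and constant literals fill up what
  is left over. A vertex is then a number with three digits in base \<open>Y\<close>, and adjacency
  becomes plain arithmetic on digits.\<close>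

datatype com = Done | Act nat "nat list \<Rightarrow> nat \<times> move" | Seq com com | While "nat list \<Rightarrow> bool" com

definition idle :: "nat list \<Rightarrow> (nat \<times> move) list" where
  "idle ss = map (\<lambda>s. (s, Stay)) ss"

text \<open>Written symbols are reduced modulo 3, so that every program yields a well-formed machine.\<close>

fun nxt :: "com \<Rightarrow> nat list \<Rightarrow> com \<times> (nat \<times> move) list" where
  "nxt Done ss = (Done, idle ss)"
| "nxt (Act j g) ss = (Done, (idle ss)[j := (fst (g ss) mod 3, snd (g ss))])"
| "nxt (Seq c1 c2) ss =
     (if c1 = Done then (c2, idle ss) else (Seq (fst (nxt c1 ss)) c2, snd (nxt c1 ss)))"
| "nxt (While b c) ss = (if b ss then Seq c (While b c) else Done, idle ss)"

text \<open>An over-approximation of the programs that \<open>nxt\<close> can reach. Its finiteness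
  is the point, since it provides the states of a machine; unfolding a loop does not enlarge it,
  because the body is always continued by the same loop.\<close>

fun conts :: "com \<Rightarrow> com set" where
  "conts Done = {Done}"
| "conts (Act j g) = {Act j g, Done}"
| "conts (Seq c1 c2) = (\<lambda>c. Seq c c2) ` conts c1 \<union> conts c2"
| "conts (While b c) = insert Done (insert (While b c) ((\<lambda>c'. Seq c' (While b c)) ` conts c))"

lemma finite_conts: "finite (conts c)"
  by (induction c) auto

lemma self_in_conts: "c \<in> conts c"
  by (induction c) auto

lemma Done_in_conts: "Done \<in> conts c"
  by (induction c) auto

lemma nxt_in_conts: "d \<in> conts c \<Longrightarrow> fst (nxt d ss) \<in> conts c"
  by (induction c arbitrary: d) (auto simp: self_in_conts Done_in_conts split: if_splits)

definition exec1 :: "com \<times> tape list \<Rightarrow> com \<times> tape list" where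
  "exec1 cs = (let n = nxt (fst cs) (map read_tape (snd cs)) in (fst n, map2 act_on_tape (snd n) (snd cs)))"

text \<open>As \<open>Done\<close> is a fixed point of \<open>exec1\<close>, the number
  \<open>n\<close> acts as an upper bound on the running time.\<close>

definition runs :: "com \<Rightarrow> tape list \<Rightarrow> tape list \<Rightarrow> nat \<Rightarrow> bool" where
  "runs c s s' n \<longleftrightarrow> (exec1 ^^ n) (c, s) = (Done, s')"

lemma act_idle: "map2 act_on_tape (idle (map read_tape s)) s = s"
  by (induction s) (auto simp: idle_def)

lemma exec1_Done: "exec1 (Done, s) = (Done, s)"
  by (simp add: exec1_def act_idle)

lemma runs_mono: "runs c s s' n \<Longrightarrow> n \<le> m \<Longrightarrow> runs c s s' m"
proof -
  have *: "(exec1 ^^ j) (Done, s') = (Done, s')" for j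
    by (induction j) (auto simp: exec1_Done)
  assume "runs c s s' n" "n \<le> m"
  then have "(exec1 ^^ (m - n + n)) (c, s) = (Done, s')"
    using * unfolding funpow_add runs_def by simp
  then show ?thesis using \<open>n \<le> m\<close> by (simp add: runs_def)
qed

lemma runs_Done: "runs Done s s 0"
  by (simp add: runs_def)

lemma map2_idle_update:
  "j < length s \<Longrightarrow>
   map2 act_on_tape ((idle (map read_tape s))[j := a]) s = s[j := act_on_tape a (s ! j)]"
proof (rule nth_equalityI)
  show "length (map2 act_on_tape ((idle (map read_tape s))[j := a]) s) = length (s[j := act_on_tape a (s ! j)])"
    by (simp add: idle_def)
  fix i assume "i < length (map2 act_on_tape ((idle (map read_tape s))[j := a]) s)"
  then have i: "i < length s" by simp
  obtain f h where fh: "s ! i = (f, h)" by fastforce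
  show "map2 act_on_tape ((idle (map read_tape s))[j := a]) s ! i = s[j := act_on_tape a (s ! j)] ! i"
    using i fh by (cases "i = j") (auto simp: idle_def)
qed

lemma runs_Act:
  assumes "j < length s"
  shows "runs (Act j g) s (s[j := act_on_tape (fst (g (map read_tape s)) mod 3, snd (g (map read_tape s))) (s ! j)]) 1"
  using assms by (simp add: runs_def exec1_def map2_idle_update)

lemma exec1_Seq: "c \<noteq> Done \<Longrightarrow>
   exec1 (Seq c c2, s) = (Seq (fst (exec1 (c, s))) c2, snd (exec1 (c, s)))"
  by (simp add: exec1_def Let_def)

text \<open>Only some \<open>m \<le> n\<close> steps are claimed: the idle steps that
  \<open>runs\<close> allows once \<open>c1\<close> is done do not occur inside \<open>Seq\<close>,
  which passes on to \<open>c2\<close> at once.\<close>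

lemma runs_Seq_aux: "runs c1 s s' n \<Longrightarrow> \<exists>m\<le>n. (exec1 ^^ m) (Seq c1 c2, s) = (Seq Done c2, s')"
proof (induction n arbitrary: c1 s)
  case 0
  then show ?case by (auto simp: runs_def)
next
  case (Suc n)
  show ?case
  proof (cases "c1 = Done")
    case True
    then have "s' = s"
      using Suc.prems runs_mono[OF runs_Done, of "Suc n" s] by (auto simp: runs_def)
    then show ?thesis using True by (intro exI[of _ 0]) auto
  next
    case False
    obtain c s1 where cs: "exec1 (c1, s) = (c, s1)" by fastforce
    have "runs c s1 s' n"
      using Suc.prems cs by (simp add: runs_def funpow_Suc_right del: funpow.simps)
    then obtain m where m: "m \<le> n" "(exec1 ^^ m) (Seq c c2, s1) = (Seq Done c2, s')"
      using Suc.IH by blast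
    show ?thesis
      using m cs False by (intro exI[of _ "Suc m"]) (auto simp: funpow_Suc_right exec1_Seq simp del: funpow.simps)
  qed
qed

lemma runs_Seq:
  assumes "runs c1 s s' n" "runs c2 s' s'' m"
  shows "runs (Seq c1 c2) s s'' (n + m + 1)"
proof -
  obtain l where l: "l \<le> n" "(exec1 ^^ l) (Seq c1 c2, s) = (Seq Done c2, s')"
    using runs_Seq_aux[OF assms(1)] by blast
  have "exec1 (Seq Done c2, s') = (c2, s')"
    by (simp add: exec1_def act_idle)
  then have "(exec1 ^^ (m + Suc l)) (Seq c1 c2, s) = (Done, s'')"
    using l assms(2) by (simp only: runs_def funpow_add funpow.simps comp_apply)
  then have "runs (Seq c1 c2) s s'' (m + Suc l)" by (simp add: runs_def)
  then show ?thesis by (rule runs_mono) (use l in simp)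
qed

lemma runs_While_False:
  "\<not> b (map read_tape s) \<Longrightarrow> runs (While b c) s s 1"
  by (simp add: runs_def exec1_def act_idle)

lemma runs_While_True:
  assumes "b (map read_tape s)" "runs c s s' n" "runs (While b c) s' s'' m"
  shows "runs (While b c) s s'' (n + m + 2)"
proof -
  have "exec1 (While b c, s) = (Seq c (While b c), s)"
    using assms(1) by (simp add: exec1_def act_idle)
  moreover have "n + m + 2 = Suc (n + m + 1)" by simp
  ultimately show ?thesis
    using runs_Seq[OF assms(2,3)] unfolding runs_def by (metis comp_apply funpow_Suc_right)
qed

lemma runs_While_iterate:
  assumes body: "\<And>i. i < n \<Longrightarrow> b (map read_tape (S i)) \<and> runs c (S i) (S (Suc i)) t"
    and exit: "\<not> b (map read_tape (S n))"
  shows "runs (While b c) (S 0) (S n) (n * (t + 2) + 1)"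
  using assms
proof (induction n arbitrary: S)
  case 0
  then show ?case using runs_While_False by force
next
  case (Suc n)
  have "runs (While b c) (S (Suc 0)) (S (Suc n)) (n * (t + 2) + 1)"
    using Suc.IH[of "\<lambda>i. S (Suc i)"] Suc.prems by auto
  then have "runs (While b c) (S 0) (S (Suc n)) (t + (n * (t + 2) + 1) + 2)"
    using Suc.prems(1)[of 0] by (intro runs_While_True[of b _ c "S (Suc 0)"]) auto
  then show ?case by (simp add: algebra_simps)
qed

section \<open>Machines executing programs\<close>

text \<open>Tape 1 contains the output \<open>y\<close> followed by the second input word \<open>w\<close>, with the head in between.
  A counter is a tape on which only cell 0 is marked; its value is the position of the head.\<close>

definition word_tape :: "bool list \<Rightarrow> bool list \<Rightarrow> tape" where
  "word_tape y w = (fst (input_tape (y @ w)), int (length y))"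

definition counter_tape :: "nat \<Rightarrow> tape" where
  "counter_tape v = ((\<lambda>p. if p = 0 then 1 else 0), int v)"

definition tapes :: "tape \<Rightarrow> tape \<Rightarrow> (nat \<Rightarrow> nat) \<Rightarrow> nat \<Rightarrow> tape list" where
  "tapes a b s K = a # b # map (\<lambda>j. counter_tape (s j)) [0..<K]"

text \<open>A blank tape has no distinguished cell. Writing symbol 1 into cell 0 of every counter
  tape makes the test for zero possible; the offset 2 skips the two word tapes.\<close>

fun mark :: "nat \<Rightarrow> com" where
  "mark 0 = Done"
| "mark (Suc n) = Seq (mark n) (Act (n + 2) (\<lambda>_. (1, Stay)))"

lemma runs_mark:
  "n \<le> K \<Longrightarrow> runs (mark n) (a # b # replicate K (input_tape []))
     (a # b # map (\<lambda>j. counter_tape 0) [0..<n] @ replicate (K - n) (input_tape [])) (2 * n)"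
proof (induction n)
  case 0
  then show ?case by (simp add: runs_Done)
next
  case (Suc n)
  let ?s = "a # b # map (\<lambda>j. counter_tape 0) [0..<n] @ replicate (K - n) (input_tape [])"
  have r: "replicate (K - n) (input_tape []) = input_tape [] # replicate (K - Suc n) (input_tape [])"
    using Suc.prems by (metis Suc_diff_Suc Suc_le_lessD replicate_Suc)
  have eq: "?s[n + 2 := act_on_tape (1, Stay) (?s ! (n + 2))] =
     a # b # map (\<lambda>j. counter_tape 0) [0..<Suc n] @ replicate (K - Suc n) (input_tape [])"
    unfolding r by (simp add: list_update_append nth_append input_tape_def counter_tape_def fun_eq_iff)
  have "runs (Act (n + 2) (\<lambda>_. (1, Stay))) ?s (?s[n + 2 := act_on_tape (1, Stay) (?s ! (n + 2))]) 1"
    using runs_Act[of "n + 2" ?s "\<lambda>_. (1, Stay)"] Suc.prems by simp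
  from runs_Seq[OF Suc.IH this] show ?case
    unfolding eq using Suc.prems by simp
qed

text \<open>The continuations of a program become the states of the machine. When the program is
  done, the machine accepts iff counter 0 (on tape 2) is not zero.\<close>

definition machine :: "com \<Rightarrow> nat \<Rightarrow> (com \<Rightarrow> nat) \<Rightarrow> tm" where
  "machine c K h =
     \<lparr>num_tapes = K + 3, num_symbols = 3, num_states = card (conts c) + 2, start_state = h c,
      accept_state = card (conts c), reject_state = card (conts c) + 1,
      transition = (\<lambda>q ss.
        let d = the_inv_into (conts c) h q in
        if q \<ge> card (conts c) then (q, idle ss)
        else if d = Done then (if ss ! 2 = 1 then card (conts c) + 1 else card (conts c), idle ss)
        else (h (fst (nxt d ss)), snd (nxt d ss)))\<rparr>"

lemma nxt_action:
  "set ss \<subseteq> {..<3} \<Longrightarrow> length (snd (nxt d ss)) = length ss \<and> fst ` set (snd (nxt d ss)) \<subseteq> {..<3}"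
proof (induction d)
  case (Act j g)
  have "set ((idle ss)[j := (fst (g ss) mod 3, snd (g ss))]) \<subseteq> insert (fst (g ss) mod 3, snd (g ss)) (set (idle ss))"
    by (rule set_update_subset_insert)
  then show ?case using Act by (fastforce simp: idle_def)
qed (auto simp: idle_def)

lemma wf_machine:
  assumes h: "bij_betw h (conts c) {..<card (conts c)}"
  shows "wf_tm (machine c K h)"
proof -
  have 1: "h d < card (conts c)" if "d \<in> conts c" for d
    using h that by (auto simp: bij_betw_def)
  have 2: "the_inv_into (conts c) h q \<in> conts c" if "q < card (conts c)" for q
    using h that by (metis bij_betw_def lessThan_iff subset_refl the_inv_into_into)
  show ?thesis
    unfolding wf_tm_def machine_def
    using 1[OF self_in_conts] 1[OF nxt_in_conts[OF 2]] nxt_action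
    by (auto simp: Let_def idle_def less_Suc_eq split: prod.splits)
qed

text \<open>The machine does not wait in the state of \<open>Done\<close> but halts from there,
  hence the claim about some moment \<open>m \<le> n\<close> instead of step \<open>n\<close>
  itself.\<close>

lemma machine_simulates:
  assumes h: "bij_betw h (conts c) {..<card (conts c)}"
    and run: "runs c s s' n"
    and M: "M = machine c K h"
  shows "\<exists>m\<le>n. (step M ^^ m) (h c, s) = (h Done, s')"
proof -
  have *: "\<exists>m\<le>n. (step M ^^ m) (h d, s) = (h Done, s')" if "runs d s s' n" "d \<in> conts c" for d
    using that
  proof (induction n arbitrary: d s)
    case 0
    then show ?case by (auto simp: runs_def)
  next
    case (Suc n)
    show ?case
    proof (cases "d = Done")
      case True
      then have "s' = s"
        using Suc.prems runs_mono[OF runs_Done, of "Suc n" s] by (auto simp: runs_def)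
      then show ?thesis using True by (intro exI[of _ 0]) auto
    next
      case False
      obtain c1 s1 where cs: "exec1 (d, s) = (c1, s1)" by fastforce
      have "h d < card (conts c)"
        using h Suc.prems by (auto simp: bij_betw_def)
      moreover have "the_inv_into (conts c) h (h d) = d"
        using h Suc.prems by (auto simp: bij_betw_def the_inv_into_f_f)
      ultimately have st: "step M (h d, s) = (h c1, s1)"
        using cs False by (auto simp: M step_def halted_def machine_def exec1_def Let_def)
      have "runs c1 s1 s' n"
        using Suc.prems cs by (simp add: runs_def funpow_Suc_right del: funpow.simps)
      moreover have "c1 \<in> conts c"
        using cs nxt_in_conts[OF Suc.prems(2)] by (auto simp: exec1_def Let_def)
      ultimately obtain m where m: "m \<le> n" "(step M ^^ m) (h c1, s1) = (h Done, s')"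
        using Suc.IH by blast
      show ?thesis
        using m st by (intro exI[of _ "Suc m"]) (auto simp: funpow_Suc_right simp del: funpow.simps)
    qed
  qed
  show ?thesis using *[OF run self_in_conts] .
qed

lemma step_funpow_halted: "halted M c \<Longrightarrow> (step M ^^ n) c = c"
  by (induction n) (auto simp: step_def)

text \<open>The bound on \<open>N\<close> adds up 2 * (K + 1) steps of marking, n steps of the
  program, one step for the sequencing and a last one that inspects counter 0 and enters a halting
  state. With \<open>Suc K\<close> counters there always is a counter 0.\<close>

lemma machine_computation:
  assumes M: "M = machine (Seq (mark (Suc K)) c) K h"
    and h: "bij_betw h (conts (Seq (mark (Suc K)) c)) {..<card (conts (Seq (mark (Suc K)) c))}"
    and len: "length xs \<le> 2"
    and ab: "a = input_tape ((xs @ [[], []]) ! 0)" "b = input_tape ((xs @ [[], []]) ! 1)"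
    and run: "runs c (tapes a b (\<lambda>_. 0) (Suc K)) (tapes a' b' s (Suc K)) n"
    and N: "2 * K + n + 4 \<le> N"
  shows "config_after M xs N =
     (if s 0 = 0 then reject_state M else accept_state M, tapes a' b' s (Suc K))"
proof -
  let ?c = "Seq (mark (Suc K)) c"
  let ?t = "tapes a' b' s (Suc K)"
  have ini: "snd (initial_config M xs) = a # b # replicate (Suc K) (input_tape [])"
  proof -
    consider "xs = []" | u where "xs = [u]" | u v where "xs = [u, v]"
      using len by (metis One_nat_def Suc_1 Suc_le_length_iff le_zero_eq length_0_conv neq_Nil_conv list.size(3) not_less_eq_eq)
    then show ?thesis
      by cases (auto simp: initial_config_def M machine_def ab numeral_3_eq_3)
  qed
  have "runs (mark (Suc K)) (a # b # replicate (Suc K) (input_tape []))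
     (tapes a b (\<lambda>_. 0) (Suc K)) (2 * Suc K)"
    using runs_mark[of "Suc K" "Suc K" a b] unfolding tapes_def by simp
  from runs_Seq[OF this run]
  have "runs ?c (snd (initial_config M xs)) ?t (2 * Suc K + n + 1)"
    by (simp only: ini)
  then obtain m where m: "m \<le> 2 * Suc K + n + 1"
      "(step M ^^ m) (h ?c, snd (initial_config M xs)) = (h Done, ?t)"
    using machine_simulates[OF h _ M] by blast
  have st: "fst (initial_config M xs) = h ?c"
    by (simp add: initial_config_def M machine_def)
  have D: "h Done < card (conts ?c)" "the_inv_into (conts ?c) h (h Done) = Done"
    using h Done_in_conts[of ?c] by (auto simp: bij_betw_def the_inv_into_f_f)
  have rd: "read_tape (?t ! 2) = (if s 0 = 0 then 1 else 0)"
    by (simp add: tapes_def counter_tape_def nth_Cons numeral_2_eq_2 del: upt_Suc)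
  let ?e = "(if s 0 = 0 then reject_state M else accept_state M, ?t)"
  have len2: "length ?t = K + 3" by (simp add: tapes_def)
  have "(map read_tape ?t) ! 2 = (if s 0 = 0 then 1 else 0)"
    using len2 rd by simp
  then have fin: "step M (h Done, ?t) = ?e"
    using D act_idle[of ?t]
    by (auto simp: M step_def halted_def machine_def Let_def simp del: conts.simps)
  have "(step M ^^ Suc m) (initial_config M xs) = ?e"
    using m st fin by (metis comp_apply funpow.simps(2) prod.collapse)
  moreover have "halted M ?e" by (simp add: halted_def)
  ultimately have "(step M ^^ (N - Suc m + Suc m)) (initial_config M xs) = ?e"
    by (simp only: funpow_add[of "N - Suc m"] comp_apply step_funpow_halted)
  moreover have "N - Suc m + Suc m = N" using m N by simp
  ultimately show ?thesis
    unfolding config_after_def by (simp only:)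
qed

lemma ex_state_numbering: "\<exists>h. bij_betw h (conts c) {..<card (conts c)}"
  using ex_bij_betw_finite_nat[OF finite_conts, of c] by (simp add: atLeast0LessThan)

section \<open>Counter programs\<close>

definition inc :: "nat \<Rightarrow> com" where
  "inc j = Act (j + 2) (\<lambda>ss. (ss ! (j + 2), Move_Right))"

definition dec :: "nat \<Rightarrow> com" where
  "dec j = Act (j + 2) (\<lambda>ss. (ss ! (j + 2), if ss ! (j + 2) = 1 then Stay else Move_Left))"

definition loop :: "nat \<Rightarrow> com \<Rightarrow> com" where
  "loop j c = While (\<lambda>ss. ss ! (j + 2) \<noteq> 1) c"

definition shift :: "nat \<Rightarrow> move \<Rightarrow> com" where
  "shift i d = Act i (\<lambda>ss. (ss ! i, d))"

definition inc_if :: "nat \<Rightarrow> nat \<Rightarrow> com" where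
  "inc_if i j = Act (j + 2) (\<lambda>ss. (ss ! (j + 2), if ss ! i = 2 then Move_Right else Stay))"

lemma length_tapes [simp]: "length (tapes a b s K) = K + 2"
  by (simp add: tapes_def)

lemma nth_tapes [simp]:
  "tapes a b s K ! 0 = a" "tapes a b s K ! Suc 0 = b"
  "j < K \<Longrightarrow> tapes a b s K ! (Suc (Suc j)) = counter_tape (s j)"
  by (auto simp: tapes_def)

lemma tapes_update:
  "j < K \<Longrightarrow> (tapes a b s K)[Suc (Suc j) := counter_tape v] = tapes a b (s(j := v)) K"
  by (auto simp: tapes_def intro!: nth_equalityI)

lemma tapes_update_01:
  "(tapes a b s K)[0 := a'] = tapes a' b s K" "(tapes a b s K)[Suc 0 := b'] = tapes a b' s K"
  by (auto simp: tapes_def)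

lemma read_counter_tape [simp]: "read_tape (counter_tape v) = (if v = 0 then 1 else 0)"
  by (simp add: counter_tape_def)

lemma act_counter_tape:
  "act_on_tape (read_tape (counter_tape v) mod 3, Move_Right) (counter_tape v) = counter_tape (Suc v)"
  "v > 0 \<Longrightarrow> act_on_tape (read_tape (counter_tape v) mod 3, Move_Left) (counter_tape v) = counter_tape (v - 1)"
  "act_on_tape (read_tape (counter_tape v) mod 3, Stay) (counter_tape v) = counter_tape v"
  by (auto simp: counter_tape_def fun_eq_iff)

lemma runs_inc: "j < K \<Longrightarrow> runs (inc j) (tapes a b s K) (tapes a b (s(j := Suc (s j))) K) 1"
  using runs_Act[of "Suc (Suc j)" "tapes a b s K" "\<lambda>ss. (ss ! (j + 2), Move_Right)"]
  by (simp add: inc_def act_counter_tape tapes_update del: read_counter_tape)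

lemma runs_dec: "j < K \<Longrightarrow> runs (dec j) (tapes a b s K) (tapes a b (s(j := s j - 1)) K) 1"
  using runs_Act[of "Suc (Suc j)" "tapes a b s K" "\<lambda>ss. (ss ! (j + 2), if ss ! (j + 2) = 1 then Stay else Move_Left)"]
    act_counter_tape[of "s j"]
  by (cases "s j = 0") (auto simp: dec_def tapes_update)

lemma runs_loop:
  assumes "\<And>i. i < n \<Longrightarrow> S i j > 0 \<and> runs c (tapes (A i) (B i) (S i) K) (tapes (A (Suc i)) (B (Suc i)) (S (Suc i)) K) t"
    and "S n j = 0" "j < K"
  shows "runs (loop j c) (tapes (A 0) (B 0) (S 0) K) (tapes (A n) (B n) (S n) K) (n * (t + 2) + 1)"
  unfolding loop_def
  by (rule runs_While_iterate[of n _ "\<lambda>i. tapes (A i) (B i) (S i) K"]) (use assms in auto)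

fun incs :: "nat list \<Rightarrow> com" where
  "incs [] = Done"
| "incs (k # ks) = Seq (inc k) (incs ks)"

lemma runs_incs:
  "distinct ks \<Longrightarrow> set ks \<subseteq> {..<K} \<Longrightarrow>
   runs (incs ks) (tapes a b s K) (tapes a b (\<lambda>l. if l \<in> set ks then Suc (s l) else s l) K) (2 * length ks)"
proof (induction ks arbitrary: s)
  case Nil
  then show ?case by (simp add: runs_Done)
next
  case (Cons k ks)
  have eq: "(\<lambda>l. if l \<in> set ks then Suc ((s(k := Suc (s k))) l) else (s(k := Suc (s k))) l) =
        (\<lambda>l. if l \<in> set (k # ks) then Suc (s l) else s l)"
    using Cons.prems by auto
  have "runs (incs (k # ks)) (tapes a b s K)
     (tapes a b (\<lambda>l. if l \<in> set ks then Suc ((s(k := Suc (s k))) l) else (s(k := Suc (s k))) l) K)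
     (1 + 2 * length ks + 1)"
    unfolding incs.simps
    by (rule runs_Seq[OF runs_inc]) (use Cons in auto)
  then show ?case unfolding eq by simp
qed

text \<open>Used in three roles: an empty list clears counter \<open>j\<close>, one target adds to
  it, and two targets duplicate the value.\<close>

definition transfer :: "nat \<Rightarrow> nat list \<Rightarrow> com" where
  "transfer j ks = loop j (Seq (dec j) (incs ks))"

lemma runs_transfer:
  assumes "distinct ks" "set ks \<subseteq> {..<K}" "j < K" "j \<notin> set ks"
  shows "runs (transfer j ks) (tapes a b s K)
     (tapes a b (\<lambda>l. if l = j then 0 else if l \<in> set ks then s l + s j else s l) K)
     (s j * (2 * length ks + 4) + 1)"
proof -
  let ?S = "\<lambda>i l. if l = j then s j - i else if l \<in> set ks then s l + i else s l"
  have "runs (Seq (dec j) (incs ks)) (tapes a b (?S i) K) (tapes a b (?S (Suc i)) K) (2 * length ks + 2)"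
    if "i < s j" for i
  proof -
    have eq: "(\<lambda>l. if l \<in> set ks then Suc (((?S i)(j := ?S i j - 1)) l) else ((?S i)(j := ?S i j - 1)) l) = ?S (Suc i)"
      using assms by (auto simp: fun_eq_iff)
    have "runs (Seq (dec j) (incs ks)) (tapes a b (?S i) K) (tapes a b
        (\<lambda>l. if l \<in> set ks then Suc (((?S i)(j := ?S i j - 1)) l) else ((?S i)(j := ?S i j - 1)) l) K)
        (1 + 2 * length ks + 1)"
      by (rule runs_Seq[OF runs_dec runs_incs]) (use assms in auto)
    then show ?thesis unfolding eq by simp
  qed
  then have "runs (transfer j ks) (tapes a b (?S 0) K) (tapes a b (?S (s j)) K) (s j * (2 * length ks + 2 + 2) + 1)"
    unfolding transfer_def
    by (intro runs_loop[of "s j" ?S j _ "\<lambda>_. a" "\<lambda>_. b"]) (use assms in auto)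
  moreover have "?S 0 = s" by auto
  moreover have "?S (s j) = (\<lambda>l. if l = j then 0 else if l \<in> set ks then s l + s j else s l)" by auto
  ultimately show ?thesis by (simp add: numeral_Bit0)
qed


section \<open>Procedures with arguments in counters and polynomial running time\<close>

definition tps :: "bool list \<Rightarrow> bool list \<Rightarrow> bool list \<Rightarrow> (nat \<Rightarrow> nat) \<Rightarrow> nat \<Rightarrow> tape list" where
  "tps x w y s K = tapes (input_tape x) (word_tape y w) s K"

abbreviation (input) extent :: "bool list \<Rightarrow> bool list \<Rightarrow> nat list \<Rightarrow> nat" where
  "extent x w e \<equiv> length x + length w + sum_list e"

text \<open>The program \<open>c\<close> reads its arguments from the counters \<open>\<rho>\<close>, stores \<open>f x w e\<close> in counter \<open>r\<close>
  and appends \<open>F x w e\<close> to the output. It may use the counters from \<open>r\<close> up to \<open>W - 1\<close>, which must be 0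
  before, and leaves them 0 except for \<open>r\<close>. The output overwrites the second input word; this is
  why a condition \<open>V\<close> on that word is carried along.\<close>

definition performs :: "(bool list \<Rightarrow> bool) \<Rightarrow> com \<Rightarrow> nat list \<Rightarrow> nat \<Rightarrow> nat \<Rightarrow> nat poly \<Rightarrow>
    (bool list \<Rightarrow> bool list \<Rightarrow> nat list \<Rightarrow> bool list) \<Rightarrow> (bool list \<Rightarrow> bool list \<Rightarrow> nat list \<Rightarrow> nat) \<Rightarrow> bool" where
  "performs V c \<rho> r W p F f \<longleftrightarrow> r < W \<and>
     (\<forall>x w y s K. V w \<longrightarrow> W \<le> K \<longrightarrow> (\<forall>j. r \<le> j \<and> j < W \<longrightarrow> s j = 0) \<longrightarrow>
        (let e = map s \<rho>; v = f x w e; n = extent x w e in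
         v \<le> poly p n \<and> runs c (tps x w y s K) (tps x w (y @ F x w e) (s(r := v)) K) (poly p n)))"

text \<open>Quantifying over the places of the arguments and over the first free counter makes
  procedures composable: a caller runs a callee above the counters whose contents it still
  needs.\<close>

definition proc :: "(bool list \<Rightarrow> bool) \<Rightarrow> nat \<Rightarrow> (bool list \<Rightarrow> bool list \<Rightarrow> nat list \<Rightarrow> bool list) \<Rightarrow>
    (bool list \<Rightarrow> bool list \<Rightarrow> nat list \<Rightarrow> nat) \<Rightarrow> bool" where
  "proc V d F f \<longleftrightarrow> (\<forall>\<rho> r. length \<rho> = d \<longrightarrow> set \<rho> \<subseteq> {..<r} \<longrightarrow> (\<exists>c W p. performs V c \<rho> r W p F f))"

definition comp :: "nat \<Rightarrow> (bool list \<Rightarrow> bool list \<Rightarrow> nat list \<Rightarrow> nat) \<Rightarrow> bool" where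
  "comp d f \<longleftrightarrow> proc (\<lambda>w. True) d (\<lambda>x w e. []) f"

definition emit :: "nat \<Rightarrow> (bool list \<Rightarrow> nat list \<Rightarrow> bool list) \<Rightarrow> bool" where
  "emit d F \<longleftrightarrow> proc (\<lambda>w. w = []) d (\<lambda>x w e. F x e) (\<lambda>x w e. 0)"

lemma poly_nat_mono: "a \<le> b \<Longrightarrow> poly (p :: nat poly) a \<le> poly p b"
  by (induction p) (auto intro!: add_mono mult_mono)

lemma procI:
  "(\<And>\<rho> r. length \<rho> = d \<Longrightarrow> set \<rho> \<subseteq> {..<r} \<Longrightarrow> \<exists>c W p. performs V c \<rho> r W p F f) \<Longrightarrow> proc V d F f"
  by (simp add: proc_def)

lemma procE:
  assumes "proc V d F f" "length \<rho> = d" "set \<rho> \<subseteq> {..<r}"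
  obtains c W p where "performs V c \<rho> r W p F f" "r < W"
  using assms unfolding proc_def performs_def by blast

lemma performsD:
  assumes "performs V c \<rho> r W p F f" "V w" "W \<le> K" "\<And>j. r \<le> j \<Longrightarrow> j < W \<Longrightarrow> s j = 0"
    and "extent x w (map s \<rho>) \<le> n" "v = f x w (map s \<rho>)" "y' = y @ F x w (map s \<rho>)"
  shows "v \<le> poly p n \<and> runs c (tps x w y s K) (tps x w y' (s(r := v)) K) (poly p n)"
proof -
  let ?n = "extent x w (map s \<rho>)"
  have "v \<le> poly p ?n \<and> runs c (tps x w y s K) (tps x w y' (s(r := v)) K) (poly p ?n)"
    using assms unfolding performs_def Let_def by blast
  moreover have "poly p ?n \<le> poly p n" by (rule poly_nat_mono[OF assms(5)])
  ultimately show ?thesis using runs_mono le_trans by blast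
qed

lemma ex_performs:
  assumes "r < W"
    and "\<And>x w y s K n v. V w \<Longrightarrow> W \<le> K \<Longrightarrow> (\<And>j. r \<le> j \<Longrightarrow> j < W \<Longrightarrow> s j = 0) \<Longrightarrow>
      n = extent x w (map s \<rho>) \<Longrightarrow> v = f x w (map s \<rho>) \<Longrightarrow>
      v \<le> poly p n \<and> runs c (tps x w y s K) (tps x w (y @ F x w (map s \<rho>)) (s(r := v)) K) (poly p n)"
  shows "\<exists>c W p. performs V c \<rho> r W p F f"
proof -
  have "performs V c \<rho> r W p F f"
    unfolding performs_def Let_def using assms by blast
  then show ?thesis by blast
qed

lemma proc_cong:
  assumes "proc V d F f" "\<And>w. V' w \<Longrightarrow> V w"
    "\<And>x w e. V' w \<Longrightarrow> length e = d \<Longrightarrow> f x w e = g x w e" "\<And>x w e. V' w \<Longrightarrow> length e = d \<Longrightarrow> F x w e = G x w e"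
  shows "proc V' d G g"
proof (rule procI)
  fix \<rho> :: "nat list" and r assume \<rho>: "length \<rho> = d" "set \<rho> \<subseteq> {..<r}"
  obtain c W p where c: "performs V c \<rho> r W p F f" using procE[OF assms(1) \<rho>] .
  have "f x w (map s \<rho>) = g x w (map s \<rho>) \<and> F x w (map s \<rho>) = G x w (map s \<rho>)" if "V' w" for x w s
    using assms(3,4) that \<rho>(1) by simp
  then have "performs V' c \<rho> r W p G g"
    using c assms(2) unfolding performs_def Let_def by metis
  then show "\<exists>c W p. performs V' c \<rho> r W p G g" by blast
qed

lemma map_upd_notin:
  fixes \<rho> :: "nat list"
  assumes "set \<rho> \<subseteq> {..<r}" "r \<le> j"
  shows "map (s(j := v)) \<rho> = map s \<rho>"
proof -
  have "j \<notin> set \<rho>" using assms by (meson lessThan_iff not_le subsetD)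
  then show ?thesis by simp
qed

lemma runs_cong:
  "runs c S (tps x w y s K) t \<Longrightarrow> s = s' \<Longrightarrow> t \<le> t' \<Longrightarrow> runs c S (tps x w y s' K) t'"
  using runs_mono by blast

lemma runs_transfer_tps:
  assumes "distinct ks" "set ks \<subseteq> {..<K}" "j < K" "j \<notin> set ks"
    and "\<And>l. s' l = (if l = j then 0 else if l \<in> set ks then s l + s j else s l)"
  shows "runs (transfer j ks) (tps x w y s K) (tps x w y s' K) (s j * (2 * length ks + 4) + 1)"
proof -
  have "s' = (\<lambda>l. if l = j then 0 else if l \<in> set ks then s l + s j else s l)"
    using assms(5) by (rule ext)
  then show ?thesis unfolding tps_def using runs_transfer[OF assms(1-4)] by simp
qed

lemma runs_inc_tps: "j < K \<Longrightarrow> runs (inc j) (tps x w y s K) (tps x w y (s(j := Suc (s j))) K) 1"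
  and runs_dec_tps: "j < K \<Longrightarrow> runs (dec j) (tps x w y s K) (tps x w y (s(j := s j - 1)) K) 1"
  unfolding tps_def by (rule runs_inc runs_dec; assumption)+

lemma runs_loop_tps:
  assumes "\<And>i. i < n \<Longrightarrow> S i j > 0 \<and> runs c (tps x w (Y i) (S i) K) (tps x w (Y (Suc i)) (S (Suc i)) K) t"
    and "S n j = 0" "j < K"
  shows "runs (loop j c) (tps x w (Y 0) (S 0) K) (tps x w (Y n) (S n) K) (n * (t + 2) + 1)"
  using assms unfolding tps_def by (intro runs_loop[where A = "\<lambda>_. input_tape x"]) auto

lemma comp_rename:
  assumes "comp d f" "length js = d" "set js \<subseteq> {..<d'}"
  shows "comp d' (\<lambda>x w e. f x w (map (\<lambda>j. e ! j) js))"
  unfolding comp_def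
proof (rule procI, goal_cases)
  case (1 \<rho> r)
  let ?\<rho> = "map (\<lambda>j. \<rho> ! j) js"
  have sub: "set ?\<rho> \<subseteq> set \<rho>" using assms 1 by fastforce
  obtain c W p where c: "performs (\<lambda>w. True) c ?\<rho> r W p (\<lambda>x w e. []) f" "r < W"
    by (rule procE[OF assms(1)[unfolded comp_def], of ?\<rho> r]) (use assms 1 sub in auto)
  have eq: "map s ?\<rho> = map (\<lambda>j. map s \<rho> ! j) js" for s :: "nat \<Rightarrow> nat"
    using assms 1 by (auto simp: nth_map subset_iff)
  show ?case
  \<comment> \<open>An index may occur several times in \<open>js\<close>, so the arguments can add
    up to \<open>length js\<close> times their former sum; one more copy of \<open>n\<close> pays
    for the two words.\<close>
  proof (rule ex_performs[where c = c and W = W and p = "pcompose p (smult (Suc (length js)) [:0, 1:])"], goal_cases)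
    case (2 x w y s K n v)
    have mem: "s a \<le> sum_list (map s \<rho>)" if "a \<in> set \<rho>" for a
      using that by (simp add: member_le_sum_list)
    have "sum_list (map s ?\<rho>) \<le> sum_list (map (\<lambda>_. sum_list (map s \<rho>)) ?\<rho>)"
      by (rule sum_list_mono) (use mem sub in blast)
    also have "\<dots> = length js * sum_list (map s \<rho>)"
      by (simp add: sum_list_triv del: map_map)
    finally have "extent x w (map s ?\<rho>) \<le> Suc (length js) * n"
      by (simp add: 2(4) algebra_simps)
    from performsD[OF c(1) 2(1,2,3) this, of v y y] show ?case
      using 2(5) unfolding eq by (auto simp: poly_pcompose mult.commute)
  qed (rule c(2))
qed

lemma comp_const: "comp d (\<lambda>x w e. k)"
  unfolding comp_def
proof (rule procI, induction k)
  case (0 \<rho> r)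
  show ?case
  proof (rule ex_performs[where c = Done and W = "Suc r" and p = 0], goal_cases)
    case (2 x w y s K n v)
    then have "s(r := v) = s" by auto
    then show ?case using 2(5) runs_Done by simp
  qed simp
next
  case (Suc k \<rho> r)
  obtain c W p where c: "performs (\<lambda>w. True) c \<rho> r W p (\<lambda>x w e. []) (\<lambda>x w e. k)"
    using Suc.IH[OF Suc.prems] by blast
  then have rW: "r < W" by (simp add: performs_def)
  show ?case
  proof (rule ex_performs[where c = "Seq c (inc r)" and W = W and p = "p + [:2:]"], goal_cases)
    case (2 x w y s K n v)
    have d: "k \<le> poly p n" "runs c (tps x w y s K) (tps x w y (s(r := k)) K) (poly p n)"
      using performsD[OF c 2(1,2,3) eq_refl[OF 2(4)[symmetric]] refl refl, of y] by auto
    have "runs (Seq c (inc r)) (tps x w y s K) (tps x w y ((s(r := k))(r := Suc ((s(r := k)) r))) K) (poly p n + 1 + 1)"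
      using rW 2(2) by (intro runs_Seq[OF d(2) runs_inc_tps]) simp_all
    then show ?case
      using d(1) 2(5) by simp
  qed (rule rW)
qed

text \<open>A counter can be read only by emptying it. It is drained into two fresh counters, one of
  which is drained back.\<close>

lemma comp_var:
  assumes "j < d"
  shows "comp d (\<lambda>x w e. e ! j)"
  unfolding comp_def
proof (rule procI, goal_cases)
  case (1 \<rho> r)
  define a where "a = \<rho> ! j"
  have a: "a < r" "a \<in> set \<rho>" using 1 assms by (auto simp: a_def subset_iff)
  show ?case
  proof (rule ex_performs[where c = "Seq (transfer a [r, r + 1]) (transfer (r + 1) [a])" and W = "r + 2" and p = "[:3, 14:]"],
      goal_cases)
    case (2 x w y s K n v)
    have v: "v = s a" using assms 1 2(5) by (simp add: a_def)
    have le: "s a \<le> n" using member_le_sum_list[of "s a" "map s \<rho>"] a 2(4) by auto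
    have z: "s r = 0" "s (r + 1) = 0" using 2(3) by auto
    let ?s = "s(a := 0, r := v, r + 1 := v)"
    have 3: "runs (transfer a [r, r + 1]) (tps x w y s K) (tps x w y ?s K) (s a * (2 * length [r, r + 1] + 4) + 1)"
      by (rule runs_transfer_tps) (use 2(2) z a v in auto)
    have 4: "runs (transfer (r + 1) [a]) (tps x w y ?s K) (tps x w y (s(r := v)) K) (?s (r + 1) * (2 * length [a] + 4) + 1)"
      by (rule runs_transfer_tps) (use 2(2) z a v in auto)
    show ?case
      using runs_mono[OF runs_Seq[OF 3 4]] le v by simp
  qed simp
qed

text \<open>The value of \<open>f\<close> rests in counter \<open>r\<close> while \<open>g\<close>
  works from \<open>r + 1\<close> on; \<open>op\<close> then merges both counters. The condition
  \<open>h a b \<le> a + b\<close> keeps the result polynomially bounded.\<close>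

lemma proc_binary:
  assumes f: "proc V d F f" and g: "proc V d G g" and le: "\<And>a b. h a b \<le> a + b"
    and op: "\<And>r x w y s K. r + 1 < K \<Longrightarrow>
      runs (op r) (tps x w y s K) (tps x w y (s(r := h (s r) (s (r + 1)), r + 1 := 0)) K) (6 * s (r + 1) + 1)"
  shows "proc V d (\<lambda>x w e. F x w e @ G x w e) (\<lambda>x w e. h (f x w e) (g x w e))"
proof (rule procI, goal_cases)
  case (1 \<rho> r)
  obtain c1 W1 p1 where c1: "performs V c1 \<rho> r W1 p1 F f" "r < W1" using procE[OF f 1] .
  obtain c2 W2 p2 where c2: "performs V c2 \<rho> (r + 1) W2 p2 G g" "r + 1 < W2"
    by (rule procE[OF g 1(1), of "r + 1"]) (use 1 in auto)
  let ?c = "Seq c1 (Seq c2 (op r))" and ?p = "p1 + smult 7 p2 + [:3:]"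
  show ?case
  proof (rule ex_performs[where c = ?c and W = "max W1 W2" and p = ?p], goal_cases)
    case (2 x w y s K n v)
    define v1 where "v1 = f x w (map s \<rho>)"
    define v2 where "v2 = g x w (map s \<rho>)"
    define y1 where "y1 = y @ F x w (map s \<rho>)"
    define y2 where "y2 = y1 @ G x w (map s \<rho>)"
    have m: "map (s(r := a)) \<rho> = map s \<rho>" for a using 1 by (simp add: map_upd_notin)
    have z: "s (r + 1) = 0" using 2(3)[of "r + 1"] c2(2) by auto
    have d1: "v1 \<le> poly p1 n \<and> runs c1 (tps x w y s K) (tps x w y1 (s(r := v1)) K) (poly p1 n)"
      by (rule performsD[OF c1(1) 2(1)]) (use 2 in \<open>auto simp: v1_def y1_def\<close>)
    have d2: "v2 \<le> poly p2 n \<and>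
        runs c2 (tps x w y1 (s(r := v1)) K) (tps x w y2 (s(r := v1, r + 1 := v2)) K) (poly p2 n)"
      by (rule performsD[OF c2(1) 2(1)]) (use 2 in \<open>auto simp: m v2_def y2_def\<close>)
    have "runs (op r) (tps x w y2 (s(r := v1, r + 1 := v2)) K) (tps x w y2 (s(r := v)) K) (6 * v2 + 1)"
      by (rule runs_cong[OF op]) (use 2 c2(2) z in \<open>auto simp: fun_eq_iff v1_def v2_def\<close>)
    with d1 d2 have "runs ?c (tps x w y s K) (tps x w y2 (s(r := v)) K) (poly p1 n + (poly p2 n + (6 * v2 + 1) + 1) + 1)"
      by (intro runs_Seq[of c1 _ "tps x w y1 (s(r := v1)) K"] runs_Seq[of c2 _ "tps x w y2 (s(r := v1, r + 1 := v2)) K"]) auto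
    moreover have "v \<le> v1 + v2" using le 2(5) by (simp add: v1_def v2_def)
    ultimately show ?case
      using runs_mono[of ?c "tps x w y s K" _ _ "poly ?p n"] d1 d2 by (simp add: y2_def y1_def)
  qed (use c1(2) in simp)
qed

lemma proc_plus:
  assumes "proc V d F f" "proc V d G g"
  shows "proc V d (\<lambda>x w e. F x w e @ G x w e) (\<lambda>x w e. f x w e + g x w e)"
proof (rule proc_binary[OF assms, where op = "\<lambda>r. transfer (r + 1) [r]"])
  fix r x w y s K assume "r + 1 < (K :: nat)"
  then show "runs (transfer (r + 1) [r]) (tps x w y s K) (tps x w y (s(r := s r + s (r + 1), r + 1 := 0)) K) (6 * s (r + 1) + 1)"
    using runs_transfer_tps[of "[r]" K "r + 1" "s(r := s r + s (r + 1), r + 1 := 0)" s]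
    by (simp add: mult.commute)
qed simp

lemma comp_plus: "comp d f \<Longrightarrow> comp d g \<Longrightarrow> comp d (\<lambda>x w e. f x w e + g x w e)"
  unfolding comp_def using proc_plus[of _ d "\<lambda>x w e. []" f "\<lambda>x w e. []" g] by simp

lemma emit_append: "emit d F \<Longrightarrow> emit d G \<Longrightarrow> emit d (\<lambda>x e. F x e @ G x e)"
  unfolding emit_def using proc_plus[of _ d "\<lambda>x w e. F x e" "\<lambda>x w e. 0" "\<lambda>x w e. G x e" "\<lambda>x w e. 0"] by simp

lemma comp_minus:
  assumes "comp d f" "comp d g"
  shows "comp d (\<lambda>x w e. f x w e - g x w e)"
proof -
  let ?op = "\<lambda>r. loop (r + 1) (Seq (dec (r + 1)) (dec r))"
  have "runs (?op r) (tps x w y s K) (tps x w y (s(r := s r - s (r + 1), r + 1 := 0)) K) (6 * s (r + 1) + 1)"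
    if "r + 1 < K" for r x w y s K
  proof -
    let ?S = "\<lambda>i. s(r := s r - i, r + 1 := s (r + 1) - i)"
    have "runs (Seq (dec (r + 1)) (dec r)) (tps x w y (?S i) K) (tps x w y (?S (Suc i)) K) (1 + 1 + 1)" for i
      by (rule runs_cong[OF runs_Seq[OF runs_dec_tps runs_dec_tps]]) (use that in \<open>auto simp: fun_eq_iff\<close>)
    then have "runs (?op r) (tps x w y (?S 0) K) (tps x w y (?S (s (r + 1))) K) (s (r + 1) * (1 + 1 + 1 + 2) + 1)"
      by (intro runs_loop_tps[of "s (r + 1)" ?S "r + 1" _ x w "\<lambda>_. y"]) (use that in auto)
    moreover have "?S 0 = s" by auto
    ultimately show ?thesis by (simp add: runs_mono)
  qed
  from proc_binary[OF assms[unfolded comp_def], where h = "\<lambda>a b. a - b", OF _ this]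
  show ?thesis by (simp add: comp_def)
qed

text \<open>The source of all iteration: the number of rounds is computed before the loop starts,
  which keeps the running time polynomial. Counter \<open>r\<close> accumulates the sum,
  \<open>r + 1\<close> counts down, \<open>r + 2\<close> holds the index that the body receives as
  an additional argument, and \<open>r + 3\<close> takes the value of the body.\<close>

lemma proc_loop:
  assumes b: "proc V d (\<lambda>x w e. []) b" and f: "proc V (Suc d) F f"
  shows "proc V d (\<lambda>x w e. concat (map (\<lambda>i. F x w (e @ [i])) [0..<b x w e])) (\<lambda>x w e. \<Sum>i<b x w e. f x w (e @ [i]))"
proof (rule procI, goal_cases)
  case (1 \<rho> r)
  obtain c1 W1 p1 where c1: "performs V c1 \<rho> (r + 1) W1 p1 (\<lambda>x w e. []) b"
    by (rule procE[OF b 1(1), of "r + 1"]) (use 1 in auto)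
  obtain c2 W2 p2 where c2: "performs V c2 (\<rho> @ [r + 2]) (r + 3) W2 p2 F f" "r + 3 < W2"
    by (rule procE[OF f, of "\<rho> @ [r + 2]" "r + 3"]) (use 1 in auto)
  let ?b = "Seq (dec (r + 1)) (Seq c2 (Seq (transfer (r + 3) [r]) (inc (r + 2))))"
  let ?c = "Seq c1 (Seq (loop (r + 1) ?b) (transfer (r + 2) []))"
  \<comment> \<open>The index stays below the number of rounds, which \<open>p1\<close> bounds, so
    the body sees an extent of at most \<open>n + poly p1 n\<close>.\<close>
  let ?q = "pcompose p2 ([:0, 1:] + p1)"
  let ?p = "smult 13 p1 + smult 7 (p1 * ?q) + [:4:]"
  show ?case
  proof (rule ex_performs[where c = ?c and W = "max W1 W2" and p = ?p], goal_cases)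
    case (2 x w y s K n v)
    define B where "B = b x w (map s \<rho>)"
    define g where "g i = f x w (map s \<rho> @ [i])" for i
    define H where "H i = F x w (map s \<rho> @ [i])" for i
    have rK: "r + 3 < K" using 2(2) c2(2) by auto
    have z: "s r = 0" "s (r + 1) = 0" "s (r + 2) = 0" "s (r + 3) = 0"
      using 2(3) c2(2) by auto
    have d1: "B \<le> poly p1 n \<and> runs c1 (tps x w y s K) (tps x w y (s(r + 1 := B)) K) (poly p1 n)"
      by (rule performsD[OF c1 2(1)]) (use 2 in \<open>auto simp: B_def\<close>)
    let ?F = "poly ?q n"
    let ?S = "\<lambda>i. s(r := \<Sum>j<i. g j, r + 1 := B - i, r + 2 := i)" and ?Y = "\<lambda>i. y @ concat (map H [0..<i])"
    have body: "g i \<le> ?F \<and> runs ?b (tps x w (?Y i) (?S i) K) (tps x w (?Y (Suc i)) (?S (Suc i)) K) (7 * ?F + 6)"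
      if "i < B" for i
    proof -
      let ?s = "s(r := \<Sum>j<i. g j, r + 1 := B - Suc i, r + 2 := i)"
      have m: "map ?s (\<rho> @ [r + 2]) = map s \<rho> @ [i]" using 1 by (simp add: map_upd_notin)
      have 3: "runs (dec (r + 1)) (tps x w (?Y i) (?S i) K) (tps x w (?Y i) ?s K) 1"
        by (rule runs_cong[OF runs_dec_tps]) (use rK in \<open>auto simp: fun_eq_iff\<close>)
      have d2: "g i \<le> poly p2 (n + poly p1 n) \<and>
          runs c2 (tps x w (?Y i) ?s K) (tps x w (?Y (Suc i)) (?s(r + 3 := g i)) K) (poly p2 (n + poly p1 n))"
        by (rule performsD[OF c2(1) 2(1)], unfold m) (use 2 d1 that in \<open>auto simp: g_def H_def\<close>)
      have 4: "runs (transfer (r + 3) [r]) (tps x w (?Y (Suc i)) (?s(r + 3 := g i)) K)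
         (tps x w (?Y (Suc i)) (?s(r := \<Sum>j<Suc i. g j)) K) (g i * (2 * length [r] + 4) + 1)"
        by (rule runs_cong[OF runs_transfer_tps]) (use rK z in auto)
      have 5: "runs (inc (r + 2)) (tps x w (?Y (Suc i)) (?s(r := \<Sum>j<Suc i. g j)) K) (tps x w (?Y (Suc i)) (?S (Suc i)) K) 1"
        by (rule runs_cong[OF runs_inc_tps]) (use rK in \<open>auto simp: fun_eq_iff\<close>)
      show ?thesis
        using runs_mono[OF runs_Seq[OF 3 runs_Seq[OF conjunct2[OF d2] runs_Seq[OF 4 5]]], of "7 * ?F + 6"] d2
        by (simp add: poly_pcompose)
    qed
    then have "runs (loop (r + 1) ?b) (tps x w (?Y 0) (?S 0) K) (tps x w (?Y B) (?S B) K) (B * (7 * ?F + 6 + 2) + 1)"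
      by (intro runs_loop_tps[of B ?S "r + 1" _ x w ?Y K]) (use rK in auto)
    moreover have "?S 0 = s(r + 1 := B)" using z by (auto simp: fun_eq_iff)
    ultimately have 3: "runs (loop (r + 1) ?b) (tps x w y (s(r + 1 := B)) K) (tps x w (?Y B) (?S B) K) (B * (7 * ?F + 8) + 1)"
      by (simp add: add.commute)
    have v: "v = (\<Sum>i<B. g i)" using 2(5) by (simp add: g_def B_def)
    have 4: "runs (transfer (r + 2) []) (tps x w (?Y B) (?S B) K) (tps x w (?Y B) (s(r := v)) K) (B * (2 * length [] + 4) + 1)"
      by (rule runs_cong[OF runs_transfer_tps]) (use rK z v in auto)
    note run = runs_Seq[OF conjunct2[OF d1] runs_Seq[OF 3 4]]
    have "v \<le> B * ?F"
      using sum_mono[of "{..<B}" g "\<lambda>_. ?F"] body by (simp add: v)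
    then have "v \<le> poly ?p n"
      using order_trans[OF _ mult_le_mono1[OF conjunct1[OF d1]], of v ?F] by simp
    moreover have "poly p1 n + (B * (7 * ?F + 8) + 1 + (B * (2 * length [] + 4) + 1) + 1) + 1 \<le> poly ?p n"
      using mult_le_mono1[OF conjunct1[OF d1], of "7 * ?F + 12"] by (simp add: algebra_simps)
    ultimately show ?case
      using runs_mono[OF run] unfolding H_def B_def by blast
  qed (use c2(2) in simp)
qed

lemma comp_sum:
  assumes "comp d b" "comp (Suc d) f"
  shows "comp d (\<lambda>x w e. \<Sum>i<b x w e. f x w (e @ [i]))"
  unfolding comp_def by (rule proc_cong[OF proc_loop[OF assms[unfolded comp_def]]]) simp_all

lemma emit_loop:
  assumes "comp d b" "emit (Suc d) F"
  shows "emit d (\<lambda>x e. concat (map (\<lambda>i. F x (e @ [i])) [0..<b x [] e]))"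
proof -
  have "proc (\<lambda>w. w = []) d (\<lambda>x w e. []) b"
    by (rule proc_cong[OF assms(1)[unfolded comp_def]]) simp_all
  then show ?thesis
    unfolding emit_def by (rule proc_cong[OF proc_loop[OF _ assms(2)[unfolded emit_def]]]) auto
qed

section \<open>Reading and writing single bits of words\<close>

definition move_tape :: "tape \<Rightarrow> nat \<Rightarrow> tape" where
  "move_tape a k = (fst a, snd a + int k)"

text \<open>Between procedures the heads of the word tapes are at rest. This describes the moments
  when the head of tape 0 (for \<open>i = 0\<close>) or of tape 1 (otherwise) is \<open>k\<close>
  cells to the right of its resting place.\<close>

definition moved :: "nat \<Rightarrow> tape \<Rightarrow> tape \<Rightarrow> nat \<Rightarrow> (nat \<Rightarrow> nat) \<Rightarrow> nat \<Rightarrow> tape list" where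
  "moved i a b k s K = (if i = 0 then tapes (move_tape a k) b s K else tapes a (move_tape b k) s K)"

abbreviation symbols_ok :: "tape \<Rightarrow> bool" where
  "symbols_ok a \<equiv> \<forall>p. fst a p < 3"

lemma symbols_ok_input [simp]: "symbols_ok (input_tape x)" "symbols_ok (word_tape y w)"
proof -
  have "bit_symbol c < 3" for c by (cases c) auto
  then show "symbols_ok (input_tape x)" "symbols_ok (word_tape y w)"
    by (auto simp: input_tape_def word_tape_def)
qed

lemma act_move_tape:
  assumes "symbols_ok a"
  shows "act_on_tape (read_tape (move_tape a k) mod 3, Move_Right) (move_tape a k) = move_tape a (Suc k)"
    "act_on_tape (read_tape (move_tape a (Suc k)) mod 3, Move_Left) (move_tape a (Suc k)) = move_tape a k"
  using assms by (cases a; auto simp: move_tape_def)+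

lemma runs_shift:
  assumes "symbols_ok a" "symbols_ok b" "i < 2"
  shows "runs (shift i Move_Right) (moved i a b k s K) (moved i a b (Suc k) s K) 1"
    "runs (shift i Move_Left) (moved i a b (Suc k) s K) (moved i a b k s K) 1"
proof -
  have "runs (shift i d) S (S[i := act_on_tape (read_tape (S ! i) mod 3, d) (S ! i)]) 1"
    if "length S = K + 2" for d S
    using runs_Act[of i S "\<lambda>ss. (ss ! i, d)"] assms(3) that by (simp add: shift_def)
  note * = this[of "moved i a b k s K" Move_Right] this[of "moved i a b (Suc k) s K" Move_Left]
  show "runs (shift i Move_Right) (moved i a b k s K) (moved i a b (Suc k) s K) 1"
    "runs (shift i Move_Left) (moved i a b (Suc k) s K) (moved i a b k s K) 1"
    using * assms by (auto simp: moved_def act_move_tape tapes_update_01 less_2_cases_iff)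
qed

lemma runs_inc_if:
  assumes "j < K" "i < 2" "s j = 0"
  shows "runs (inc_if i j) (moved i a b k s K)
    (moved i a b k (s(j := of_bool (fst (if i = 0 then a else b) (snd (if i = 0 then a else b) + int k) = 2))) K) 1"
proof -
  have "runs (inc_if i j) S (S[j + 2 := act_on_tape
     (read_tape (S ! (j + 2)) mod 3, if read_tape (S ! i) = 2 then Move_Right else Stay) (S ! (j + 2))]) 1"
    if "length S = K + 2" for S
    using runs_Act[of "j + 2" S "\<lambda>ss. (ss ! (j + 2), if ss ! i = 2 then Move_Right else Stay)"] assms that
    by (simp add: inc_if_def)
  note * = this[of "moved i a b k s K"]
  show ?thesis
    using * assms act_counter_tape[of "s j"]
    by (cases a; cases b) (auto simp: moved_def tapes_update less_2_cases_iff move_tape_def)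
qed

lemma runs_loop_moved:
  assumes "\<And>k. k < n \<Longrightarrow> S k j > 0 \<and> runs c (moved i a b (P k) (S k) K) (moved i a b (P (Suc k)) (S (Suc k)) K) t"
    and "S n j = 0" "j < K"
  shows "runs (loop j c) (moved i a b (P 0) (S 0) K) (moved i a b (P n) (S n) K) (n * (t + 2) + 1)"
proof -
  have rd: "map read_tape (moved i a b k s K) ! Suc (Suc j) = (if s j = 0 then 1 else 0)" for k s
    using assms(3) by (auto simp: moved_def)
  show ?thesis
    unfolding loop_def
    by (rule runs_While_iterate[of n _ "\<lambda>k. moved i a b (P k) (S k) K"]) (use assms in \<open>auto simp: rd simp del: nth_map\<close>)
qed

lemma runs_inc_moved: "j < K \<Longrightarrow> runs (inc j) (moved i a b k s K) (moved i a b k (s(j := Suc (s j))) K) 1"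
  and runs_dec_moved: "j < K \<Longrightarrow> runs (dec j) (moved i a b k s K) (moved i a b k (s(j := s j - 1)) K) 1"
  unfolding moved_def using runs_inc runs_dec by auto

lemma runs_cong_moved:
  "runs c S (moved i a b k s K) t \<Longrightarrow> s = s' \<Longrightarrow> runs c S (moved i a b k s' K) t"
  by simp

lemma moved_0: "moved i a b 0 s K = tapes a b s K"
  by (simp add: moved_def move_tape_def)


lemma runs_move:
  assumes step: "\<And>k s. k < v \<Longrightarrow> runs (shift i m) (moved i a b (P k) s K) (moved i a b (P (Suc k)) s K) 1"
    and "r < K" "l < K" "r \<noteq> l" "s r = v" "s l = 0"
  shows "runs (loop r (Seq (dec r) (Seq (inc l) (shift i m)))) (moved i a b (P 0) s K)
    (moved i a b (P v) (s(r := 0, l := v)) K) (7 * v + 1)"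
proof -
  let ?S = "\<lambda>k. s(r := v - k, l := k)"
  have "runs (Seq (dec r) (Seq (inc l) (shift i m))) (moved i a b (P k) (?S k) K) (moved i a b (P (Suc k)) (?S (Suc k)) K)
      (1 + (1 + 1 + 1) + 1)" if k: "k < v" for k
  proof -
    have 1: "runs (dec r) (moved i a b (P k) (?S k) K) (moved i a b (P k) (s(r := v - Suc k, l := k)) K) 1"
      by (rule runs_cong_moved[OF runs_dec_moved]) (use assms in \<open>auto simp: fun_eq_iff\<close>)
    have 2: "runs (inc l) (moved i a b (P k) (s(r := v - Suc k, l := k)) K) (moved i a b (P k) (?S (Suc k)) K) 1"
      by (rule runs_cong_moved[OF runs_inc_moved]) (use assms in \<open>auto simp: fun_eq_iff\<close>)
    show ?thesis by (rule runs_Seq[OF 1 runs_Seq[OF 2 step[OF k]]])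
  qed
  then have "runs (loop r (Seq (dec r) (Seq (inc l) (shift i m)))) (moved i a b (P 0) (?S 0) K)
     (moved i a b (P v) (?S v) K) (v * (1 + (1 + 1 + 1) + 1 + 2) + 1)"
    by (intro runs_loop_moved[of v ?S r _ i a b P K]) (use assms in auto)
  moreover have "?S 0 = s" using assms by (auto simp: fun_eq_iff)
  moreover have "?S v = s(r := 0, l := v)" by simp
  ultimately show ?thesis using runs_mono[where m = "7 * v + 1"] by simp
qed

lemma runs_move_back:
  assumes "symbols_ok a" "symbols_ok b" "i < 2" "r < K" "l < K" "r \<noteq> l" "s r = v" "s l = 0"
  shows "runs (loop r (Seq (dec r) (Seq (inc l) (shift i Move_Left)))) (moved i a b v s K)
    (tapes a b (s(r := 0, l := v)) K) (7 * v + 1)"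
proof -
  have "runs (shift i Move_Left) (moved i a b (v - k) s K) (moved i a b (v - Suc k) s K) 1" if "k < v" for k s
    using runs_shift(2)[OF assms(1-3), of "v - Suc k" s K] that by (simp add: Suc_diff_Suc)
  from runs_move[where P = "\<lambda>k. v - k", OF this assms(4-8)] show ?thesis by (simp add: moved_0)
qed

text \<open>Counter \<open>r\<close> serves as an address: it is emptied while the head walks right,
  and \<open>r + 1\<close> records the way back. The bit then replaces the address in
  \<open>r\<close>, whose copy is left in \<open>r + 2\<close> for the caller to clear.\<close>

definition read_bit :: "nat \<Rightarrow> nat \<Rightarrow> com" where
  "read_bit i r =
     Seq (loop r (Seq (dec r) (Seq (inc (r + 1)) (shift i Move_Right))))
       (Seq (inc_if i r) (loop (r + 1) (Seq (dec (r + 1)) (Seq (inc (r + 2)) (shift i Move_Left)))))"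

lemma runs_read_bit:
  assumes "symbols_ok a" "symbols_ok b" "i < 2" "r + 2 < K" "s r = v" "s (r + 1) = 0" "s (r + 2) = 0"
  shows "runs (read_bit i r) (tapes a b s K)
    (tapes a b (s(r := of_bool (fst (if i = 0 then a else b) (snd (if i = 0 then a else b) + int v) = 2), r + 2 := v)) K)
    (14 * v + 5)"
proof -
  define z :: nat where "z = of_bool (fst (if i = 0 then a else b) (snd (if i = 0 then a else b) + int v) = 2)"
  have 1: "runs (loop r (Seq (dec r) (Seq (inc (r + 1)) (shift i Move_Right)))) (moved i a b 0 s K)
    (moved i a b v (s(r := 0, r + 1 := v)) K) (7 * v + 1)"
    by (rule runs_move[where P = "\<lambda>k. k", OF runs_shift(1)]) (use assms in auto)
  have 2: "runs (inc_if i r) (moved i a b v (s(r := 0, r + 1 := v)) K) (moved i a b v (s(r := z, r + 1 := v)) K) 1"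
    using runs_inc_if[of r K i "s(r := 0, r + 1 := v)" a b v] assms
    unfolding z_def[symmetric] by (simp add: fun_upd_twist)
  have 3: "runs (loop (r + 1) (Seq (dec (r + 1)) (Seq (inc (r + 2)) (shift i Move_Left)))) (moved i a b v (s(r := z, r + 1 := v)) K)
     (tapes a b ((s(r := z, r + 1 := v))(r + 1 := 0, r + 2 := v)) K) (7 * v + 1)"
    by (rule runs_move_back) (use assms in auto)
  have eq: "(s(r := z, r + 1 := v))(r + 1 := 0, r + 2 := v) = s(r := z, r + 2 := v)"
    using assms by (auto simp: fun_eq_iff)
  have "runs (read_bit i r) (moved i a b 0 s K) (tapes a b (s(r := z, r + 2 := v)) K) (7 * v + 1 + (1 + (7 * v + 1) + 1) + 1)"
    unfolding read_bit_def using runs_Seq[OF 1 runs_Seq[OF 2 3]] unfolding eq .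
  then show ?thesis unfolding z_def moved_0 by (rule runs_mono) simp
qed

text \<open>Positions beyond the end count as False, which agrees with the tape: a blank there is
  different from symbol 2.\<close>

definition bit_at :: "bool list \<Rightarrow> nat \<Rightarrow> bool" where
  "bit_at b v \<longleftrightarrow> v < length b \<and> b ! v"

lemma bit_symbol_2: "bit_symbol c = 2 \<longleftrightarrow> c"
  by (cases c) auto

lemma read_input_bit: "fst (input_tape x) (int v) = 2 \<longleftrightarrow> bit_at x v"
  by (auto simp: input_tape_def bit_at_def bit_symbol_2)

lemma read_word_bit: "fst (word_tape y w) (int (length y) + int v) = 2 \<longleftrightarrow> bit_at w v"
proof -
  have "fst (word_tape y w) (int (length y) + int v) = fst (input_tape (y @ w)) (int (length y + v))"
    by (simp add: word_tape_def)
  then show ?thesis by (simp only: read_input_bit) (simp add: bit_at_def nth_append)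
qed


lemma comp_bit_aux:
  fixes i :: nat
  assumes "comp d f" "i < 2"
  shows "comp d (\<lambda>x w e. of_bool (bit_at (if i = 0 then x else w) (f x w e)))"
  unfolding comp_def
proof (rule procI, goal_cases)
  case (1 \<rho> r)
  obtain c W p where c: "performs (\<lambda>w. True) c \<rho> r W p (\<lambda>x w e. []) f"
    using procE[OF assms(1)[unfolded comp_def] 1] .
  let ?c = "Seq c (Seq (read_bit i r) (transfer (r + 2) []))"
  show ?case
  proof (rule ex_performs[where c = ?c and W = "max W (r + 3)" and p = "smult 19 p + [:8:]"], goal_cases)
    case (2 x w y s K n v)
    define u where "u = f x w (map s \<rho>)"
    have z: "s (r + 1) = 0" "s (r + 2) = 0" and K: "r + 2 < K" using 2(2,3) by auto
    have d: "u \<le> poly p n \<and> runs c (tps x w y s K) (tps x w y (s(r := u)) K) (poly p n)"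
      by (rule performsD[OF c 2(1)]) (use 2 in \<open>auto simp: u_def\<close>)
    let ?T = "if i = 0 then input_tape x else word_tape y w"
    have "snd (input_tape x) = 0" "snd (word_tape y w) = int (length y)"
      by (simp_all add: input_tape_def word_tape_def)
    then have "of_bool (fst ?T (snd ?T + int u) = 2) = v"
      using 2(5) by (simp add: read_input_bit read_word_bit u_def)
    then have 3: "runs (read_bit i r) (tps x w y (s(r := u)) K) (tps x w y (s(r := v, r + 2 := u)) K) (14 * u + 5)"
      using runs_read_bit[of "input_tape x" "word_tape y w" i r K "s(r := u)" u] K z assms(2)
      unfolding tps_def by auto
    have 4: "runs (transfer (r + 2) []) (tps x w y (s(r := v, r + 2 := u)) K) (tps x w y (s(r := v)) K) (u * (2 * length [] + 4) + 1)"
      by (rule runs_cong[OF runs_transfer_tps]) (use K z in auto)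
    show ?case
      using runs_mono[OF runs_Seq[OF conjunct2[OF d] runs_Seq[OF 3 4]]] d 2(5) by simp
  qed simp
qed

lemma comp_input_bit: "comp d f \<Longrightarrow> comp d (\<lambda>x w e. of_bool (bit_at x (f x w e)))"
  and comp_word_bit: "comp d f \<Longrightarrow> comp d (\<lambda>x w e. of_bool (bit_at w (f x w e)))"
  using comp_bit_aux[of d f 0] comp_bit_aux[of d f 1] by simp_all

text \<open>Bits are never represented by blanks, so counter \<open>r\<close> can follow the head up
  to the first blank cell; the head is then led back, after which the length sits in
  \<open>r + 1\<close>.\<close>

lemma comp_length: "comp d (\<lambda>x w e. length x)"
  unfolding comp_def
proof (rule procI, goal_cases)
  case (1 \<rho> r)
  let ?w = "While (\<lambda>ss. ss ! 0 \<noteq> 0) (Seq (inc r) (shift 0 Move_Right))"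
  let ?c = "Seq ?w (Seq (loop r (Seq (dec r) (Seq (inc (r + 1)) (shift 0 Move_Left)))) (transfer (r + 1) [r]))"
  show ?case
  proof (rule ex_performs[where c = ?c and W = "r + 2" and p = "[:5, 18:]"], goal_cases)
    case (2 x w y s K n v)
    have z: "s r = 0" "s (r + 1) = 0" and K: "r + 1 < K" using 2(2,3) by auto
    let ?a = "input_tape x" and ?b = "word_tape y w" and ?S = "\<lambda>k. s(r := k)"
    have "runs (Seq (inc r) (shift 0 Move_Right)) (moved 0 ?a ?b k (?S k) K) (moved 0 ?a ?b (Suc k) (?S (Suc k)) K) (1 + 1 + 1)" for k
    proof -
      have "runs (inc r) (moved 0 ?a ?b k (?S k) K) (moved 0 ?a ?b k (?S (Suc k)) K) 1"
        by (rule runs_cong_moved[OF runs_inc_moved]) (use K in auto)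
      then show ?thesis by (rule runs_Seq[OF _ runs_shift(1)]) simp_all
    qed
    moreover have "read_tape (move_tape ?a k) \<noteq> 0 \<longleftrightarrow> k < length x" for k
    proof -
      have "bit_symbol c \<noteq> 0" for c by (cases c) auto
      then show ?thesis by (auto simp: move_tape_def input_tape_def)
    qed
    ultimately have "runs ?w (moved 0 ?a ?b 0 (?S 0) K) (moved 0 ?a ?b v (?S v) K) (v * (1 + 1 + 1 + 2) + 1)"
      using 2(5) by (intro runs_While_iterate[of v _ "\<lambda>k. moved 0 ?a ?b k (?S k) K"]) (auto simp: moved_def)
    moreover have "?S 0 = s" using z by (auto simp: fun_eq_iff)
    ultimately have 3: "runs ?w (tps x w y s K) (moved 0 ?a ?b v (?S v) K) (v * (1 + 1 + 1 + 2) + 1)"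
      by (simp add: moved_0 tps_def)
    have 4: "runs (loop r (Seq (dec r) (Seq (inc (r + 1)) (shift 0 Move_Left)))) (moved 0 ?a ?b v (?S v) K)
       (tps x w y ((?S v)(r := 0, r + 1 := v)) K) (7 * v + 1)"
      unfolding tps_def by (rule runs_move_back) (use K z in auto)
    have 5: "runs (transfer (r + 1) [r]) (tps x w y ((?S v)(r := 0, r + 1 := v)) K) (tps x w y (s(r := v)) K) (v * (2 * length [r] + 4) + 1)"
      by (rule runs_cong[OF runs_transfer_tps]) (use K z in auto)
    show ?case
      using runs_mono[OF runs_Seq[OF 3 runs_Seq[OF 4 5]]] 2(4,5) by simp
  qed simp
qed

definition write_bit :: "nat \<Rightarrow> com" where
  "write_bit r = Act 1 (\<lambda>ss. (if ss ! (r + 2) = 1 then 1 else 2, Move_Right))"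

lemma runs_write_bit:
  assumes "r < K"
  shows "runs (write_bit r) (tps x [] y s K) (tps x [] (y @ [s r \<noteq> 0]) s K) 1"
proof -
  have "act_on_tape (bit_symbol (s r \<noteq> 0), Move_Right) (word_tape y []) = word_tape (y @ [s r \<noteq> 0]) []"
    by (auto simp: word_tape_def input_tape_def fun_eq_iff nth_append)
  then have "act_on_tape (if s r = 0 then 1 else 2, Move_Right) (word_tape y []) = word_tape (y @ [s r \<noteq> 0]) []"
    by (cases "s r = 0") simp_all
  then show ?thesis
    using runs_Act[of 1 "tps x [] y s K" "\<lambda>ss. (if ss ! (r + 2) = 1 then 1 else 2, Move_Right)"] assms
    by (auto simp: tps_def tapes_update_01 write_bit_def split: if_splits)
qed


lemma emit_bit:
  assumes "comp d (\<lambda>x w e. of_bool (P x w e))"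
  shows "emit d (\<lambda>x e. [P x [] e])"
  unfolding emit_def
proof (rule procI, goal_cases)
  case (1 \<rho> r)
  obtain c W p where c: "performs (\<lambda>w. True) c \<rho> r W p (\<lambda>x w e. []) (\<lambda>x w e. of_bool (P x w e))" "r < W"
    using procE[OF assms[unfolded comp_def] 1] .
  let ?c = "Seq c (Seq (write_bit r) (transfer r []))"
  show ?case
  proof (rule ex_performs[where c = ?c and W = W and p = "p + [:8:]"], goal_cases)
    case (2 x w y s K n v)
    define b where "b = P x [] (map s \<rho>)"
    have d: "of_bool b \<le> poly p n \<and> runs c (tps x [] y s K) (tps x [] y (s(r := of_bool b)) K) (poly p n)"
      by (rule performsD[OF c(1) TrueI 2(2,3)]) (use 2 in \<open>auto simp: b_def\<close>)
    have 3: "runs (write_bit r) (tps x [] y (s(r := of_bool b)) K) (tps x [] (y @ [b]) (s(r := of_bool b)) K) 1"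
      using runs_write_bit[of r K x y "s(r := of_bool b)"] c(2) 2(2) by simp
    have "s r = 0" using 2(3) c(2) by auto
    then have 4: "runs (transfer r []) (tps x [] (y @ [b]) (s(r := of_bool b)) K) (tps x [] (y @ [b]) (s(r := 0)) K) (4 * 1 + 1)"
      by (intro runs_cong[OF runs_transfer_tps]) (use c(2) 2(2) in auto)
    show ?case
      using runs_mono[OF runs_Seq[OF conjunct2[OF d] runs_Seq[OF 3 4]]] 2(1,5) by (simp add: b_def)
  qed (rule c(2))
qed

section \<open>From procedures to machines\<close>

lemma word_tape_Nil: "word_tape [] w = input_tape w"
  by (simp add: word_tape_def input_tape_def)

text \<open>After the marking phase the initial configuration meets the calling convention: no
  arguments, all counters zero, empty output, and the second word on tape 1. An input list with a
  single word is treated as if the second word were empty.\<close>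

lemma proc_machine:
  assumes "proc V 0 F f"
  obtains M p s where "wf_tm M"
    "\<And>xs x w N. xs = [x, w] \<or> xs = [x] \<and> w = [] \<Longrightarrow> V w \<Longrightarrow> N = poly p (length x + length w) \<Longrightarrow>
       config_after M xs N = (if f x w [] = 0 then reject_state M else accept_state M, s x w) \<and>
       s x w ! 1 = word_tape (F x w []) w"
proof -
  obtain c W p where c: "performs V c [] 0 W p F f"
    by (rule procE[OF assms, of "[]" 0]) auto
  let ?c = "Seq (mark (Suc W)) c"
  obtain h where h: "bij_betw h (conts ?c) {..<card (conts ?c)}"
    using ex_state_numbering by blast
  let ?M = "machine ?c W h" and ?q = "p + [:2 * W + 4:]"
  define s where "s x w = tps x w (F x w []) ((\<lambda>_. 0)(0 := f x w [])) (Suc W)" for x w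
  have "config_after ?M xs N = (if f x w [] = 0 then reject_state ?M else accept_state ?M, s x w) \<and>
      s x w ! 1 = word_tape (F x w []) w"
    if xs: "xs = [x, w] \<or> xs = [x] \<and> w = []" and V: "V w" and N: "N = poly ?q (length x + length w)" for xs x w N
  proof -
    have run: "runs c (tps x w [] (\<lambda>_. 0) (Suc W)) (s x w) (poly p (length x + length w))"
      using performsD[OF c V, of "Suc W" "\<lambda>_. 0" x "length x + length w" "f x w []" "F x w []" "[]"]
      by (simp add: s_def)
    have ini: "length xs \<le> 2" "input_tape x = input_tape ((xs @ [[], []]) ! 0)"
        "word_tape [] w = input_tape ((xs @ [[], []]) ! 1)"
      using xs by (elim disjE; simp add: word_tape_Nil)+
    have "2 * W + poly p (length x + length w) + 4 \<le> N" by (simp add: N)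
    from machine_computation[OF refl h ini run[unfolded s_def tps_def] this] show ?thesis
      by (simp add: s_def tps_def)
  qed
  then show thesis by (rule that[OF wf_machine[OF h]])
qed

theorem poly_time_decidable_comp:
  assumes "comp 0 (\<lambda>x w e. of_bool (R x w))"
  shows "poly_time_decidable R"
  using assms unfolding comp_def
proof (rule proc_machine, goal_cases)
  case (1 M p s)
  then have "fst (config_after M [x, w] (poly p (length x + length w))) =
      (if R x w then accept_state M else reject_state M)" for x w
    by auto
  then show ?case unfolding poly_time_decidable_def using 1(1) by blast
qed

theorem poly_time_computable_emit:
  assumes "emit 0 F"
  shows "poly_time_computable (\<lambda>x. F x [])"
  using assms unfolding emit_def
proof (rule proc_machine, goal_cases)
  case (1 M p s)
  have "config_after M [x] (poly p (length x)) = (reject_state M, s x []) \<and> s x [] ! 1 = word_tape (F x []) []" for x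
    using 1(2)[of "[x]" x "[]"] by simp
  then have "halted M (config_after M [x] (poly p (length x))) \<and> outputs (config_after M [x] (poly p (length x))) (F x [])" for x
    by (simp add: halted_def outputs_def word_tape_def input_tape_def)
  then show ?case unfolding poly_time_computable_def Let_def using 1(1) by blast
qed

section \<open>Closure properties of computable functions and predicates\<close>

lemma comp_cong:
  assumes "comp d f" "\<And>x w e. length e = d \<Longrightarrow> f x w e = g x w e"
  shows "comp d g"
  unfolding comp_def by (rule proc_cong[OF assms(1)[unfolded comp_def]]) (auto simp: assms(2))

lemma comp_take:
  assumes "comp d f"
  shows "comp (Suc d) (\<lambda>x w e. f x w (take d e))"
proof (rule comp_cong[OF comp_rename[OF assms, of "[0..<d]" "Suc d"]])
  fix x w :: "bool list" and e :: "nat list" assume "length e = Suc d"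
  then have "map (\<lambda>j. e ! j) [0..<d] = take d e"
    by (intro nth_equalityI) auto
  then show "f x w (map (\<lambda>j. e ! j) [0..<d]) = f x w (take d e)" by simp
qed auto

lemma comp_Sum:
  assumes "comp d b" "comp (Suc d) (\<lambda>x w e. f x w (take d e) (e ! d))"
  shows "comp d (\<lambda>x w e. \<Sum>i<b x w e. f x w e i)"
  by (rule comp_cong[OF comp_sum[OF assms]]) (simp add: nth_append)

lemma comp_times:
  assumes "comp d f" "comp d g"
  shows "comp d (\<lambda>x w e. f x w e * g x w e)"
proof -
  have "comp d (\<lambda>x w e. \<Sum>i<f x w e. g x w e)"
    by (rule comp_Sum[OF assms(1) comp_take[OF assms(2)]])
  then show ?thesis by simp
qed

lemma comp_Suc: "comp d f \<Longrightarrow> comp d (\<lambda>x w e. Suc (f x w e))"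
  using comp_plus[OF _ comp_const[of d 1], of f] by simp

definition compb :: "nat \<Rightarrow> (bool list \<Rightarrow> bool list \<Rightarrow> nat list \<Rightarrow> bool) \<Rightarrow> bool" where
  "compb d P \<longleftrightarrow> comp d (\<lambda>x w e. of_bool (P x w e))"

lemma comp_via:
  assumes "comp d f" "\<And>x w e. f x w e = of_bool (P x w e)"
  shows "compb d P"
  unfolding compb_def by (rule comp_cong[OF assms(1)]) (rule assms(2))

lemma compb_cong:
  assumes "compb d P" "\<And>x w e. P x w e \<longleftrightarrow> Q x w e"
  shows "compb d Q"
  using assms(1) unfolding compb_def by (rule comp_cong) (simp add: assms(2))

lemma compb_const: "compb d (\<lambda>x w e. b)"
  unfolding compb_def by (rule comp_const)

lemma compb_not: "compb d P \<Longrightarrow> compb d (\<lambda>x w e. \<not> P x w e)"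
  by (rule comp_via[of d "\<lambda>x w e. 1 - of_bool (P x w e)"])
    (auto intro!: comp_minus comp_const simp: compb_def)

lemma compb_conj: "compb d P \<Longrightarrow> compb d Q \<Longrightarrow> compb d (\<lambda>x w e. P x w e \<and> Q x w e)"
  by (rule comp_via[of d "\<lambda>x w e. of_bool (P x w e) * of_bool (Q x w e)"])
    (auto intro!: comp_times simp: compb_def)

lemma compb_disj: "compb d P \<Longrightarrow> compb d Q \<Longrightarrow> compb d (\<lambda>x w e. P x w e \<or> Q x w e)"
  using compb_not[OF compb_conj[OF compb_not compb_not], of d P Q] by simp

lemma compb_imp: "compb d P \<Longrightarrow> compb d Q \<Longrightarrow> compb d (\<lambda>x w e. P x w e \<longrightarrow> Q x w e)"
  by (rule compb_cong[OF compb_disj[OF compb_not, of d P Q]]) auto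

lemma compb_less: "comp d f \<Longrightarrow> comp d g \<Longrightarrow> compb d (\<lambda>x w e. f x w e < g x w e)"
  by (rule comp_via[of d "\<lambda>x w e. 1 - (1 - (g x w e - f x w e))"])
    (auto intro!: comp_minus comp_const simp: compb_def)

lemma compb_le: "comp d f \<Longrightarrow> comp d g \<Longrightarrow> compb d (\<lambda>x w e. f x w e \<le> g x w e)"
  using compb_not[OF compb_less, of d g f] by (simp add: not_less)

lemma compb_eq: "comp d f \<Longrightarrow> comp d g \<Longrightarrow> compb d (\<lambda>x w e. f x w e = g x w e)"
  by (rule compb_cong[OF compb_conj[OF compb_le compb_le, of d f g g f]]) auto

lemma compb_iff: "compb d P \<Longrightarrow> compb d Q \<Longrightarrow> compb d (\<lambda>x w e. P x w e \<longleftrightarrow> Q x w e)"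
  by (rule compb_cong[OF compb_conj[OF compb_imp compb_imp, of d P Q Q P]]) auto

lemma compb_input_bit: "comp d f \<Longrightarrow> compb d (\<lambda>x w e. bit_at x (f x w e))"
  and compb_word_bit: "comp d f \<Longrightarrow> compb d (\<lambda>x w e. bit_at w (f x w e))"
  unfolding compb_def by (rule comp_input_bit comp_word_bit; assumption)+

lemma comp_of_bool: "compb d P \<Longrightarrow> comp d (\<lambda>x w e. of_bool (P x w e))"
  by (simp add: compb_def)

lemma compb_ex:
  assumes "comp d b" "compb (Suc d) (\<lambda>x w e. P x w (take d e) (e ! d))"
  shows "compb d (\<lambda>x w e. \<exists>i<b x w e. P x w e i)"
proof -
  have "comp d (\<lambda>x w e. \<Sum>i<b x w e. of_bool (P x w e i))"
    by (rule comp_Sum[OF assms(1)]) (use assms(2) in \<open>simp add: compb_def\<close>)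
  from compb_less[OF comp_const[of d 0] this] show ?thesis
    by (rule compb_cong) (auto simp: sum_nonneg_eq_0_iff neq0_conv[symmetric] simp del: neq0_conv)
qed

lemma compb_all:
  assumes "comp d b" "compb (Suc d) (\<lambda>x w e. P x w (take d e) (e ! d))"
  shows "compb d (\<lambda>x w e. \<forall>i<b x w e. P x w e i)"
  by (rule compb_cong[OF compb_not[OF compb_ex[OF assms(1) compb_not[OF assms(2)]]]]) auto

lemma comp_if:
  assumes "compb d P" "comp d f" "comp d g"
  shows "comp d (\<lambda>x w e. if P x w e then f x w e else g x w e)"
proof (rule comp_cong)
  show "comp d (\<lambda>x w e. of_bool (P x w e) * f x w e + of_bool (\<not> P x w e) * g x w e)"
    by (intro comp_plus comp_times comp_of_bool compb_not assms)
qed auto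

lemma compb_if:
  assumes "compb d P" "compb d Q" "compb d R"
  shows "compb d (\<lambda>x w e. if P x w e then Q x w e else R x w e)"
  by (rule compb_cong[OF compb_conj[OF compb_imp[OF assms(1,2)] compb_imp[OF compb_not[OF assms(1)] assms(3)]]]) auto

text \<open>A quotient counts the numbers \<open>i\<close> with \<open>(i + 1) * g \<le> f\<close>;
  the test \<open>0 < g\<close> gives the value 0 for division by zero.\<close>

lemma comp_div:
  assumes "comp d f" "comp d g"
  shows "comp d (\<lambda>x w e. f x w e div g x w e)"
proof (rule comp_cong)
  show "comp d (\<lambda>x w e. \<Sum>i<f x w e. of_bool (0 < g x w e \<and> (i + 1) * g x w e \<le> f x w e))"
    by (intro comp_Sum comp_of_bool compb_conj compb_less compb_le comp_times comp_plus comp_const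
        comp_var comp_take assms) simp
  fix x w e
  let ?f = "f x w e" and ?g = "g x w e"
  show "(\<Sum>i<?f. of_bool (0 < ?g \<and> (i + 1) * ?g \<le> ?f)) = ?f div ?g"
  proof (cases "?g = 0")
    case False
    have *: "(0 < ?g \<and> (i + 1) * ?g \<le> ?f) \<longleftrightarrow> i < ?f div ?g" for i
      using False less_eq_div_iff_mult_less_eq[of ?g "i + 1" ?f] by auto
    have "i < ?f" if "i < ?f div ?g" for i
      using that div_le_dividend[of ?f ?g] by linarith
    then have "{..<?f} \<inter> {i. i < ?f div ?g} = {..<?f div ?g}" by auto
    then show ?thesis unfolding * by (simp add: sum.If_cases of_bool_def)
  qed simp
qed

lemma comp_mod:
  assumes "comp d f" "comp d g"
  shows "comp d (\<lambda>x w e. f x w e mod g x w e)"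
proof (rule comp_cong)
  show "comp d (\<lambda>x w e. f x w e - g x w e * (f x w e div g x w e))"
    by (intro comp_minus comp_times comp_div assms)
qed (simp add: minus_mult_div_eq_mod)

lemma compb_member:
  assumes "finite F" "comp d f"
  shows "compb d (\<lambda>x w e. f x w e \<in> F)"
  using assms(1)
proof induction
  case empty
  then show ?case using compb_const[of d False] by simp
next
  case (insert a F)
  then have "compb d (\<lambda>x w e. f x w e = a \<or> f x w e \<in> F)"
    by (intro compb_disj compb_eq assms comp_const)
  then show ?case by simp
qed

lemma comp_poly:
  assumes "comp d f"
  shows "comp d (\<lambda>x w e. poly p (f x w e))"
proof (induction p)
  case 0
  then show ?case using comp_const[of d 0] by simp
next
  case (pCons a p)
  then show ?case using comp_plus[OF comp_const[of d a] comp_times[OF assms pCons.IH]] by simp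
qed

text \<open>A bounded sum can bind a variable: of the terms with \<open>i < Suc (g x w e)\<close>
  only the one with \<open>i = g x w e\<close> survives.\<close>

lemma comp_let:
  assumes "comp d g" "comp (Suc d) f"
  shows "comp d (\<lambda>x w e. f x w (e @ [g x w e]))"
proof (rule comp_cong)
  have "comp (Suc d) (\<lambda>x w e. f x w (take d e @ [e ! d]))"
    by (rule comp_cong[OF assms(2)]) (metis lessI take_Suc_conv_app_nth take_all_iff le_refl)
  then show "comp d (\<lambda>x w e. \<Sum>i<Suc (g x w e). of_bool (i = g x w e) * f x w (e @ [i]))"
    by (intro comp_Sum comp_Suc comp_times comp_of_bool compb_eq comp_var comp_take assms(1)) simp_all
qed simp

lemma comp_subst_aux:
  assumes "\<And>f. f \<in> set fs \<Longrightarrow> comp d f" "comp (d + length fs) g"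
  shows "comp d (\<lambda>x w e. g x w (e @ map (\<lambda>f. f x w e) fs))"
  using assms
proof (induction "length fs" arbitrary: d fs)
  case 0
  then show ?case by simp
next
  case (Suc n)
  then obtain f fs' where fs: "fs = f # fs'" by (cases fs) auto
  let ?fs = "map (\<lambda>h x w e. h x w (take d e)) fs'"
  have "comp (Suc d) (\<lambda>x w e. g x w (e @ map (\<lambda>f. f x w e) ?fs))"
    by (rule Suc.hyps(1)) (use Suc.hyps(2) Suc.prems fs comp_take in auto)
  from comp_let[OF _ this, of f] Suc.prems(1) fs
  have "comp d (\<lambda>x w e. g x w ((e @ [f x w e]) @ map (\<lambda>h. h x w (e @ [f x w e])) ?fs))"
    by simp
  then show ?case by (rule comp_cong) (simp add: fs o_def)
qed

text \<open>The computed values are appended to the arguments at hand, and a renaming then lets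
  \<open>g\<close> see only these values.\<close>

lemma comp_subst:
  assumes "comp (length fs) g" "\<And>f. f \<in> set fs \<Longrightarrow> comp d f"
  shows "comp d (\<lambda>x w e. g x w (map (\<lambda>f. f x w e) fs))"
proof (rule comp_cong)
  let ?js = "map (\<lambda>i. d + i) [0..<length fs]"
  have "comp (d + length fs) (\<lambda>x w e. g x w (map (\<lambda>j. e ! j) ?js))"
    by (rule comp_rename[OF assms(1)]) auto
  then show "comp d (\<lambda>x w e. g x w (map (\<lambda>j. (e @ map (\<lambda>f. f x w e) fs) ! j) ?js))"
    using comp_subst_aux[where g = "\<lambda>x w e. g x w (map (\<lambda>j. e ! j) ?js)" and fs = fs and d = d] assms(2) by blast
  fix x w :: "bool list" and e :: "nat list" assume "length e = d"
  then have "map (\<lambda>j. (e @ map (\<lambda>f. f x w e) fs) ! j) ?js = map (\<lambda>f. f x w e) fs"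
    by (intro nth_equalityI) (auto simp: nth_append)
  then show "g x w (map (\<lambda>j. (e @ map (\<lambda>f. f x w e) fs) ! j) ?js) = g x w (map (\<lambda>f. f x w e) fs)"
    by simp
qed

lemma comp_subst2:
  "comp 2 (\<lambda>x w e. g x w (e ! 0) (e ! 1)) \<Longrightarrow> comp d f1 \<Longrightarrow> comp d f2 \<Longrightarrow>
   comp d (\<lambda>x w e. g x w (f1 x w e) (f2 x w e))"
  using comp_subst[of "[f1, f2]" "\<lambda>x w e. g x w (e ! 0) (e ! 1)" d]
  by (auto simp: numeral_2_eq_2)

lemmas comp_rules =
  comp_Sum comp_Suc comp_plus comp_minus comp_times comp_div comp_mod comp_if comp_of_bool comp_poly comp_length
  compb_not compb_conj compb_disj compb_imp compb_iff compb_if compb_ex compb_all compb_eq compb_less compb_le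
  compb_input_bit compb_word_bit compb_const comp_const

section \<open>Colorings in first-order form\<close>

text \<open>In a proper coloring, two neighbours of \<open>q\<close> that lie with \<open>q\<close>
  in the union of two consecutive color classes have the same color. The matching condition
  therefore restricts only paths whose ends are colored alike.\<close>

definition semi_ok :: "'a set \<Rightarrow> ('a \<Rightarrow> 'a \<Rightarrow> bool) \<Rightarrow> nat \<Rightarrow> ('a \<Rightarrow> nat) \<Rightarrow> bool" where
  "semi_ok V adj k \<phi> \<longleftrightarrow>
     (\<forall>v\<in>V. 1 \<le> \<phi> v \<and> \<phi> v \<le> k) \<and>
     (\<forall>u\<in>V. \<forall>v\<in>V. adj u v \<longrightarrow> \<phi> u \<noteq> \<phi> v) \<and>
     (\<forall>p\<in>V. \<forall>q\<in>V. \<forall>r\<in>V. adj q p \<and> adj q r \<and> p \<noteq> r \<and> \<phi> p = \<phi> r \<longrightarrow>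
        \<phi> p \<noteq> \<phi> q + 1 \<and> \<phi> q \<noteq> \<phi> p + 1)"

definition far :: "nat \<Rightarrow> nat \<Rightarrow> bool" where
  "far a b \<longleftrightarrow> a + 3 \<le> b \<or> b + 3 \<le> a"

definition triangles_ok :: "'a set \<Rightarrow> ('a \<Rightarrow> 'a \<Rightarrow> bool) \<Rightarrow> ('a \<Rightarrow> nat) \<Rightarrow> bool" where
  "triangles_ok V adj \<phi> \<longleftrightarrow>
     (\<forall>p\<in>V. \<forall>q\<in>V. \<forall>r\<in>V. adj p q \<and> adj q r \<and> adj p r \<longrightarrow>
        far (\<phi> p) (\<phi> q) \<or> far (\<phi> q) (\<phi> r) \<or> far (\<phi> p) (\<phi> r))"

abbreviation adjacent :: "'a set set \<Rightarrow> 'a \<Rightarrow> 'a \<Rightarrow> bool" where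
  "adjacent E u v \<equiv> {u, v} \<in> E"

lemma simple_graphD:
  assumes "simple_graph V E" "e \<in> E"
  obtains u v where "e = {u, v}" "u \<noteq> v" "u \<in> V" "v \<in> V"
  using assms unfolding simple_graph_def nsets_2_eq by blast

lemma simple_graph_finite: "simple_graph V E \<Longrightarrow> finite E"
  unfolding simple_graph_def by (meson finite_imp_finite_nsets finite_subset)

lemma simple_graph_edge:
  assumes "simple_graph V E" "{u, v} \<in> E"
  shows "u \<noteq> v" "u \<in> V" "v \<in> V"
  using simple_graphD[OF assms] by (metis doubleton_eq_iff)+

lemma semi_matching_coloring_iff:
  assumes G: "simple_graph V E"
  shows "semi_matching_coloring V E k \<phi> \<longleftrightarrow> semi_ok V (adjacent E) k \<phi>"
proof
  assume *: "semi_matching_coloring V E k \<phi>"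
  have range: "\<forall>v\<in>V. 1 \<le> \<phi> v \<and> \<phi> v \<le> k" and proper: "\<forall>u\<in>V. \<forall>v\<in>V. {u, v} \<in> E \<longrightarrow> \<phi> u \<noteq> \<phi> v"
    using * by (auto simp: semi_matching_coloring_def proper_coloring_def)
  have "False" if pqr: "p \<in> V" "q \<in> V" "r \<in> V" "{q, p} \<in> E" "{q, r} \<in> E" "p \<noteq> r" "\<phi> p = \<phi> r"
    and c: "\<phi> p = \<phi> q + 1 \<or> \<phi> q = \<phi> p + 1" for p q r
  proof -
    define i where "i = min (\<phi> p) (\<phi> q)"
    let ?W = "{v \<in> V. \<phi> v = i} \<union> {v \<in> V. \<phi> v = i + 1}"
    have "i \<in> {1..k - 1}" using range pqr c by (auto simp: i_def min_def) 
    then have "induces_matching E ?W"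
      using * by (simp add: semi_matching_coloring_def)
    moreover have W: "p \<in> ?W" "q \<in> ?W" "r \<in> ?W"
      using pqr c by (auto simp: i_def)
    ultimately have "card {e \<in> E. e \<subseteq> ?W \<and> q \<in> e} \<le> 1"
      unfolding induces_matching_def by blast
    moreover have "card {{q, p}, {q, r}} \<le> card {e \<in> E. e \<subseteq> ?W \<and> q \<in> e}"
      by (rule card_mono) (use simple_graph_finite[OF G] pqr W in auto)
    moreover have "card {{q, p}, {q, r}} = 2"
      using pqr(6) by (simp add: doubleton_eq_iff)
    ultimately show False by simp
  qed
  then show "semi_ok V (adjacent E) k \<phi>"
    unfolding semi_ok_def using range proper by blast
next
  assume *: "semi_ok V (adjacent E) k \<phi>"
  have "card {e \<in> E. e \<subseteq> W \<and> v \<in> e} \<le> 1"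
    if W: "W = {v \<in> V. \<phi> v = i} \<union> {v \<in> V. \<phi> v = i + 1}" and v: "v \<in> W" for i W v
  proof (rule ccontr)
    assume "\<not> card {e \<in> E. e \<subseteq> W \<and> v \<in> e} \<le> 1"
    then obtain e1 e2 where e: "e1 \<noteq> e2" "e1 \<in> {e \<in> E. e \<subseteq> W \<and> v \<in> e}" "e2 \<in> {e \<in> E. e \<subseteq> W \<and> v \<in> e}"
      using card_le_Suc0_iff_eq[of "{e \<in> E. e \<subseteq> W \<and> v \<in> e}"] simple_graph_finite[OF G]
      by (metis (no_types, lifting) One_nat_def finite_subset mem_Collect_eq subsetI)
    have other: "\<exists>p. e = {v, p} \<and> p \<in> W" if e: "e \<in> E" "e \<subseteq> W" "v \<in> e" for e
    proof -
      obtain a b where "e = {a, b}" using simple_graphD[OF G e(1)] by blast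
      then show ?thesis using e by (auto simp: insert_commute)
    qed
    obtain p r where pr: "e1 = {v, p}" "e2 = {v, r}" "p \<in> W" "r \<in> W"
      using other[of e1] other[of e2] e by blast
    then have "p \<noteq> r" "{v, p} \<in> E" "{v, r} \<in> E" using e by auto
    moreover have "v \<in> V" "p \<in> V" "r \<in> V" using v pr W by auto
    moreover have "\<phi> v \<noteq> \<phi> p" "\<phi> v \<noteq> \<phi> r"
      using * calculation by (auto simp: semi_ok_def)
    moreover have "\<phi> p = \<phi> r" "\<phi> p = \<phi> v + 1 \<or> \<phi> v = \<phi> p + 1"
      using calculation v pr(3,4) unfolding W by auto
    ultimately show False using * unfolding semi_ok_def by blast
  qed
  then show "semi_matching_coloring V E k \<phi>"
    using * by (auto simp: semi_matching_coloring_def proper_coloring_def semi_ok_def induces_matching_def)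
qed

lemma edges_in_pair:
  assumes G: "simple_graph V E" and "u \<noteq> v"
  shows "card {e \<in> E. e \<subseteq> {u, v}} = of_bool ({u, v} \<in> E)"
proof -
  have H: "e = {u, v}" if e: "e \<in> E" "e \<subseteq> {u, v}" for e
  proof -
    obtain a b where "e = {a, b}" "a \<noteq> b" using simple_graphD[OF G e(1)] by blast
    then show ?thesis using e(2) by auto
  qed
  show ?thesis
  proof (cases "{u, v} \<in> E")
    case True
    have "e \<in> E \<and> e \<subseteq> {u, v} \<longleftrightarrow> e = {u, v}" for e
      using H[of e] True by auto
    then have "{e \<in> E. e \<subseteq> {u, v}} = {{u, v}}" by simp
    then show ?thesis using True by simp
  next
    case False
    have "\<not> (e \<in> E \<and> e \<subseteq> {u, v})" for e
      using H[of e] False by metis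
    then have "{e \<in> E. e \<subseteq> {u, v}} = {}" by simp
    then show ?thesis using False by simp
  qed
qed

lemma edges_in_triple:
  assumes G: "simple_graph V E" and d: "p \<noteq> q" "q \<noteq> r" "p \<noteq> r"
  shows "card {e \<in> E. e \<subseteq> {p, q, r}} =
     of_bool ({p, q} \<in> E) + of_bool ({q, r} \<in> E) + of_bool ({p, r} \<in> E)"
proof -
  have "e = {p, q} \<or> e = {q, r} \<or> e = {p, r}" if e: "e \<in> E" "e \<subseteq> {p, q, r}" for e
  proof -
    obtain a b where ab: "e = {a, b}" "a \<noteq> b" using simple_graphD[OF G e(1)] by blast
    then have "a \<in> {p, q, r}" "b \<in> {p, q, r}" using e by auto
    then show ?thesis using ab by (auto simp: insert_commute)
  qed
  then have "{e \<in> E. e \<subseteq> {p, q, r}} = {e \<in> {{p, q}, {q, r}, {p, r}}. e \<in> E}" by auto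
  also have "card \<dots> = (\<Sum>e\<in>{{p, q}, {q, r}, {p, r}}. of_bool (e \<in> E))"
    by (subst sum_of_bool_eq) (simp_all add: Int_def)
  also have "\<dots> = of_bool ({p, q} \<in> E) + of_bool ({q, r} \<in> E) + of_bool ({p, r} \<in> E)"
    using d by (simp add: doubleton_eq_iff)
  finally show ?thesis .
qed

text \<open>Two edges on three vertices ask for a distance of 2. In a proper coloring this fails
  exactly if both ends of the path have the same color, next to that of the middle vertex. Three
  edges ask for distance 3, and at most one edge only for a proper coloring.\<close>

lemma local_coloring_iff:
  assumes G: "simple_graph V E"
  shows "local_coloring V E k \<phi> \<longleftrightarrow> semi_ok V (adjacent E) k \<phi> \<and> triangles_ok V (adjacent E) \<phi>"
proof
  assume *: "local_coloring V E k \<phi>"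
  have range: "\<forall>v\<in>V. 1 \<le> \<phi> v \<and> \<phi> v \<le> k" using * by (auto simp: local_coloring_def)
  have loc: "\<exists>u\<in>S. \<exists>v\<in>S. int (card {e \<in> E. e \<subseteq> S}) \<le> \<bar>int (\<phi> u) - int (\<phi> v)\<bar>"
    if "S \<subseteq> V" "card S \<in> {2, 3}" for S
    using * that unfolding local_coloring_def by blast
  have proper: "\<phi> u \<noteq> \<phi> v" if "u \<in> V" "v \<in> V" "{u, v} \<in> E" for u v
    using loc[of "{u, v}"] that simple_graph_edge[OF G that(3)] edges_in_pair[OF G, of u v] by auto
  have trip: "\<exists>u\<in>{p, q, r}. \<exists>v\<in>{p, q, r}. int (of_bool ({p, q} \<in> E) + of_bool ({q, r} \<in> E) + of_bool ({p, r} \<in> E)) \<le> \<bar>int (\<phi> u) - int (\<phi> v)\<bar>"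
    if "p \<in> V" "q \<in> V" "r \<in> V" "p \<noteq> q" "q \<noteq> r" "p \<noteq> r" for p q r
    using loc[of "{p, q, r}"] that edges_in_triple[OF G that(4-6)] by simp
  have path: "\<phi> p \<noteq> \<phi> q + 1 \<and> \<phi> q \<noteq> \<phi> p + 1"
    if "p \<in> V" "q \<in> V" "r \<in> V" "{q, p} \<in> E" "{q, r} \<in> E" "p \<noteq> r" "\<phi> p = \<phi> r" for p q r
  proof -
    have "\<exists>u\<in>{p, q, r}. \<exists>v\<in>{p, q, r}. 2 \<le> \<bar>int (\<phi> u) - int (\<phi> v)\<bar>"
    proof -
      have "{p, q} \<in> E" using that(4) by (simp add: insert_commute)
      then show ?thesis
        using trip[of p q r] simple_graph_edge[OF G that(4)] simple_graph_edge[OF G that(5)] that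
        by (cases "{p, r} \<in> E") auto
    qed
    then show ?thesis using that(7) by auto
  qed
  have "far (\<phi> p) (\<phi> q) \<or> far (\<phi> q) (\<phi> r) \<or> far (\<phi> p) (\<phi> r)"
    if "p \<in> V" "q \<in> V" "r \<in> V" "{p, q} \<in> E" "{q, r} \<in> E" "{p, r} \<in> E" for p q r
  proof -
    have "\<exists>u\<in>{p, q, r}. \<exists>v\<in>{p, q, r}. 3 \<le> \<bar>int (\<phi> u) - int (\<phi> v)\<bar>"
      using trip[of p q r] simple_graph_edge[OF G that(4)] simple_graph_edge[OF G that(5)] simple_graph_edge[OF G that(6)] that
      by simp
    then show ?thesis unfolding far_def by auto
  qed
  then show "semi_ok V (adjacent E) k \<phi> \<and> triangles_ok V (adjacent E) \<phi>"
    unfolding semi_ok_def triangles_ok_def using range proper path by blast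
next
  assume *: "semi_ok V (adjacent E) k \<phi> \<and> triangles_ok V (adjacent E) \<phi>"
  have proper: "\<phi> u \<noteq> \<phi> v" if "u \<in> V" "v \<in> V" "{u, v} \<in> E" for u v
    using * that by (auto simp: semi_ok_def)
  have path: "\<phi> p = \<phi> r \<Longrightarrow> \<phi> p \<noteq> \<phi> q + 1 \<and> \<phi> q \<noteq> \<phi> p + 1"
    if "p \<in> V" "q \<in> V" "r \<in> V" "{q, p} \<in> E" "{q, r} \<in> E" "p \<noteq> r" for p q r
    using * that unfolding semi_ok_def by blast
  have tri: "far (\<phi> p) (\<phi> q) \<or> far (\<phi> q) (\<phi> r) \<or> far (\<phi> p) (\<phi> r)"
    if "p \<in> V" "q \<in> V" "r \<in> V" "{p, q} \<in> E" "{q, r} \<in> E" "{p, r} \<in> E" for p q r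
    using * that unfolding triangles_ok_def by blast
  have "\<exists>u\<in>S. \<exists>v\<in>S. int (card {e \<in> E. e \<subseteq> S}) \<le> \<bar>int (\<phi> u) - int (\<phi> v)\<bar>"
    if S: "S \<subseteq> V" "card S \<in> {2, 3}" for S
  proof (cases "card S = 2")
    case True
    then obtain u v where uv: "S = {u, v}" "u \<noteq> v" by (auto simp: card_2_iff)
    then show ?thesis
      using edges_in_pair[OF G uv(2)] proper[of u v] S(1) by (cases "{u, v} \<in> E") auto
  next
    case False
    then have "card S = 3" using S by auto
    then obtain p q r where pqr: "S = {p, q, r}" "p \<noteq> q" "q \<noteq> r" "p \<noteq> r" by (auto simp: card_3_iff)
    have V: "p \<in> V" "q \<in> V" "r \<in> V" using S(1) pqr by auto
    let ?a = "{p, q} \<in> E" and ?b = "{q, r} \<in> E" and ?c = "{p, r} \<in> E"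
    have sym: "{q, p} = {p, q}" "{r, q} = {q, r}" "{r, p} = {p, r}" by auto
    have 1: "?a \<Longrightarrow> \<phi> p \<noteq> \<phi> q" "?b \<Longrightarrow> \<phi> q \<noteq> \<phi> r" "?c \<Longrightarrow> \<phi> p \<noteq> \<phi> r" using proper V by auto
    have 2: "?a \<Longrightarrow> ?b \<Longrightarrow> \<phi> p = \<phi> r \<Longrightarrow> \<phi> p \<noteq> \<phi> q + 1 \<and> \<phi> q \<noteq> \<phi> p + 1"
      "?a \<Longrightarrow> ?c \<Longrightarrow> \<phi> q = \<phi> r \<Longrightarrow> \<phi> q \<noteq> \<phi> p + 1 \<and> \<phi> p \<noteq> \<phi> q + 1"
      "?b \<Longrightarrow> ?c \<Longrightarrow> \<phi> p = \<phi> q \<Longrightarrow> \<phi> p \<noteq> \<phi> r + 1 \<and> \<phi> r \<noteq> \<phi> p + 1"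
      using path[of p q r] path[of q p r] path[of p r q] V pqr by (auto simp: sym)
    have 3: "?a \<Longrightarrow> ?b \<Longrightarrow> ?c \<Longrightarrow> far (\<phi> p) (\<phi> q) \<or> far (\<phi> q) (\<phi> r) \<or> far (\<phi> p) (\<phi> r)"
      using tri V by auto
    have "int (of_bool ?a + of_bool ?b + of_bool ?c) \<le> \<bar>int (\<phi> p) - int (\<phi> q)\<bar> \<or>
      int (of_bool ?a + of_bool ?b + of_bool ?c) \<le> \<bar>int (\<phi> q) - int (\<phi> r)\<bar> \<or>
      int (of_bool ?a + of_bool ?b + of_bool ?c) \<le> \<bar>int (\<phi> p) - int (\<phi> r)\<bar>"
      by (cases ?a; cases ?b; cases ?c; use 1 2 3 in \<open>simp add: far_def del: of_nat_add\<close>) (arith+)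
    then show ?thesis
      unfolding edges_in_triple[OF G pqr(2-4), folded pqr(1)] using pqr(1) by blast
  qed
  then show "local_coloring V E k \<phi>"
    using * by (auto simp: local_coloring_def semi_ok_def)
qed

section \<open>Membership in NP\<close>

definition edge_bit :: "bool list \<Rightarrow> nat \<Rightarrow> nat \<Rightarrow> nat \<Rightarrow> bool" where
  "edge_bit x n u v \<longleftrightarrow> bit_at x (n + 1 + u * n + v)"

definition encodes :: "bool list \<Rightarrow> nat \<Rightarrow> bool" where
  "encodes x n \<longleftrightarrow> length x = n + 1 + n * n \<and> (\<forall>i<n. bit_at x i) \<and> \<not> bit_at x n \<and>
     (\<forall>u<n. \<not> edge_bit x n u u) \<and> (\<forall>u<n. \<forall>v<n. edge_bit x n u v \<longleftrightarrow> edge_bit x n v u)"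

definition decoded_edges :: "bool list \<Rightarrow> nat \<Rightarrow> nat set set" where
  "decoded_edges x n = {{u, v} |u v. u < n \<and> v < n \<and> edge_bit x n u v}"

lemma concat_blocks:
  assumes "\<And>u. u < n \<Longrightarrow> length (f u) = m"
  shows "length (concat (map f [0..<n])) = n * m"
    and "u < n \<Longrightarrow> v < m \<Longrightarrow> concat (map f [0..<n]) ! (u * m + v) = f u ! v"
proof -
  have len: "length (concat (map f [0..<j])) = j * m" if "j \<le> n" for j
    using that assms by (induction j) auto
  then show "length (concat (map f [0..<n])) = n * m" by simp
  assume uv: "u < n" "v < m"
  have "concat (map f [0..<j]) ! (u * m + v) = f u ! v" if "u < j" "j \<le> n" for j
    using that
  proof (induction j)
    case (Suc j)
    show ?case
    proof (cases "u = j")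
      case True
      then show ?thesis using len[of j] Suc.prems by (simp add: nth_append)
    next
      case False
      then have "u < j" using Suc.prems by simp
      then have "Suc u * m \<le> j * m" by (intro mult_le_mono1) simp
      then have "u * m + v < j * m" using uv(2) by simp
      then show ?thesis using len[of j] Suc \<open>u < j\<close> by (simp add: nth_append)
    qed
  qed simp
  then show "concat (map f [0..<n]) ! (u * m + v) = f u ! v" using uv by simp
qed

lemma length_encode_graph: "length (encode_graph n E) = n + 1 + n * n"
  using concat_blocks(1)[of n "\<lambda>u. map (\<lambda>v. {u, v} \<in> E) [0..<n]" n] by (simp add: encode_graph_def)

lemma bit_encode_graph:
  "i < n \<Longrightarrow> bit_at (encode_graph n E) i" "\<not> bit_at (encode_graph n E) n"
  "u < n \<Longrightarrow> v < n \<Longrightarrow> edge_bit (encode_graph n E) n u v \<longleftrightarrow> {u, v} \<in> E"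
proof -
  show "i < n \<Longrightarrow> bit_at (encode_graph n E) i" "\<not> bit_at (encode_graph n E) n"
    by (auto simp: bit_at_def encode_graph_def nth_append)
  assume uv: "u < n" "v < n"
  have "Suc u * n \<le> n * n" using uv by (intro mult_le_mono1) simp
  then have less: "n + 1 + u * n + v < n + 1 + n * n" using uv by simp
  have "encode_graph n E ! (n + 1 + u * n + v) = concat (map (\<lambda>u. map (\<lambda>v. {u, v} \<in> E) [0..<n]) [0..<n]) ! (u * n + v)"
    by (simp add: encode_graph_def nth_append)
  also have "\<dots> \<longleftrightarrow> {u, v} \<in> E"
    using concat_blocks(2)[of n "\<lambda>u. map (\<lambda>v. {u, v} \<in> E) [0..<n]" n u v] uv by simp
  finally show "edge_bit (encode_graph n E) n u v \<longleftrightarrow> {u, v} \<in> E"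
    using less by (simp add: edge_bit_def bit_at_def length_encode_graph)
qed

lemma decoded_edges_simple: "encodes x n \<Longrightarrow> simple_graph {..<n} (decoded_edges x n)"
  by (auto simp: encodes_def simple_graph_def decoded_edges_def nsets_def card_2_iff) metis

lemma decoded_edges_iff:
  "encodes x n \<Longrightarrow> u < n \<Longrightarrow> v < n \<Longrightarrow> {u, v} \<in> decoded_edges x n \<longleftrightarrow> edge_bit x n u v"
  by (auto simp: encodes_def decoded_edges_def doubleton_eq_iff)

lemma nth_adjacency_position:
  fixes n :: nat
  assumes "j < n * n"
  obtains u v where "u < n" "v < n" "j = u * n + v"
proof -
  have "n > 0" using assms by (cases n) auto
  then show thesis
    using that[of "j div n" "j mod n"] assms by (simp add: less_mult_imp_div_less)
qed

lemma encode_decoded_edges: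
  assumes "encodes x n"
  shows "encode_graph n (decoded_edges x n) = x"
proof (rule nth_equalityI)
  let ?g = "encode_graph n (decoded_edges x n)"
  have lx: "length x = n + 1 + n * n" using assms by (simp add: encodes_def)
  show "length ?g = length x" using lx by (simp add: length_encode_graph)
  have lg: "length ?g = n + 1 + n * n" by (rule length_encode_graph)
  fix i assume i: "i < length ?g"
  have "bit_at ?g i = bit_at x i"
  proof -
    consider "i < n" | "i = n" | j where "i = n + 1 + j"
      by (metis Suc_eq_plus1 less_iff_Suc_add linorder_neqE_nat add_Suc)
    then show ?thesis
    proof cases
      case 3
      then have "j < n * n" using i lg by simp
      then obtain u v where uv: "u < n" "v < n" "j = u * n + v" by (rule nth_adjacency_position)
      then have "i = n + 1 + u * n + v" using 3 by simp
      then show ?thesis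
        using bit_encode_graph(3)[OF uv(1,2), of "decoded_edges x n"] decoded_edges_iff[OF assms uv(1,2)]
        by (simp add: edge_bit_def)
    qed (use assms bit_encode_graph in \<open>auto simp: encodes_def\<close>)
  qed
  then show "?g ! i = x ! i" using i lx lg by (simp add: bit_at_def)
qed

lemma encodes_encode_graph:
  assumes "simple_graph {..<n} E"
  shows "encodes (encode_graph n E) n" "decoded_edges (encode_graph n E) n = E"
proof -
  have "{u} \<notin> E" for u using simple_graph_edge(1)[OF assms, of u u] by auto
  then show "encodes (encode_graph n E) n"
    unfolding encodes_def
    using bit_encode_graph[where n = n and E = E] length_encode_graph[of n E] simple_graph_edge[OF assms]
    by (auto simp: insert_commute)
  have "e \<in> E \<longleftrightarrow> e \<in> decoded_edges (encode_graph n E) n" for e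
    using bit_encode_graph(3)[of _ n _ E] simple_graphD[OF assms, of e]
    unfolding decoded_edges_def mem_Collect_eq lessThan_iff by metis
  then show "decoded_edges (encode_graph n E) n = E" by auto
qed

text \<open>An encoding is longer than its number of vertices, so the quantifier over
  \<open>n\<close> can be bounded and hence evaluated by a program.\<close>

lemma graph_problem_iff:
  "x \<in> graph_problem P \<longleftrightarrow> (\<exists>n<Suc (length x). encodes x n \<and> P {..<n} (decoded_edges x n))"
proof
  assume "x \<in> graph_problem P"
  then obtain n E where *: "x = encode_graph n E" "simple_graph {..<n} E" "P {..<n} E"
    by (auto simp: graph_problem_def)
  then show "\<exists>n<Suc (length x). encodes x n \<and> P {..<n} (decoded_edges x n)"
    using encodes_encode_graph[OF *(2)] length_encode_graph[of n E] by (intro exI[of _ n]) auto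
next
  assume "\<exists>n<Suc (length x). encodes x n \<and> P {..<n} (decoded_edges x n)"
  then obtain n where n: "encodes x n" "P {..<n} (decoded_edges x n)" by blast
  then show "x \<in> graph_problem P"
    unfolding graph_problem_def mem_Collect_eq
    by (intro exI[of _ n] exI[of _ "decoded_edges x n"]) (simp add: encode_decoded_edges decoded_edges_simple)
qed

lemma semi_ok_cong:
  assumes "\<And>u v. u \<in> V \<Longrightarrow> v \<in> V \<Longrightarrow> adj u v \<longleftrightarrow> adj' u v" "\<And>u. u \<in> V \<Longrightarrow> \<phi> u = \<psi> u"
  shows "semi_ok V adj k \<phi> \<longleftrightarrow> semi_ok V adj' k \<psi>" "triangles_ok V adj \<phi> \<longleftrightarrow> triangles_ok V adj' \<psi>"
  unfolding semi_ok_def triangles_ok_def using assms by (simp_all cong: ball_cong)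

text \<open>A certificate consists of one block of \<open>k\<close> bits per vertex, whose number of ones is the color.\<close>

definition block_color :: "nat \<Rightarrow> bool list \<Rightarrow> nat \<Rightarrow> nat" where
  "block_color k w u = (\<Sum>i<k. of_bool (bit_at w (u * k + i)))"

lemma ex_certificate:
  assumes "\<And>u. u < n \<Longrightarrow> \<phi> u \<le> k"
  shows "\<exists>w. length w = n * k \<and> (\<forall>u<n. block_color k w u = \<phi> u)"
proof -
  let ?f = "\<lambda>u. replicate (\<phi> u) True @ replicate (k - \<phi> u) False"
  let ?w = "concat (map ?f [0..<n])"
  have len: "length (?f u) = k" if "u < n" for u using assms[OF that] by simp
  have "block_color k ?w u = \<phi> u" if "u < n" for u
  proof -
    have "bit_at ?w (u * k + i) \<longleftrightarrow> i < \<phi> u" if "i < k" for i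
    proof -
      have "Suc u * k \<le> n * k" using \<open>u < n\<close> by (intro mult_le_mono1) simp
      then have "u * k + i < n * k" using \<open>i < k\<close> by simp
      then show ?thesis
        using concat_blocks[of n ?f k, OF len] \<open>u < n\<close> \<open>i < k\<close> by (auto simp: bit_at_def nth_append)
    qed
    then have "block_color k ?w u = (\<Sum>i<k. of_bool (i < \<phi> u))"
      by (simp add: block_color_def)
    also have "\<dots> = card ({..<k} \<inter> {i. i < \<phi> u})" by (simp add: sum_of_bool_eq)
    also have "{..<k} \<inter> {i. i < \<phi> u} = {..<\<phi> u}" using assms[OF that] by auto
    finally show ?thesis by simp
  qed
  then show ?thesis using concat_blocks(1)[of n ?f k, OF len] by blast
qed

text \<open>Every word \<open>w\<close> describes some map into 0, ..., k, since missing bits count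
  as 0 and further bits are ignored; color 0 is rejected by \<open>semi_ok\<close>. All quantifiers
  and sums are bounded, so that the closure rules prove decidability.\<close>

definition verifier :: "bool \<Rightarrow> nat \<Rightarrow> bool list \<Rightarrow> bool list \<Rightarrow> bool" where
  "verifier tri k x w \<longleftrightarrow> (\<exists>n<Suc (length x). encodes x n \<and>
     semi_ok {..<n} (edge_bit x n) k (block_color k w) \<and>
     (tri \<longrightarrow> triangles_ok {..<n} (edge_bit x n) (block_color k w)))"

lemma poly_time_decidable_verifier: "poly_time_decidable (verifier tri k)"
proof (rule poly_time_decidable_comp)
  have "compb 0 (\<lambda>x w e. verifier tri k x w)"
    unfolding verifier_def encodes_def semi_ok_def triangles_ok_def far_def edge_bit_def block_color_def
      Ball_def lessThan_iff
    by (intro comp_rules; simp add: comp_var)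
  then show "comp 0 (\<lambda>x w e. of_bool (verifier tri k x w))" by (simp add: compb_def)
qed

lemma graph_problem_in_NP:
  assumes P: "\<And>n E. simple_graph {..<n::nat} E \<Longrightarrow> P {..<n} E \<longleftrightarrow>
     (\<exists>\<phi>. semi_ok {..<n} (adjacent E) k \<phi> \<and> (tri \<longrightarrow> triangles_ok {..<n} (adjacent E) \<phi>))"
  shows "graph_problem P \<in> NP"
proof -
  have "x \<in> graph_problem P \<longleftrightarrow> (\<exists>w. length w \<le> poly [:0, k:] (length x) \<and> verifier tri k x w)" for x
  proof
    assume "x \<in> graph_problem P"
    then obtain n where n: "n < Suc (length x)" "encodes x n" "P {..<n} (decoded_edges x n)"
      by (auto simp: graph_problem_iff)
    then obtain \<phi> where \<phi>: "semi_ok {..<n} (adjacent (decoded_edges x n)) k \<phi>"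
        "tri \<longrightarrow> triangles_ok {..<n} (adjacent (decoded_edges x n)) \<phi>"
      using P decoded_edges_simple by blast
    obtain w where w: "length w = n * k" "\<forall>u<n. block_color k w u = \<phi> u"
      using ex_certificate[of n \<phi> k] \<phi>(1) by (auto simp: semi_ok_def)
    have "verifier tri k x w"
      unfolding verifier_def using n \<phi> w(2) decoded_edges_iff[OF n(2)]
        semi_ok_cong[of "{..<n}" "adjacent (decoded_edges x n)" "edge_bit x n" \<phi> "block_color k w"]
      by (intro exI[of _ n]) auto
    moreover have "length w \<le> poly [:0, k:] (length x)"
      using n(1) w(1) by simp
    ultimately show "\<exists>w. length w \<le> poly [:0, k:] (length x) \<and> verifier tri k x w" by blast
  next
    assume "\<exists>w. length w \<le> poly [:0, k:] (length x) \<and> verifier tri k x w"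
    then obtain n w where n: "n < Suc (length x)" "encodes x n"
        "semi_ok {..<n} (edge_bit x n) k (block_color k w)"
        "tri \<longrightarrow> triangles_ok {..<n} (edge_bit x n) (block_color k w)"
      by (auto simp: verifier_def)
    then have "P {..<n} (decoded_edges x n)"
      using P[OF decoded_edges_simple[OF n(2)]] decoded_edges_iff[OF n(2)]
        semi_ok_cong[of "{..<n}" "adjacent (decoded_edges x n)" "edge_bit x n" "block_color k w" "block_color k w"]
      by auto
    then show "x \<in> graph_problem P" using n graph_problem_iff by blast
  qed
  then show ?thesis
    unfolding NP_def using poly_time_decidable_verifier by blast
qed

lemma problems_in_NP:
  "local_coloring_problem k \<in> NP" "semi_matching_coloring_problem k \<in> NP"
proof -
  show "local_coloring_problem k \<in> NP"
    unfolding local_coloring_problem_def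
    by (rule graph_problem_in_NP[where k = k and tri = True]) (use local_coloring_iff in blast)
  show "semi_matching_coloring_problem k \<in> NP"
    unfolding semi_matching_coloring_problem_def
    by (rule graph_problem_in_NP[where k = k and tri = False]) (use semi_matching_coloring_iff in blast)
qed

section \<open>Colors at distance at least two\<close>

definition apart :: "nat \<Rightarrow> nat \<Rightarrow> bool" where
  "apart a b \<longleftrightarrow> a + 2 \<le> b \<or> b + 2 \<le> a"

lemma apart_sym: "apart a b \<Longrightarrow> apart b a"
  by (auto simp: apart_def)

text \<open>Apart colors lie in different pairs 1-2, 3-4, and so on; \<open>(c + 1) div 2\<close> is
  the number of the pair of \<open>c\<close>.\<close>

lemma card_apart_le:
  assumes "Q \<subseteq> {1..k}" "\<And>a b. a \<in> Q \<Longrightarrow> b \<in> Q \<Longrightarrow> a \<noteq> b \<Longrightarrow> apart a b"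
  shows "card Q \<le> (k + 1) div 2"
proof -
  have "inj_on (\<lambda>c. (c + 1) div 2) Q"
  proof (rule inj_onI)
    fix a b assume "a \<in> Q" "b \<in> Q" "(a + 1) div 2 = (b + 1) div 2"
    then show "a = b" using assms(2)[of a b] unfolding apart_def by arith
  qed
  moreover have "(\<lambda>c. (c + 1) div 2) ` Q \<subseteq> {1..(k + 1) div 2}"
  proof
    fix y assume "y \<in> (\<lambda>c. (c + 1) div 2) ` Q"
    then obtain x where "y = (x + 1) div 2" "1 \<le> x" "x \<le> k" using assms(1) by auto
    then show "y \<in> {1..(k + 1) div 2}" by (simp add: div_le_mono)
  qed
  ultimately show ?thesis using card_inj_on_le[of _ Q "{1..(k + 1) div 2}"] by simp
qed

text \<open>For odd \<open>k\<close>, the only largest set of colors at pairwise distance at least two consists of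
  the odd colors: an even color \<open>c\<close> wastes a place, as the injection below misses \<open>0\<close>.\<close>

lemma card_apart_less:
  assumes "Q \<subseteq> {1..k}" "\<And>a b. a \<in> Q \<Longrightarrow> b \<in> Q \<Longrightarrow> a \<noteq> b \<Longrightarrow> apart a b"
    and "odd k" "c \<in> Q" "even c"
  shows "card Q < (k + 1) div 2"
proof -
  \<comment> \<open>Below \<open>c\<close> the pairs start at odd colors, above \<open>c\<close> at
    even ones. Neither neighbour of \<open>c\<close> occurs in \<open>Q\<close>, so the value
    \<open>c div 2\<close> is taken by \<open>c\<close> alone, and \<open>k div 2\<close> values
    suffice.\<close>
  let ?h = "\<lambda>x. if x < c then (x + 1) div 2 else x div 2"
  have *: "x + 2 \<le> c \<or> x = c \<or> c + 2 \<le> x" if "x \<in> Q" for x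
    using assms(2)[OF that assms(4)] by (auto simp: apart_def)
  have "inj_on ?h Q"
  proof (rule inj_onI)
    fix a b assume ab: "a \<in> Q" "b \<in> Q" "?h a = ?h b"
    obtain d where d: "c = 2 * d" using assms(5) by blast
    have "apart a b \<or> a = b" using assms(2)[OF ab(1,2)] by blast
    then show "a = b" using *[OF ab(1)] *[OF ab(2)] ab(3) unfolding apart_def d
      by (auto split: if_splits)
  qed
  moreover have "?h ` Q \<subseteq> {1..k div 2}"
  proof
    fix y assume "y \<in> ?h ` Q"
    then obtain x where x: "x \<in> Q" "y = ?h x" by blast
    have r: "1 \<le> x" "x \<le> k" "1 \<le> c" "c \<le> k" using assms(1,4) x(1) by auto
    show "y \<in> {1..k div 2}"
      using *[OF x(1)] r assms(5) unfolding x(2) by (auto elim!: evenE)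
  qed
  ultimately have "card Q \<le> k div 2" using card_inj_on_le[of _ Q "{1..k div 2}"] by simp
  then show ?thesis using assms(3) by (auto elim!: oddE)
qed

section \<open>From clauses to graphs\<close>

text \<open>Literals are numbers: \<open>2 * v\<close> and \<open>2 * v + 1\<close> are complementary, \<open>0\<close> is false and \<open>1\<close> is
  true. Clause \<open>c\<close> consists of the literals \<open>lit c j\<close>.\<close>

definition satisfiable :: "nat \<Rightarrow> (nat \<Rightarrow> nat \<Rightarrow> nat) \<Rightarrow> bool" where
  "satisfiable Y lit \<longleftrightarrow> (\<exists>\<alpha>. \<alpha> 1 \<and> \<not> \<alpha> 0 \<and> (\<forall>v. 2 * v + 1 < Y \<longrightarrow> \<alpha> (2 * v) \<noteq> \<alpha> (2 * v + 1)) \<and>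
     (\<forall>c<Y - 2. \<exists>j<Y - 1. \<alpha> (lit c j)))"

text \<open>Vertex \<open>(a, b, g)\<close> with \<open>g < k + 1\<close> is a copy of node \<open>(a, b)\<close>. The node \<open>(0, l)\<close> is the
  literal \<open>l\<close>; the nodes \<open>(1, i)\<close> with \<open>i < (k + 1) div 2 - 2\<close> are joined to everything; and
  \<open>(c + 2, j)\<close> states that one of the first \<open>j\<close> literals of clause \<open>c\<close> is true. The vertices
  \<open>(c + 2, j, g)\<close> with larger \<open>g\<close> form a gadget that forces the value of \<open>(c + 2, j + 1)\<close> to be
  that of \<open>(c + 2, j)\<close> or that of \<open>lit c j\<close>. Its middle vertices are doubled for even \<open>k\<close>,
  because one of them can then be the single close neighbour of either of its two ends.\<close>

definition joined :: "nat \<Rightarrow> nat \<Rightarrow> nat \<Rightarrow> nat \<Rightarrow> nat \<Rightarrow> nat \<Rightarrow> bool" where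
  "joined k Y a b a' b' \<longleftrightarrow>
     (a = 0 \<and> a' = 0 \<and> b div 2 = b' div 2 \<and> b \<noteq> b') \<or>
     (2 \<le> a \<and> b = 0 \<and> a' = 0 \<and> b' = 1) \<or>
     (2 \<le> a \<and> b = Y - 1 \<and> a' = 0 \<and> b' = 0) \<or>
     (a = 1 \<and> b < (k + 1) div 2 - 2 \<and> (a' \<noteq> 1 \<or> b' \<noteq> b))"

definition gadget :: "nat \<Rightarrow> nat \<Rightarrow> (nat \<Rightarrow> nat \<Rightarrow> nat) \<Rightarrow> nat \<Rightarrow> nat \<Rightarrow> nat \<Rightarrow> nat \<Rightarrow> nat \<Rightarrow> nat \<Rightarrow> bool" where
  "gadget k Y lit a b g a' b' g' \<longleftrightarrow> 2 \<le> a \<and> b < Y - 1 \<and>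
     ((g = k + 1 \<and> a' = a \<and> b' = b + 1 \<and> g' < k + 1) \<or>
      (g = k + 2 \<and> a' = a \<and> b' = b \<and> g' < k + 1) \<or>
      (g = k + 3 \<and> a' = 0 \<and> b' = lit (a - 2) b \<and> g' < k + 1) \<or>
      (a' = a \<and> b' = b \<and> (g = k + 4 \<or> g = k + 5 \<and> even k) \<and> (g' = k + 1 \<or> g' = k + 2)) \<or>
      (a' = a \<and> b' = b \<and> (g = k + 6 \<or> g = k + 7 \<and> even k) \<and> (g' = k + 1 \<or> g' = k + 3)))"

fun arc :: "nat \<Rightarrow> nat \<Rightarrow> (nat \<Rightarrow> nat \<Rightarrow> nat) \<Rightarrow> nat \<times> nat \<times> nat \<Rightarrow> nat \<times> nat \<times> nat \<Rightarrow> bool" where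
  "arc k Y lit (a, b, g) (a', b', g') \<longleftrightarrow>
     (g < k + 1 \<and> g' < k + 1 \<and> joined k Y a b a' b') \<or>
     (a = 1 \<and> b < (k + 1) div 2 - 2 \<and> g < k + 1 \<and> k + 1 \<le> g') \<or>
     gadget k Y lit a b g a' b' g'"

definition adj :: "nat \<Rightarrow> nat \<Rightarrow> (nat \<Rightarrow> nat \<Rightarrow> nat) \<Rightarrow> nat \<times> nat \<times> nat \<Rightarrow> nat \<times> nat \<times> nat \<Rightarrow> bool" where
  "adj k Y lit u v \<longleftrightarrow> arc k Y lit u v \<or> arc k Y lit v u"

definition cube :: "nat \<Rightarrow> (nat \<times> nat \<times> nat) set" where
  "cube Y = {..<Y} \<times> {..<Y} \<times> {..<Y}"

text \<open>The third coordinate of a gadget vertex goes up to \<open>k + 7\<close>, so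
  \<open>Y \<ge> k + 8\<close> makes every gadget fit into the cube.\<close>

locale clause_graph =
  fixes k Y :: nat and lit :: "nat \<Rightarrow> nat \<Rightarrow> nat"
  assumes k: "k \<ge> 3" and Y: "Y \<ge> k + 8" and lit: "\<And>c j. lit c j < Y"
begin

abbreviation "A \<equiv> adj k Y lit"

section \<open>Soundness: an assignment from a semi-matching coloring\<close>

context
  fixes \<phi> :: "nat \<times> nat \<times> nat \<Rightarrow> nat"
  assumes ok: "semi_ok (cube Y) A k \<phi>"
begin

lemma range: "v \<in> cube Y \<Longrightarrow> \<phi> v \<in> {1..k}"
  using ok by (auto simp: semi_ok_def)

lemma proper: "u \<in> cube Y \<Longrightarrow> v \<in> cube Y \<Longrightarrow> A u v \<Longrightarrow> \<phi> u \<noteq> \<phi> v"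
  using ok by (auto simp: semi_ok_def)

lemma path:
  "p \<in> cube Y \<Longrightarrow> q \<in> cube Y \<Longrightarrow> r \<in> cube Y \<Longrightarrow> A q p \<Longrightarrow> A q r \<Longrightarrow> p \<noteq> r \<Longrightarrow> \<phi> p = \<phi> r \<Longrightarrow>
   apart (\<phi> q) (\<phi> p)"
proof -
  assume *: "p \<in> cube Y" "q \<in> cube Y" "r \<in> cube Y" "A q p" "A q r" "p \<noteq> r" "\<phi> p = \<phi> r"
  then have "\<phi> p \<noteq> \<phi> q + 1 \<and> \<phi> q \<noteq> \<phi> p + 1"
    using ok unfolding semi_ok_def by blast
  then show ?thesis using proper[OF *(2,1,4)] unfolding apart_def by arith
qed

definition heavy :: "nat \<Rightarrow> nat \<Rightarrow> nat \<Rightarrow> bool" where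
  "heavy a b c \<longleftrightarrow> (\<exists>g g'. g < k + 1 \<and> g' < k + 1 \<and> g \<noteq> g' \<and> \<phi> (a, b, g) = c \<and> \<phi> (a, b, g') = c)"

lemma ex_heavy:
  assumes "a < Y" "b < Y"
  shows "\<exists>c. heavy a b c"
proof -
  have "\<not> inj_on (\<lambda>g. \<phi> (a, b, g)) {..<k + 1}"
  proof
    assume "inj_on (\<lambda>g. \<phi> (a, b, g)) {..<k + 1}"
    moreover have "(\<lambda>g. \<phi> (a, b, g)) ` {..<k + 1} \<subseteq> {1..k}"
      using range assms Y by (force simp: cube_def)
    ultimately have "card {..<k + 1} \<le> card {1..k}" by (rule card_inj_on_le) simp
    then show False by simp
  qed
  then show ?thesis unfolding inj_on_def heavy_def by auto
qed

definition main :: "nat \<Rightarrow> nat \<Rightarrow> nat" where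
  "main a b = (SOME c. heavy a b c)"

lemma heavy_main: "a < Y \<Longrightarrow> b < Y \<Longrightarrow> heavy a b (main a b)"
  unfolding main_def using ex_heavy by (rule someI_ex)

lemma main_in:
  assumes "a < Y" "b < Y"
  obtains g where "g < k + 1" "(a, b, g) \<in> cube Y" "\<phi> (a, b, g) = main a b"
proof -
  obtain g where "g < k + 1" "\<phi> (a, b, g) = main a b"
    using heavy_main[OF assms] unfolding heavy_def by blast
  then show thesis using that assms Y by (auto simp: cube_def)
qed

lemma apart_main:
  assumes "x \<in> cube Y" "a < Y" "b < Y" "\<And>g. g < k + 1 \<Longrightarrow> A x (a, b, g)"
  shows "apart (\<phi> x) (main a b)"
proof -
  obtain g g' where g: "g < k + 1" "g' < k + 1" "g \<noteq> g'" "\<phi> (a, b, g) = main a b" "\<phi> (a, b, g') = main a b"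
    using heavy_main[OF assms(2,3)] unfolding heavy_def by blast
  then show ?thesis
    using path[of "(a, b, g)" x "(a, b, g')"] assms Y by (simp add: cube_def)
qed

lemma apart_main_main:
  assumes "a < Y" "b < Y" "a' < Y" "b' < Y" "joined k Y a b a' b' \<or> joined k Y a' b' a b"
  shows "apart (main a b) (main a' b')"
proof -
  obtain g where g: "g < k + 1" "(a, b, g) \<in> cube Y" "\<phi> (a, b, g) = main a b"
    using main_in assms by blast
  have "apart (\<phi> (a, b, g)) (main a' b')"
    by (rule apart_main) (use g assms in \<open>auto simp: adj_def\<close>)
  then show ?thesis using g by simp
qed

abbreviation "m \<equiv> (k + 1) div 2"

definition S :: "nat set" where
  "S = {c \<in> {1..k}. \<forall>i<m - 2. apart c (main 1 i)}"

lemma m_less: "m \<ge> 2" "i < m - 2 \<Longrightarrow> i < Y"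
  using k Y by auto

lemma vertex_in_S:
  assumes "x \<in> cube Y" "fst x \<noteq> 1"
  shows "\<phi> x \<in> S"
proof -
  obtain a b g where x: "x = (a, b, g)" by (cases x)
  have "apart (\<phi> x) (main 1 i)" if "i < m - 2" for i
    by (rule apart_main) (use assms x m_less that Y in \<open>auto simp: adj_def joined_def\<close>)
  then show ?thesis using range[OF assms(1)] by (simp add: S_def)
qed

lemma main_in_S: "a < Y \<Longrightarrow> b < Y \<Longrightarrow> a \<noteq> 1 \<Longrightarrow> main a b \<in> S"
  using vertex_in_S by (metis fst_conv main_in)

definition U :: "nat set" where
  "U = main 1 ` {..<m - 2}"

lemma U_apart: "i < m - 2 \<Longrightarrow> j < m - 2 \<Longrightarrow> i \<noteq> j \<Longrightarrow> apart (main 1 i) (main 1 j)"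
  using Y m_less by (intro apart_main_main) (auto simp: joined_def)

lemma card_U: "card U = m - 2"
proof -
  have "inj_on (main 1) {..<m - 2}"
    using U_apart by (force simp: inj_on_def apart_def)
  then show ?thesis by (simp add: U_def card_image)
qed

text \<open>The bounds on sets of pairwise apart colors concern all of 1, ..., k. Adding the
  \<open>m - 2\<close> main colors of the universal nodes turns them into bounds for subsets of
  \<open>S\<close>.\<close>

lemma extend_U:
  assumes "C \<subseteq> S" "\<And>a b. a \<in> C \<Longrightarrow> b \<in> C \<Longrightarrow> a \<noteq> b \<Longrightarrow> apart a b"
  shows "C \<union> U \<subseteq> {1..k}" "\<And>a b. a \<in> C \<union> U \<Longrightarrow> b \<in> C \<union> U \<Longrightarrow> a \<noteq> b \<Longrightarrow> apart a b"
    "finite C \<Longrightarrow> card (C \<union> U) = card C + (m - 2)"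
proof -
  have "main 1 i \<in> {1..k}" if "i < m - 2" for i
  proof -
    have "1 < Y" "i < Y" using m_less(2)[OF that] Y by auto
    then obtain g where "(1, i, g) \<in> cube Y" "\<phi> (1, i, g) = main 1 i" using main_in by blast
    then show ?thesis using range by metis
  qed
  then show "C \<union> U \<subseteq> {1..k}" using assms(1) by (auto simp: S_def U_def)
  have CU: "apart a b" if "a \<in> C" "b \<in> U" for a b
    using that assms(1) by (auto simp: S_def U_def)
  have UU: "apart a b" if "a \<in> U" "b \<in> U" "a \<noteq> b" for a b
    using that U_apart by (auto simp: U_def)
  show "apart a b" if "a \<in> C \<union> U" "b \<in> C \<union> U" "a \<noteq> b" for a b
    using that CU UU assms(2) apart_sym by (meson UnE)
  have "C \<inter> U = {}" using CU by (force simp: apart_def)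
  then show "finite C \<Longrightarrow> card (C \<union> U) = card C + (m - 2)"
    using card_U by (simp add: card_Un_disjoint U_def)
qed

text \<open>Together with \<open>U\<close>, three such colors would make \<open>m + 1\<close>
  pairwise apart colors, one more than fit into 1, ..., k.\<close>

lemma no_three_apart:
  assumes "a \<in> S" "b \<in> S" "c \<in> S" "apart a b" "apart b c"
  shows "\<not> apart a c"
proof
  assume "apart a c"
  then have d: "a \<noteq> b" "b \<noteq> c" "a \<noteq> c" using assms by (auto simp: apart_def)
  have C: "{a, b, c} \<subseteq> S" "\<And>x y. x \<in> {a, b, c} \<Longrightarrow> y \<in> {a, b, c} \<Longrightarrow> x \<noteq> y \<Longrightarrow> apart x y"
    using assms \<open>apart a c\<close> apart_sym by blast+
  have "card ({a, b, c} \<union> U) \<le> m"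
    by (rule card_apart_le) (use extend_U(1,2)[OF C] in blast)+
  moreover have "card ({a, b, c} \<union> U) = 3 + (m - 2)"
    using extend_U(3)[OF C] d by simp
  ultimately show False using m_less(1) by simp
qed

text \<open>Together with \<open>U\<close>, the two colors form a set of \<open>m\<close> pairwise
  apart colors. This is the maximum, and for odd \<open>k\<close> a set of that size contains no
  even color.\<close>

lemma apart_odd:
  assumes "odd k" "a \<in> S" "b \<in> S" "apart a b"
  shows "odd a"
proof (rule ccontr)
  assume "\<not> odd a"
  have d: "a \<noteq> b" using assms by (auto simp: apart_def)
  have C: "{a, b} \<subseteq> S" "\<And>x y. x \<in> {a, b} \<Longrightarrow> y \<in> {a, b} \<Longrightarrow> x \<noteq> y \<Longrightarrow> apart x y"
    using assms apart_sym by blast+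
  have "card ({a, b} \<union> U) < m"
    by (rule card_apart_less[where c = a])
      (use extend_U(1,2)[OF C] assms(1) \<open>\<not> odd a\<close> in \<open>blast | simp\<close>)+
  moreover have "card ({a, b} \<union> U) = 2 + (m - 2)"
    using extend_U(3)[OF C] d by simp
  ultimately show False using m_less(1) by simp
qed

text \<open>Since no three colors of \<open>S\<close> are apart from each other, \<open>S\<close> splits into two classes of
  pairwise close colors: those close to the smallest color, and the others.\<close>

definition low :: "nat \<Rightarrow> bool" where
  "low c \<longleftrightarrow> c \<le> Min S + 1"

lemma finite_S: "finite S"
  by (simp add: S_def)

lemma apart_low:
  assumes "a \<in> S" "b \<in> S" "apart a b"
  shows "low a \<noteq> low b"
proof -
  have M: "Min S \<in> S" "Min S \<le> a" "Min S \<le> b"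
    using finite_S assms Min_in[of S] Min_le[of S] by (metis empty_iff)+
  show ?thesis
    using no_three_apart[OF M(1) assms(1,2) _ assms(3)] M assms(3) unfolding low_def apart_def by arith
qed

text \<open>Colors of one class differ by at most 1 from each other, so a class has at most two
  colors. Two neighbours of \<open>x\<close> in its class would both have the one that
  \<open>x\<close> does not have, which is the forbidden path.\<close>

lemma one_neighbour_of_same_class:
  assumes "x \<in> cube Y" "y \<in> cube Y" "z \<in> cube Y" "A x y" "A x z" "y \<noteq> z"
    and "fst x \<noteq> 1" "fst y \<noteq> 1" "fst z \<noteq> 1" "low (\<phi> y) = low (\<phi> x)"
  shows "low (\<phi> z) \<noteq> low (\<phi> x)"
proof
  assume "low (\<phi> z) = low (\<phi> x)"
  have S: "\<phi> x \<in> S" "\<phi> y \<in> S" "\<phi> z \<in> S" using assms vertex_in_S by auto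
  have "\<not> apart (\<phi> x) (\<phi> y)" "\<not> apart (\<phi> x) (\<phi> z)" "\<not> apart (\<phi> y) (\<phi> z)"
    using apart_low[of "\<phi> x" "\<phi> y"] apart_low[of "\<phi> x" "\<phi> z"] apart_low[of "\<phi> y" "\<phi> z"] S assms(10) \<open>low (\<phi> z) = low (\<phi> x)\<close> by auto
  moreover have "\<phi> x \<noteq> \<phi> y" "\<phi> x \<noteq> \<phi> z" using proper assms by auto
  ultimately show False
    using path[of y x z] assms unfolding apart_def by arith
qed

text \<open>The vertices \<open>u 1\<close>, \<open>u 2\<close> and \<open>u 3\<close> have the
  classes opposite to those of the three nodes, so a violation means that \<open>u 1\<close> differs
  from both \<open>u 2\<close> and \<open>u 3\<close>. Each of the two disagreements costs
  \<open>u 1\<close> a close neighbour among the middle vertices, and it can afford only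
  one.\<close>

lemma gadget_sound:
  assumes c: "c < Y - 2" and j: "j < Y - 1"
  shows "low (main (c + 2) (j + 1)) = low (main (c + 2) j) \<or> low (main (c + 2) (j + 1)) = low (main 0 (lit c j))"
proof (rule ccontr)
  assume neg: "\<not> ?thesis"
  define u where "u g = (c + 2, j, k + g)" for g
  have V: "u g \<in> cube Y" if "g < 8" for g using that c j Y by (auto simp: u_def cube_def)
  have f: "fst (u g) \<noteq> 1" for g by (simp add: u_def)
  have S: "\<phi> (u g) \<in> S" if "g < 8" for g using vertex_in_S[OF V[OF that] f] .
  have jY: "c + 2 < Y" "j < Y" "j + 1 < Y" using c j by auto
  have ap: "apart (\<phi> (u 1)) (main (c + 2) (j + 1))" "apart (\<phi> (u 2)) (main (c + 2) j)" "apart (\<phi> (u 3)) (main 0 (lit c j))"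
    using apart_main[of "u 1" "c + 2" "j + 1"] apart_main[of "u 2" "c + 2" j] apart_main[of "u 3" 0 "lit c j"]
      V[of 1] V[of 2] V[of 3] jY j lit Y
    by (simp_all add: u_def adj_def gadget_def)
  have mS: "main (c + 2) (j + 1) \<in> S" "main (c + 2) j \<in> S" "main 0 (lit c j) \<in> S"
    using main_in_S jY lit Y by auto
  have low: "low (\<phi> (u 2)) \<noteq> low (\<phi> (u 1))" "low (\<phi> (u 3)) \<noteq> low (\<phi> (u 1))"
    using apart_low[OF S mS(1) ap(1)] apart_low[OF S mS(2) ap(2)] apart_low[OF S mS(3) ap(3)] neg by auto
  have adj: "A (u 1) (u 4)" "A (u 2) (u 4)" "A (u 1) (u 6)" "A (u 3) (u 6)"
    "even k \<Longrightarrow> A (u 1) (u 5)" "even k \<Longrightarrow> A (u 2) (u 5)" "even k \<Longrightarrow> A (u 1) (u 7)" "even k \<Longrightarrow> A (u 3) (u 7)"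
    using j by (auto simp: u_def adj_def gadget_def)
  have ne: "u g \<noteq> u h" if "g \<noteq> h" for g h using that by (simp add: u_def)
  show False
  proof (cases "even k")
    case True
    \<comment> \<open>At most one of \<open>u 4\<close> and \<open>u 5\<close> shares the class of
      \<open>u 2\<close>, so the other shares that of \<open>u 1\<close>. In the same way
      \<open>u 6\<close> or \<open>u 7\<close> shares the class of \<open>u 1\<close>, which then
      has two neighbours of its own class.\<close>
    have *: "low (\<phi> (u h)) \<noteq> low (\<phi> (u v)) \<or> low (\<phi> (u g)) \<noteq> low (\<phi> (u v))"
      if "A (u v) (u g)" "A (u v) (u h)" "v < 8" "g < 8" "h < 8" "g \<noteq> h" for v g h
      using one_neighbour_of_same_class[OF V V V that(1,2) ne f f f] that by blast
    show False
      using *[of 2 4 5] *[of 3 6 7] *[of 1 4 6] *[of 1 4 7] *[of 1 5 6] *[of 1 5 7] adj True low by auto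
  next
    case False
    have oddu: "odd (\<phi> (u 1))" "odd (\<phi> (u 2))" "odd (\<phi> (u 3))"
      using apart_odd[OF False S mS(1) ap(1)] apart_odd[OF False S mS(2) ap(2)] apart_odd[OF False S mS(3) ap(3)] by auto
    have oo: "apart a b" if "odd a" "odd b" "a \<noteq> b" for a b :: nat
      using that unfolding apart_def by (auto elim!: oddE)
    have ap2: "apart (\<phi> (u 1)) (\<phi> (u 2))" "apart (\<phi> (u 1)) (\<phi> (u 3))"
      using oo oddu low by metis+
    \<comment> \<open>Distinct odd colors are apart, and a color of \<open>S\<close> apart from
      another one is odd. A middle vertex apart from one end would thus be apart from both, and
      three colors of \<open>S\<close> would be pairwise apart. So its color lies strictly between
      those of the ends.\<close>
    have mid: "\<not> apart (\<phi> w) (\<phi> (u 1)) \<and> \<not> apart (\<phi> w) (\<phi> (u v))"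
      if w: "w = u (2 * v)" and v: "v = 2 \<or> v = 3" for w v
    proof -
      have wS: "\<phi> w \<in> S" and vS: "\<phi> (u v) \<in> S" using S w v by auto
      have wn: "\<phi> w \<noteq> \<phi> (u 1)" "\<phi> w \<noteq> \<phi> (u v)"
        using proper[of "u 1" w] proper[of "u v" w] V[of 1] V[of v] V[of "2 * v"] adj(1-4) v w by auto
      have 1: "apart (\<phi> (u 1)) (\<phi> (u v))" using ap2 v by auto
      have "odd (\<phi> (u v))" using oddu v by auto
      have "apart (\<phi> w) (\<phi> (u 1)) \<and> apart (\<phi> w) (\<phi> (u v))"
        if "apart (\<phi> w) (\<phi> (u 1)) \<or> apart (\<phi> w) (\<phi> (u v))"
      proof -
        have "odd (\<phi> w)" using that apart_odd[OF False wS] S[of 1] vS by auto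
        then show ?thesis using oo[of "\<phi> w"] wn oddu(1) \<open>odd (\<phi> (u v))\<close> by blast
      qed
      then show ?thesis using no_three_apart[OF wS S[of 1] vS] 1 by auto
    qed
    have "\<not> apart (\<phi> (u 2)) (\<phi> (u 3))"
      using no_three_apart[OF S S S, of 2 1 3] ap2 apart_sym by auto
    then have 23: "\<phi> (u 2) = \<phi> (u 3)" using oo oddu by blast
    have "\<phi> (u 4) \<noteq> \<phi> (u 1)" "\<phi> (u 4) \<noteq> \<phi> (u 2)" "\<phi> (u 6) \<noteq> \<phi> (u 1)" "\<phi> (u 6) \<noteq> \<phi> (u 3)"
      using proper[of "u 1" "u 4"] proper[of "u 2" "u 4"] proper[of "u 1" "u 6"] proper[of "u 3" "u 6"]
        V[of 1] V[of 2] V[of 3] V[of 4] V[of 6] adj(1-4) by auto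
    then have "\<phi> (u 4) = \<phi> (u 6)"
      using mid[of "u 4" 2] mid[of "u 6" 3] ap2(1) 23 unfolding apart_def by simp arith
    moreover have "\<not> apart (\<phi> (u 1)) (\<phi> (u 4))" using mid[of "u 4" 2] by (auto dest: apart_sym)
    ultimately show False
      using path[of "u 4" "u 1" "u 6"] V adj ne[of 4 6] by auto
  qed
qed

text \<open>A literal is true if its node has the class of node (0, 1). If all literals of clause
  \<open>c\<close> were false, the chain of gadgets would carry the class of (0, 0) from node (c +
  2, 0) to node (c + 2, Y - 1), but the latter is joined to (0, 0).\<close>

lemma sound: "satisfiable Y lit"
proof -
  define \<alpha> where "\<alpha> l = (low (main 0 l) = low (main 0 1))" for l
  have diff: "low (main a b) \<noteq> low (main a' b')"
    if "a < Y" "b < Y" "a' < Y" "b' < Y" "joined k Y a b a' b'" "a \<noteq> 1" "a' \<noteq> 1" for a b a' b'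
    using apart_main_main that main_in_S by (intro apart_low) auto
  have compl: "\<alpha> (2 * v) \<noteq> \<alpha> (2 * v + 1)" if "2 * v + 1 < Y" for v
    using diff[of 0 "2 * v" 0 "2 * v + 1"] that unfolding \<alpha>_def by (auto simp: joined_def)
  have "\<alpha> 1" by (simp add: \<alpha>_def)
  moreover have "\<not> \<alpha> 0" using compl[of 0] \<open>\<alpha> 1\<close> Y by simp
  moreover have "\<exists>j<Y - 1. \<alpha> (lit c j)" if c: "c < Y - 2" for c
  proof (rule ccontr)
    assume no: "\<not> ?thesis"
    define e where "e j = (low (main (c + 2) j) = low (main 0 1))" for j
    have "\<not> e 0" using diff[of "c + 2" 0 0 1] c Y unfolding e_def by (auto simp: joined_def)
    have "\<not> e j" if "j \<le> Y - 1" for j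
      using that
    proof (induction j)
      case 0
      then show ?case using \<open>\<not> e 0\<close> by simp
    next
      case (Suc j)
      then have "\<not> e j" "\<not> \<alpha> (lit c j)" using no by auto
      then show ?case
        using gadget_sound[OF c, of j] Suc.prems unfolding e_def \<alpha>_def by auto
    qed
    then have "\<not> e (Y - 1)" by simp
    moreover have "low (main (c + 2) (Y - 1)) \<noteq> low (main 0 0)"
      using c Y by (intro diff) (auto simp: joined_def)
    ultimately show False using \<open>\<not> \<alpha> 0\<close> unfolding e_def \<alpha>_def by auto
  qed
  ultimately show ?thesis unfolding satisfiable_def using compl by blast
qed

end

end

section \<open>Completeness: a local coloring from a satisfying assignment\<close>

locale satisfied_clauses = clause_graph +
  fixes \<alpha> :: "nat \<Rightarrow> bool"
  assumes \<alpha>01: "\<alpha> 1" "\<not> \<alpha> 0"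
    and compl: "\<And>v. 2 * v + 1 < Y \<Longrightarrow> \<alpha> (2 * v) \<noteq> \<alpha> (2 * v + 1)"
    and sat: "\<And>c. c < Y - 2 \<Longrightarrow> \<exists>j<Y - 1. \<alpha> (lit c j)"
begin

text \<open>For odd \<open>k\<close> the single color 2 between the truth values is next to both of
  them; for even \<open>k\<close> color 2 is next to 1 and color 3 is next to 4. With this choice
  the colors \<open>hi + 2 + 2 * b\<close> of the universal nodes, if there are any, end exactly at
  \<open>k\<close>.\<close>

definition hi :: nat where
  "hi = (if odd k then 3 else 4)"

definition tv :: "bool \<Rightarrow> nat" where
  "tv b = (if b then hi else 1)"

definition e :: "nat \<Rightarrow> nat \<Rightarrow> bool" where
  "e c j \<longleftrightarrow> (\<exists>i<j. \<alpha> (lit c i))"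

definition other :: "nat \<Rightarrow> nat \<Rightarrow> nat \<Rightarrow> bool" where
  "other c j i = (if i = 1 then e c j else \<alpha> (lit c j))"

definition att :: "nat \<Rightarrow> nat \<Rightarrow> nat \<Rightarrow> nat \<times> nat \<times> nat" where
  "att c j i = (c + 2, j, k + 1 + i)"

definition mid :: "nat \<Rightarrow> nat \<Rightarrow> nat \<Rightarrow> nat \<Rightarrow> nat \<times> nat \<times> nat" where
  "mid c j i r = (c + 2, j, k + 2 + 2 * i + r)"

fun univ :: "nat \<times> nat \<times> nat \<Rightarrow> bool" where
  "univ (a, b, g) \<longleftrightarrow> a = 1 \<and> b < (k + 1) div 2 - 2 \<and> g < k + 1"

text \<open>The truth values have the colors 1 and \<open>hi\<close>. The colors strictly between them are used only
  where a middle vertex of a gadget connects two vertices of different value, and the universal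
  vertices have colors from \<open>hi + 2\<close> on.\<close>

definition gadget_color :: "nat \<Rightarrow> nat \<Rightarrow> nat \<Rightarrow> nat" where
  "gadget_color c j i =
     (if i = 0 then tv (\<not> e c (Suc j))
      else if i = 1 then tv (\<not> e c j)
      else if i = 2 then tv (\<not> \<alpha> (lit c j))
      else if i = 3 \<or> i = 4 \<and> even k then (if e c (Suc j) = e c j then tv (e c (Suc j)) else i - 1)
      else if i = 5 \<or> i = 6 \<and> even k then (if e c (Suc j) = \<alpha> (lit c j) then tv (e c (Suc j)) else i - 3)
      else 1)"

definition color :: "nat \<times> nat \<times> nat \<Rightarrow> nat" where
  "color v = (case v of (a, b, g) \<Rightarrow>
     if univ v then hi + 2 + 2 * b
     else if g < k + 1 then (if a = 0 then tv (\<alpha> b) else if a = 1 then 1 else tv (e (a - 2) b))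
     else if a < 2 \<or> Y - 1 \<le> b then 1
     else gadget_color (a - 2) b (g - (k + 1)))"

lemma color_node:
  "\<not> univ (a, b, g) \<Longrightarrow> g < k + 1 \<Longrightarrow> a \<noteq> 1 \<Longrightarrow> color (a, b, g) = tv (if a = 0 then \<alpha> b else e (a - 2) b)"
  by (simp add: color_def)

lemma color_gadget: "b < Y - 1 \<Longrightarrow> color (c + 2, b, k + 1 + i) = gadget_color c b i"
  by (simp add: color_def)

lemma e_Suc: "e c (Suc j) \<longleftrightarrow> e c j \<or> \<alpha> (lit c j)"
  by (auto simp: e_def less_Suc_eq)

lemma e_last: "c < Y - 2 \<Longrightarrow> e c (Y - 1)"
  using sat by (simp add: e_def)

lemma not_e_0: "\<not> e c 0"
  by (simp add: e_def)

lemma hi_bounds: "3 \<le> hi" "hi \<le> k"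
  using k by (auto simp: hi_def elim!: evenE)

lemma tv_cases: "tv b = 1 \<or> tv b = hi" "1 \<le> tv b" "tv b \<le> hi"
  using hi_bounds by (auto simp: tv_def)

lemma color_univ: "univ v \<Longrightarrow> color v = hi + 2 + 2 * fst (snd v)"
  by (cases v) (simp add: color_def)

lemma gadget_color_bounds: "1 \<le> gadget_color c j i \<and> gadget_color c j i \<le> hi"
proof -
  have "even k \<Longrightarrow> hi = 4" by (simp add: hi_def)
  then show ?thesis using tv_cases(2,3) hi_bounds unfolding gadget_color_def by auto
qed

lemma color_not_univ: "\<not> univ v \<Longrightarrow> 1 \<le> color v \<and> color v \<le> hi"
  using hi_bounds tv_cases(2,3) gadget_color_bounds by (cases v) (simp add: color_def)

lemma color_range: "1 \<le> color v \<and> color v \<le> k"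
proof (cases "univ v")
  case True
  then obtain b where "color v = hi + 2 + 2 * b" "b < (k + 1) div 2 - 2"
    using color_univ by (cases v) auto
  then show ?thesis using k by (auto simp: hi_def elim!: evenE oddE split: if_splits)
qed (use color_not_univ[of v] hi_bounds in auto)

text \<open>Stands for the vertices that carry a truth value. The bound \<open>k + 4\<close> keeps
  out the middle vertices, which may have the colors 1 and \<open>hi\<close> as well.\<close>

definition plain :: "nat \<times> nat \<times> nat \<Rightarrow> bool" where
  "plain v \<longleftrightarrow> \<not> univ v \<and> (color v = 1 \<or> color v = hi) \<and> snd (snd v) < k + 4"

text \<open>Edges are of three kinds: at a universal vertex, between opposite truth values, and from
  a middle vertex to an attachment of its gadget. In the second kind one end is a copy of a node;
  this records that attachments are not adjacent to each other, which later excludes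
  triangles.\<close>

lemma arc_cases:
  assumes "arc k Y lit u v" "u \<in> cube Y" "v \<in> cube Y"
  shows "univ u \<and> (univ v \<longrightarrow> fst (snd u) \<noteq> fst (snd v)) \<or>
    univ v \<and> (univ u \<longrightarrow> fst (snd u) \<noteq> fst (snd v)) \<or>
    plain u \<and> plain v \<and> color u \<noteq> color v \<and> (snd (snd u) < k + 1 \<or> snd (snd v) < k + 1) \<or>
    (\<exists>c j i r. u = mid c j i r \<and> (v = att c j 0 \<or> v = att c j i) \<and> j < Y - 1 \<and>
       (i = 1 \<or> i = 2) \<and> (r = 0 \<or> r = 1 \<and> even k))"
proof -
  obtain a b g where u: "u = (a, b, g)" by (cases u)
  obtain a' b' g' where v: "v = (a', b', g')" by (cases v)
  have Yb: "a < Y" "b < Y" "a' < Y" "b' < Y" using assms(2,3) by (auto simp: u v cube_def)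
  have tv: "tv x \<noteq> tv y \<longleftrightarrow> x \<noteq> y" for x y using hi_bounds by (auto simp: tv_def)
  have arc: "arc k Y lit (a, b, g) (a', b', g')" using assms(1) by (simp add: u v)
  show ?thesis
  proof (cases "univ u \<or> univ v")
    case True
    have "b \<noteq> b'" if "univ u" "univ v"
      using that arc by (auto simp: u v joined_def gadget_def)
    then show ?thesis using True unfolding u v fst_conv snd_conv by blast
  next
    case nu: False
    then consider (join) "g < k + 1" "g' < k + 1" "joined k Y a b a' b'" "\<not> (a = 1 \<and> b < (k + 1) div 2 - 2)"
      | (gad) "gadget k Y lit a b g a' b' g'"
      using arc by (auto simp: u v)
    then show ?thesis
    proof cases
      case join
      have "a = 0 \<and> a' = 0 \<and> \<alpha> b \<noteq> \<alpha> b' \<or> 2 \<le> a \<and> a' = 0 \<and> e (a - 2) b \<noteq> \<alpha> b'"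
      proof -
        consider "a = 0" "a' = 0" "b div 2 = b' div 2" "b \<noteq> b'"
          | "2 \<le> a" "b = 0" "a' = 0" "b' = 1" | "2 \<le> a" "b = Y - 1" "a' = 0" "b' = 0"
          using join by (auto simp: joined_def)
        then show ?thesis
        proof cases
          case 1
          then have "b = 2 * (b div 2) \<and> b' = 2 * (b div 2) + 1 \<or> b' = 2 * (b div 2) \<and> b = 2 * (b div 2) + 1"
            by arith
          then show ?thesis using compl[of "b div 2"] 1 Yb by metis
        next
          case 3
          then show ?thesis using e_last[of "a - 2"] \<alpha>01 Yb by auto
        qed (use \<alpha>01 not_e_0 in auto)
      qed
      moreover have "plain (x, y, z) \<and> color (x, y, z) = tv (if x = 0 then \<alpha> y else e (x - 2) y)"
        if "\<not> univ (x, y, z)" "z < k + 1" "x \<noteq> 1" for x y z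
        using color_node[OF that] tv_cases(1) that(1,2) by (simp add: plain_def del: univ.simps)
      note this[of a b g] this[of a' b' g']
      ultimately have "plain u \<and> plain v \<and> color u \<noteq> color v"
        using nu join(1,2) tv unfolding u v by (elim disjE conjE) simp_all
      then show ?thesis using join(1) by (simp add: u)
    next
      case gad
      define c where "c = a - 2"
      have ac: "a = c + 2" "2 \<le> a" "b < Y - 1" using gad by (auto simp: gadget_def c_def)
      consider "g = k + 1" "a' = a" "b' = b + 1" "g' < k + 1" | "g = k + 2" "a' = a" "b' = b" "g' < k + 1"
        | "g = k + 3" "a' = 0" "b' = lit c b" "g' < k + 1"
        | "a' = a" "b' = b" "g = k + 4 \<or> g = k + 5 \<and> even k" "g' = k + 1 \<or> g' = k + 2"
        | "a' = a" "b' = b" "g = k + 6 \<or> g = k + 7 \<and> even k" "g' = k + 1 \<or> g' = k + 3"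
        using gad by (auto simp: gadget_def c_def)
      then show ?thesis
      proof cases
        case 4
        then have "\<exists>r. u = mid c b 1 r \<and> (r = 0 \<or> r = 1 \<and> even k)" "v = att c b 0 \<or> v = att c b 1"
          using ac by (auto simp: u v mid_def att_def)
        then show ?thesis using ac by blast
      next
        case 5
        then have "\<exists>r. u = mid c b 2 r \<and> (r = 0 \<or> r = 1 \<and> even k)" "v = att c b 0 \<or> v = att c b 2"
          using ac by (auto simp: u v mid_def att_def)
        then show ?thesis using ac by blast
      next
        case 1
        then have "plain u \<and> plain v \<and> color u \<noteq> color v"
          using nu ac tv tv_cases(1) color_gadget[of b c 0]
          by (simp add: u v plain_def color_node gadget_color_def del: univ.simps)
        then show ?thesis using 1 by (simp add: u v)
      next
        case 2
        then have "plain u \<and> plain v \<and> color u \<noteq> color v"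
          using nu ac tv tv_cases(1) color_gadget[of b c 1]
          by (simp add: u v plain_def color_node gadget_color_def del: univ.simps)
        then show ?thesis using 2 by (simp add: u v)
      next
        case 3
        then have "plain u \<and> plain v \<and> color u \<noteq> color v"
          using nu ac tv tv_cases(1) color_gadget[of b c 2]
          by (simp add: u v plain_def color_node gadget_color_def numeral_eq_Suc del: univ.simps)
        then show ?thesis using 3 by (simp add: u v)
      qed
    qed
  qed
qed

lemma color_mid:
  assumes "j < Y - 1" "i = 1 \<or> i = 2" "r = 0 \<or> r = 1 \<and> even k"
  shows "color (mid c j i r) = (if e c (Suc j) = other c j i then tv (e c (Suc j)) else 2 + r)"
proof -
  have "mid c j i r = (c + 2, j, k + 1 + (1 + 2 * i + r))" by (simp add: mid_def)
  then have "color (mid c j i r) = gadget_color c j (1 + 2 * i + r)"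
    using color_gadget[OF assms(1)] by metis
  then show ?thesis using assms(2,3) by (elim disjE conjE) (simp_all add: gadget_color_def other_def)
qed

lemma color_att:
  assumes "j < Y - 1"
  shows "color (att c j 0) = tv (\<not> e c (Suc j))"
    and "i = 1 \<or> i = 2 \<Longrightarrow> color (att c j i) = tv (\<not> other c j i)"
  unfolding att_def using color_gadget[OF assms, of c 0] color_gadget[OF assms, of c i]
  by (auto simp: gadget_color_def other_def)

text \<open>The edges at middle vertices that bridge a disagreement. All other edges join apart
  colors, so a path that violates the matching condition could use only these.\<close>

definition linked :: "nat \<times> nat \<times> nat \<Rightarrow> nat \<times> nat \<times> nat \<Rightarrow> bool" where
  "linked u v \<longleftrightarrow> (\<exists>c j i r. u = mid c j i r \<and> (v = att c j 0 \<or> v = att c j i) \<and> j < Y - 1 \<and>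
     (i = 1 \<or> i = 2) \<and> (r = 0 \<or> r = 1 \<and> even k) \<and> e c (Suc j) \<noteq> other c j i \<and> color u = 2 + r)"

lemma adj_apart_or_linked:
  assumes "A u v" "u \<in> cube Y" "v \<in> cube Y"
  shows "apart (color u) (color v) \<or> ((linked u v \<or> linked v u) \<and> color u \<noteq> color v)"
proof -
  have *: "apart (color u) (color v) \<or> (linked u v \<and> color u \<noteq> color v)"
    if arc: "arc k Y lit u v" and V: "u \<in> cube Y" "v \<in> cube Y" for u v
  proof -
    consider (u) "univ u" "univ v \<longrightarrow> fst (snd u) \<noteq> fst (snd v)"
      | (v) "univ v" "univ u \<longrightarrow> fst (snd u) \<noteq> fst (snd v)"
      | (p) "plain u" "plain v" "color u \<noteq> color v"
      | (l) c j i r where "u = mid c j i r" "v = att c j 0 \<or> v = att c j i" "j < Y - 1"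
         "i = 1 \<or> i = 2" "r = 0 \<or> r = 1 \<and> even k"
      using arc_cases[OF arc V] by blast
    then show ?thesis
    proof cases
      case u
      then show ?thesis
        using color_univ[of u] color_univ[of v] color_not_univ[of v] by (cases "univ v") (auto simp: apart_def)
    next
      case v
      then show ?thesis
        using color_univ[of u] color_univ[of v] color_not_univ[of u] by (cases "univ u") (auto simp: apart_def)
    next
      case p
      then show ?thesis using hi_bounds by (auto simp: plain_def apart_def)
    next
      case l
      note cm = color_mid[OF l(3-5), of c] and ca = color_att(1)[OF l(3), of c] color_att(2)[OF l(3,4), of c]
      show ?thesis
      proof (cases "e c (Suc j) = other c j i")
        case True
        then have "color u = tv (e c (Suc j))" "color v = tv (\<not> e c (Suc j))"
          using cm ca l(1,2) by auto
        then show ?thesis using hi_bounds by (auto simp: tv_def apart_def)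
      next
        case False
        then have c: "color u = 2 + r" using cm l(1) by simp
        have "\<exists>b. color v = tv b" using ca l(2) by auto
        then have "color v = 1 \<or> color v = hi" using tv_cases(1) by metis
        then have "color u \<noteq> color v" using c l(5) by (auto simp: hi_def split: if_splits)
        moreover have "linked u v" unfolding linked_def using l c False by blast
        ultimately show ?thesis by blast
      qed
    qed
  qed
  show ?thesis using *[of u v] *[of v u] assms apart_sym unfolding adj_def by metis
qed

lemma mid_eq: "r < 2 \<Longrightarrow> r' < 2 \<Longrightarrow> mid c j i r = mid c' j' i' r' \<longleftrightarrow> c = c' \<and> j = j' \<and> i = i' \<and> r = r'"
  by (auto simp: mid_def) presburger+

lemma att_eq: "att c j i = att c' j' i' \<longleftrightarrow> c = c' \<and> j = j' \<and> i = i'"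
  by (auto simp: att_def)

lemma linked_position: "linked u v \<Longrightarrow> k + 4 \<le> snd (snd u) \<and> k + 1 \<le> snd (snd v) \<and> snd (snd v) < k + 4"
  unfolding linked_def by (elim exE conjE disjE) (simp_all add: mid_def att_def)

lemma linkedE:
  assumes "linked u v"
  obtains c j i r where "u = mid c j i r" "v = att c j 0 \<or> v = att c j i" "j < Y - 1" "i = 1 \<or> i = 2"
    "r < 2" "e c (Suc j) \<noteq> other c j i" "color u = 2 + r"
proof -
  from assms obtain c j i r where "u = mid c j i r" "v = att c j 0 \<or> v = att c j i" "j < Y - 1" "i = 1 \<or> i = 2"
    "r = 0 \<or> r = 1 \<and> even k" "e c (Suc j) \<noteq> other c j i" "color u = 2 + r"
    unfolding linked_def by blast
  moreover from this have "r < 2" by linarith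
  ultimately show thesis using that by blast
qed

text \<open>A middle vertex bridging a disagreement has two attachments of different colors. An
  attachment is linked to middle vertices of one side only, because \<open>e c (Suc j)\<close>
  agrees with \<open>e c j\<close> or with \<open>\<alpha> (lit c j)\<close>; and the two vertices
  of a doubled side have the colors 2 and 3.\<close>

lemma linked_path:
  assumes "linked q p \<or> linked p q" "linked q r \<or> linked r q" "p \<noteq> r"
  shows "color p \<noteq> color r"
proof -
  have la: False if "linked q p" "linked r q" for q p r
    using linked_position[OF that(1)] linked_position[OF that(2)] by simp
  consider "linked q p" "linked q r" | "linked p q" "linked r q"
    using assms la by blast
  then show ?thesis
  proof cases
    case 1
    obtain c j i s where q: "q = mid c j i s" "p = att c j 0 \<or> p = att c j i" "j < Y - 1" "i = 1 \<or> i = 2"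
        "s < 2" "e c (Suc j) \<noteq> other c j i"
      using 1(1) by (rule linkedE)
    obtain c' j' i' s' where r: "q = mid c' j' i' s'" "r = att c' j' 0 \<or> r = att c' j' i'" "s' < 2"
      using 1(2) by (rule linkedE)
    have "c = c' \<and> j = j' \<and> i = i'"
      using mid_eq[OF q(5) r(3), of c j i c' j' i'] q(1) r(1) by simp
    then have "r = att c j 0 \<or> r = att c j i" using r(2) by auto
    then show ?thesis
      using q assms(3) color_att(1)[OF q(3), of c] color_att(2)[OF q(3,4), of c] hi_bounds
      by (auto simp: tv_def)
  next
    case 2
    obtain c j i s where p: "p = mid c j i s" "q = att c j 0 \<or> q = att c j i" "j < Y - 1" "i = 1 \<or> i = 2"
        "e c (Suc j) \<noteq> other c j i" "color p = 2 + s"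
      using 2(1) by (rule linkedE)
    obtain c' j' i' s' where r: "r = mid c' j' i' s'" "q = att c' j' 0 \<or> q = att c' j' i'" "i' = 1 \<or> i' = 2"
        "e c' (Suc j') \<noteq> other c' j' i'" "color r = 2 + s'"
      using 2(2) by (rule linkedE)
    have eq: "c' = c" "j' = j" using p(2) r(2) by (auto simp: att_eq)
    have "i' = i"
    proof -
      show ?thesis
        using p(2,4,5) r(2,3,4) e_Suc[of c j] unfolding eq att_eq other_def
        by (elim disjE) (simp_all add: att_eq)
    qed
    then have "s \<noteq> s'" using assms(3) p(1) r(1) eq by metis
    then show ?thesis using p(6) r(5) by simp
  qed
qed

text \<open>Edges between plain vertices have ends of color 1 and \<open>hi\<close>, so these edges
  alone form a bipartite graph. Apart from universal vertices, a middle vertex has only attachments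
  as neighbours, and no two of those are adjacent.\<close>

lemma no_plain_triangle:
  assumes "A p q" "A q r" "A p r" "p \<in> cube Y" "q \<in> cube Y" "r \<in> cube Y"
    and "\<not> univ p" "\<not> univ q" "\<not> univ r"
  shows False
proof -
  let ?g = "\<lambda>v. snd (snd v)"
  have arc: "(plain u \<and> plain v \<and> color u \<noteq> color v \<and> (?g u < k + 1 \<or> ?g v < k + 1)) \<or>
      (k + 4 \<le> ?g u \<and> k + 1 \<le> ?g v \<and> ?g v < k + 4)"
    if h: "arc k Y lit u v" "u \<in> cube Y" "v \<in> cube Y" "\<not> univ u" "\<not> univ v" for u v
  proof -
    consider (p) "plain u \<and> plain v \<and> color u \<noteq> color v \<and> (?g u < k + 1 \<or> ?g v < k + 1)"
      | (l) c j i r where "u = mid c j i r" "v = att c j 0 \<or> v = att c j i" "i = 1 \<or> i = 2"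
      using arc_cases[OF h(1-3)] h(4,5) by blast
    then show ?thesis
    proof cases
      case l
      then show ?thesis by (elim disjE) (simp_all add: mid_def att_def)
    qed blast
  qed
  have *: "(plain u \<and> plain v \<and> color u \<noteq> color v \<and> (?g u < k + 1 \<or> ?g v < k + 1)) \<or>
      (k + 4 \<le> ?g u \<and> k + 1 \<le> ?g v \<and> ?g v < k + 4) \<or> (k + 4 \<le> ?g v \<and> k + 1 \<le> ?g u \<and> ?g u < k + 4)"
    if "A u v" "u \<in> cube Y" "v \<in> cube Y" "\<not> univ u" "\<not> univ v" for u v
    using that(1) arc[of u v] arc[of v u] that(2-5) unfolding adj_def by metis
  have plain: "plain v \<Longrightarrow> ?g v < k + 4 \<and> (color v = 1 \<or> color v = hi)" for v
    by (simp add: plain_def)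
  define E where "E u v \<longleftrightarrow> (plain u \<and> plain v \<and> color u \<noteq> color v \<and> (?g u < k + 1 \<or> ?g v < k + 1)) \<or>
      (k + 4 \<le> ?g u \<and> k + 1 \<le> ?g v \<and> ?g v < k + 4) \<or> (k + 4 \<le> ?g v \<and> k + 1 \<le> ?g u \<and> ?g u < k + 4)" for u v
  have edges: "E p q" "E q r" "E p r" "E q p" "E r q" "E r p"
  proof -
    have sym: "E u v \<Longrightarrow> E v u" for u v unfolding E_def by auto
    show "E p q" "E q r" "E p r"
      unfolding E_def by (rule *[OF assms(1,4,5,7,8)] *[OF assms(2,5,6,8,9)] *[OF assms(3,4,6,7,9)])+
    then show "E q p" "E r q" "E r p" by (simp_all only: sym)
  qed
  have no_mid: "\<not> k + 4 \<le> ?g u" if "E u v" "E u w" "E v w" for u v w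
  proof
    assume u: "k + 4 \<le> ?g u"
    then have "k + 1 \<le> ?g v \<and> ?g v < k + 4" "k + 1 \<le> ?g w \<and> ?g w < k + 4"
      using that(1,2) plain[of u] unfolding E_def by auto
    then show False using that(3) unfolding E_def by auto
  qed
  have "plain p \<and> plain q \<and> plain r \<and> color p \<noteq> color q \<and> color q \<noteq> color r \<and> color p \<noteq> color r"
  proof -
    have "plain u \<and> plain v \<and> color u \<noteq> color v" if "E u v" "\<not> k + 4 \<le> ?g u" "\<not> k + 4 \<le> ?g v" for u v
      using that unfolding E_def by auto
    then show ?thesis
      using edges(1-3) no_mid[OF edges(1,3,2)] no_mid[OF edges(4,2,3)] no_mid[OF edges(6,5,1)] by metis
  qed
  then show False using plain by metis
qed

lemma complete: "semi_ok (cube Y) A k color \<and> triangles_ok (cube Y) A color"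
proof
  have "color p \<noteq> color q + 1 \<and> color q \<noteq> color p + 1"
    if *: "p \<in> cube Y" "q \<in> cube Y" "r \<in> cube Y" "A q p" "A q r" "p \<noteq> r" "color p = color r" for p q r
    using adj_apart_or_linked[OF *(4,2,1)] adj_apart_or_linked[OF *(5,2,3)] linked_path[of q p r] *(6,7)
    unfolding apart_def by auto
  moreover have "color u \<noteq> color v" if "u \<in> cube Y" "v \<in> cube Y" "A u v" for u v
    using adj_apart_or_linked[OF that(3,1,2)] by (auto simp: apart_def)
  ultimately show "semi_ok (cube Y) A k color"
    unfolding semi_ok_def using color_range by blast
  have "far (color p) (color q) \<or> far (color q) (color r) \<or> far (color p) (color r)"
    if *: "p \<in> cube Y" "q \<in> cube Y" "r \<in> cube Y" "A p q" "A q r" "A p r" for p q r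
  proof -
    have c: "(if univ v then hi + 2 \<le> color v else color v \<le> hi)" for v
      using color_univ[of v] color_not_univ[of v] by auto
    have n: "color p \<noteq> color q" "color q \<noteq> color r" "color p \<noteq> color r"
      using adj_apart_or_linked[OF *(4,1,2)] adj_apart_or_linked[OF *(5,2,3)] adj_apart_or_linked[OF *(6,1,3)]
      by (auto simp: apart_def)
    have nl: "\<not> linked u v" if "univ u \<or> univ v" for u v
      using that linked_position[of u v] by (cases u; cases v) auto
    have ap: "univ u \<Longrightarrow> univ v \<Longrightarrow> A u v \<Longrightarrow> u \<in> cube Y \<Longrightarrow> v \<in> cube Y \<Longrightarrow> apart (color u) (color v)" for u v
      using adj_apart_or_linked[of u v] nl by blast
    \<comment> \<open>Some vertex of the triangle is universal. If it is the only one, its color is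
      at least \<open>hi + 2\<close>, and the smaller of the other two distinct colors is below
      \<open>hi\<close>. If there are several, two of them are apart, so the larger color is at
      least \<open>hi + 4\<close>; a third vertex is at most \<open>hi\<close> or is apart from
      both.\<close>
    show ?thesis
      using c[of p] c[of q] c[of r] n ap[of p q] ap[of q r] ap[of p r] * no_plain_triangle[of p q r]
      unfolding far_def apart_def by (auto split: if_splits)
  qed
  then show "triangles_ok (cube Y) A color"
    unfolding triangles_ok_def by blast
qed

end

context clause_graph
begin

theorem graph_correct:
  "(\<exists>\<phi>. semi_ok (cube Y) A k \<phi>) \<longleftrightarrow> satisfiable Y lit"
  "(\<exists>\<phi>. semi_ok (cube Y) A k \<phi> \<and> triangles_ok (cube Y) A \<phi>) \<longleftrightarrow> satisfiable Y lit"
proof -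
  have "\<exists>\<phi>. semi_ok (cube Y) A k \<phi> \<and> triangles_ok (cube Y) A \<phi>" if sat: "satisfiable Y lit"
  proof -
    obtain \<alpha> where "\<alpha> 1 \<and> \<not> \<alpha> 0 \<and> (\<forall>v. 2 * v + 1 < Y \<longrightarrow> \<alpha> (2 * v) \<noteq> \<alpha> (2 * v + 1)) \<and>
     (\<forall>c<Y - 2. \<exists>j<Y - 1. \<alpha> (lit c j))"
      using sat unfolding satisfiable_def by blast
    then interpret satisfied_clauses k Y lit \<alpha>
      by unfold_locales auto
    show ?thesis using complete by blast
  qed
  then show "(\<exists>\<phi>. semi_ok (cube Y) A k \<phi>) \<longleftrightarrow> satisfiable Y lit"
    "(\<exists>\<phi>. semi_ok (cube Y) A k \<phi> \<and> triangles_ok (cube Y) A \<phi>) \<longleftrightarrow> satisfiable Y lit"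
    using sound by blast+
qed

end

section \<open>The graph as an output word\<close>

lemma adj_sym: "adj k Y lit u v \<longleftrightarrow> adj k Y lit v u"
  by (auto simp: adj_def)

lemma adj_irrefl: "\<not> adj k Y lit u u"
  by (cases u) (auto simp: adj_def joined_def gadget_def)

lemma ex_coloring_transport:
  assumes d: "bij_betw d V V'"
  shows "(\<exists>\<phi>. semi_ok V (\<lambda>u v. R (d u) (d v)) k \<phi> \<and> (tri \<longrightarrow> triangles_ok V (\<lambda>u v. R (d u) (d v)) \<phi>)) \<longleftrightarrow>
    (\<exists>\<phi>. semi_ok V' R k \<phi> \<and> (tri \<longrightarrow> triangles_ok V' R \<phi>))"
proof
  have V': "V' = d ` V" and inj: "inj_on d V" using d by (auto simp: bij_betw_def)
  assume "\<exists>\<phi>. semi_ok V (\<lambda>u v. R (d u) (d v)) k \<phi> \<and> (tri \<longrightarrow> triangles_ok V (\<lambda>u v. R (d u) (d v)) \<phi>)"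
  then obtain \<phi> where \<phi>: "semi_ok V (\<lambda>u v. R (d u) (d v)) k \<phi>" "tri \<longrightarrow> triangles_ok V (\<lambda>u v. R (d u) (d v)) \<phi>"
    by blast
  let ?\<psi> = "\<lambda>v. \<phi> (the_inv_into V d v)"
  have "?\<psi> (d u) = \<phi> u" if "u \<in> V" for u using the_inv_into_f_f[OF inj that] by simp
  then have "semi_ok V' R k ?\<psi> \<and> (tri \<longrightarrow> triangles_ok V' R ?\<psi>)"
    using \<phi> unfolding semi_ok_def triangles_ok_def V' by (simp add: inj_on_eq_iff[OF inj])
  then show "\<exists>\<phi>. semi_ok V' R k \<phi> \<and> (tri \<longrightarrow> triangles_ok V' R \<phi>)" by blast
next
  have V': "V' = d ` V" and inj: "inj_on d V" using d by (auto simp: bij_betw_def)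
  assume "\<exists>\<phi>. semi_ok V' R k \<phi> \<and> (tri \<longrightarrow> triangles_ok V' R \<phi>)"
  then obtain \<phi> where \<phi>: "semi_ok V' R k \<phi>" "tri \<longrightarrow> triangles_ok V' R \<phi>" by blast
  have "semi_ok V (\<lambda>u v. R (d u) (d v)) k (\<phi> \<circ> d)"
    using \<phi>(1) unfolding semi_ok_def V' by (simp add: inj_on_eq_iff[OF inj])
  moreover have "tri \<longrightarrow> triangles_ok V (\<lambda>u v. R (d u) (d v)) (\<phi> \<circ> d)"
    using \<phi>(2) unfolding triangles_ok_def V' by simp
  ultimately show "\<exists>\<phi>. semi_ok V (\<lambda>u v. R (d u) (d v)) k \<phi> \<and> (tri \<longrightarrow> triangles_ok V (\<lambda>u v. R (d u) (d v)) \<phi>)"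
    by blast
qed

definition digits :: "nat \<Rightarrow> nat \<Rightarrow> nat \<times> nat \<times> nat" where
  "digits Y z = (z div (Y * Y), z div Y mod Y, z mod Y)"

lemma bij_digits: "bij_betw (digits Y) {..<Y * Y * Y} (cube Y)"
proof (rule bij_betw_byWitness[where f' = "\<lambda>(a, b, g). (a * Y + b) * Y + g"])
  show "\<forall>z\<in>{..<Y * Y * Y}. (case digits Y z of (a, b, g) \<Rightarrow> (a * Y + b) * Y + g) = z"
    by (simp add: digits_def div_mult2_eq)
  show "\<forall>v\<in>cube Y. digits Y (case v of (a, b, g) \<Rightarrow> (a * Y + b) * Y + g) = v"
    by (auto simp: digits_def cube_def div_mult2_eq)
  show "digits Y ` {..<Y * Y * Y} \<subseteq> cube Y"
  proof
    fix v assume "v \<in> digits Y ` {..<Y * Y * Y}"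
    then obtain z where z: "z < Y * Y * Y" "v = digits Y z" by auto
    then have "Y > 0" by (cases Y) auto
    then show "v \<in> cube Y"
      using z less_mult_imp_div_less[of z Y "Y * Y"] by (simp add: digits_def cube_def mult.assoc)
  qed
  show "(\<lambda>(a, b, g). (a * Y + b) * Y + g) ` cube Y \<subseteq> {..<Y * Y * Y}"
  proof clarsimp
    fix a b g assume "(a, b, g) \<in> cube Y"
    then have "Suc a \<le> Y" "Suc b \<le> Y" "Suc g \<le> Y" by (auto simp: cube_def)
    then have "Suc a * Y \<le> Y * Y" by (intro mult_le_mono1)
    then have "Suc (a * Y + b) \<le> Y * Y" using \<open>Suc b \<le> Y\<close> by simp
    then have "Suc (a * Y + b) * Y \<le> Y * Y * Y" by (rule mult_le_mono1)
    then show "(a * Y + b) * Y + g < Y * Y * Y" using \<open>Suc g \<le> Y\<close> by simp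
  qed
qed

lemma comp_closed: "comp 0 f \<Longrightarrow> comp d (\<lambda>x w e. f x w [])"
  using comp_rename[of 0 f "[]" d] by simp

lemma poly_time_computable_graph:
  assumes N: "comp 0 (\<lambda>x w e. N x)" and P: "compb 2 (\<lambda>x w e. P x (e ! 0) (e ! 1))"
  shows "poly_time_computable (\<lambda>x. replicate (N x) True @ [False] @
    concat (map (\<lambda>u. map (\<lambda>v. P x u v) [0..<N x]) [0..<N x]))"
proof -
  have N': "comp d (\<lambda>x w e. N x)" for d using comp_closed[OF N] .
  have bits: "emit d (\<lambda>x e. [b])" for d b
    by (rule emit_bit[of d "\<lambda>x w e. b"]) (rule comp_const)
  have P': "emit (Suc (Suc 0)) (\<lambda>x e. [P x (e ! 0) (e ! 1)])"
    using emit_bit[of 2 "\<lambda>x w e. P x (e ! 0) (e ! 1)"] P by (simp add: compb_def numeral_2_eq_2)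
  have "emit 0 (\<lambda>x e. concat (map (\<lambda>i. [True]) [0..<N x]) @ [False] @
      concat (map (\<lambda>u. concat (map (\<lambda>v. [P x (((e @ [u]) @ [v]) ! 0) (((e @ [u]) @ [v]) ! 1)]) [0..<N x])) [0..<N x]))"
    by (intro emit_append bits emit_loop[OF N, where F = "\<lambda>x e. [True]"]
        emit_loop[OF N, where F = "\<lambda>x e. concat (map (\<lambda>v. [P x ((e @ [v]) ! 0) ((e @ [v]) ! 1)]) [0..<N x])"]
        emit_loop[OF N', where F = "\<lambda>x e. [P x (e ! 0) (e ! 1)]"] P')
  from poly_time_computable_emit[OF this] show ?thesis
    by (simp add: map_replicate_const concat_map_singleton replicate_length_same)
qed

text \<open>The flag \<open>tri\<close> says whether the triangle condition belongs to the problem.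
  The same graph serves both cases, since by \<open>graph_correct\<close> both kinds of coloring
  exist exactly for satisfiable clauses.\<close>

lemma reduction_to_graph_problem:
  fixes P :: "nat set \<Rightarrow> nat set set \<Rightarrow> bool"
  assumes k: "k \<ge> 3"
    and P: "\<And>n E. simple_graph {..<n::nat} E \<Longrightarrow> P {..<n} E \<longleftrightarrow>
     (\<exists>\<phi>. semi_ok {..<n} (adjacent E) k \<phi> \<and> (tri \<longrightarrow> triangles_ok {..<n} (adjacent E) \<phi>))"
    and Y: "comp 0 (\<lambda>x w e. Y x)" "\<And>x. Y x \<ge> k + 8"
    and lit: "comp 2 (\<lambda>x w e. lit x (e ! 0) (e ! 1))" "\<And>x c j. lit x c j < Y x"
    and sat: "\<And>x. x \<in> L \<longleftrightarrow> satisfiable (Y x) (lit x)"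
  shows "poly_time_reducible L (graph_problem P)"
proof -
  define R where "R x u v = adj k (Y x) (lit x) (digits (Y x) u) (digits (Y x) v)" for x u v
  define N where "N x = Y x * Y x * Y x" for x
  define E where "E x = {{u, v} |u v. u < N x \<and> v < N x \<and> R x u v}" for x
  have edge: "{u, v} \<in> E x \<longleftrightarrow> R x u v" if "u < N x" "v < N x" for u v x
  proof -
    have "R x u v \<longleftrightarrow> R x v u" for u v unfolding R_def by (rule adj_sym)
    then show ?thesis using that unfolding E_def mem_Collect_eq doubleton_eq_iff by metis
  qed
  have G: "simple_graph {..<N x} (E x)" for x
    using adj_irrefl unfolding simple_graph_def E_def R_def nsets_def
    by (auto simp: card_2_iff) (metis adj_irrefl)
  define f where "f x = replicate (N x) True @ [False] @
    concat (map (\<lambda>u. map (\<lambda>v. R x u v) [0..<N x]) [0..<N x])" for x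
  have f: "f x = encode_graph (N x) (E x)" for x
    unfolding f_def encode_graph_def using edge by (auto intro!: arg_cong[of _ _ concat])
  have Yd: "comp d (\<lambda>x w e. Y x)" for d using comp_closed[OF Y(1)] .
  have litd: "comp d (\<lambda>x w e. lit x (f1 x w e) (f2 x w e))" if "comp d f1" "comp d f2" for d f1 f2
    using comp_subst2[of "\<lambda>x w. lit x"] lit(1) that by blast
  have "compb 2 (\<lambda>x w e. R x (e ! 0) (e ! 1))"
    unfolding R_def adj_def digits_def arc.simps joined_def gadget_def
    by (intro comp_rules Yd litd; simp add: comp_var)
  moreover have "comp 0 (\<lambda>x w e. N x)"
    unfolding N_def by (intro comp_rules Yd)
  ultimately have "poly_time_computable f"
    unfolding f_def by (intro poly_time_computable_graph)
  moreover have "x \<in> L \<longleftrightarrow> f x \<in> graph_problem P" for x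
  proof -
    interpret clause_graph k "Y x" "lit x" using k Y(2) lit(2) by unfold_locales
    have "f x \<in> graph_problem P \<longleftrightarrow> P {..<N x} (E x)"
    proof
      assume "f x \<in> graph_problem P"
      then obtain n F where "encode_graph (N x) (E x) = encode_graph n F" "simple_graph {..<n} F" "P {..<n} F"
        unfolding f graph_problem_def by blast
      then show "P {..<N x} (E x)" using encode_graph_inject[OF G] by metis
    next
      assume "P {..<N x} (E x)"
      then show "f x \<in> graph_problem P" unfolding f graph_problem_def using G by blast
    qed
    also have "\<dots> \<longleftrightarrow> (\<exists>\<phi>. semi_ok {..<N x} (R x) k \<phi> \<and> (tri \<longrightarrow> triangles_ok {..<N x} (R x) \<phi>))"
    proof -
      have "semi_ok {..<N x} (adjacent (E x)) k \<phi> \<longleftrightarrow> semi_ok {..<N x} (R x) k \<phi>"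
        "triangles_ok {..<N x} (adjacent (E x)) \<phi> \<longleftrightarrow> triangles_ok {..<N x} (R x) \<phi>" for \<phi>
        by (rule semi_ok_cong; simp add: edge)+
      then show ?thesis unfolding P[OF G] by simp
    qed
    also have "\<dots> \<longleftrightarrow> (\<exists>\<phi>. semi_ok (cube (Y x)) A k \<phi> \<and> (tri \<longrightarrow> triangles_ok (cube (Y x)) A \<phi>))"
      unfolding R_def N_def by (rule ex_coloring_transport[OF bij_digits])
    also have "\<dots> \<longleftrightarrow> satisfiable (Y x) (lit x)"
      using graph_correct by (cases tri) auto
    finally show ?thesis using sat by simp
  qed
  ultimately show ?thesis unfolding poly_time_reducible_def by blast
qed

section \<open>From tilings to clauses\<close>

text \<open>A tiling has rows \<open>0, \<dots>, T\<close> and columns \<open>0, \<dots>, 2 * T + 2\<close>. Column \<open>i + 1\<close> of row \<open>t + 1\<close>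
  is constrained by the columns \<open>i\<close>, \<open>i + 1\<close> and \<open>i + 2\<close> of row \<open>t\<close>.\<close>

definition code :: "nat \<Rightarrow> nat \<Rightarrow> nat \<Rightarrow> nat \<Rightarrow> nat \<Rightarrow> nat" where
  "code D a b c d = ((a * D + b) * D + c) * D + d"

definition tileable :: "nat \<Rightarrow> nat \<Rightarrow> (nat \<Rightarrow> nat \<Rightarrow> nat \<Rightarrow> bool) \<Rightarrow> bool" where
  "tileable D T ok \<longleftrightarrow> (\<exists>\<tau>. (\<forall>t i. \<tau> t i < D) \<and> (\<forall>t<T. \<forall>i<2 * T + 1.
     ok t i (code D (\<tau> t i) (\<tau> t (i + 1)) (\<tau> t (i + 2)) (\<tau> (t + 1) (i + 1)))))"

text \<open>This even literal denies tile \<open>a\<close> in column \<open>i\<close> of row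
  \<open>t\<close>, and its successor asserts it. The summand 1 leaves variable 0 to the two
  constants; a row has \<open>2 * T + 3\<close> columns.\<close>

definition no_tile :: "nat \<Rightarrow> nat \<Rightarrow> nat \<Rightarrow> nat \<Rightarrow> nat \<Rightarrow> nat" where
  "no_tile D T t i a = 2 * (1 + ((t * (2 * T + 3) + i) * D + a))"

text \<open>The clause with \<open>g = 0\<close> demands some tile at the position, and the one with
  \<open>g > 0\<close> excludes the window with code \<open>g - 1\<close> unless it is allowed.
  Clauses without a window to exclude consist of the true literal 1, and short clauses are filled up
  with the false literal 0.\<close>

definition tiling_lit :: "nat \<Rightarrow> nat \<Rightarrow> (nat \<Rightarrow> nat \<Rightarrow> nat \<Rightarrow> bool) \<Rightarrow> nat \<Rightarrow> nat \<Rightarrow> nat \<Rightarrow> nat \<Rightarrow> nat" where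
  "tiling_lit D T ok t i g j =
     (if T < t then 1
      else if g = 0 then (if j < D then no_tile D T t i j + 1 else 0)
      else if T \<le> t \<or> 2 * T + 1 \<le> i \<or> ok t i (g - 1) then 1
      else if j = 0 then no_tile D T t i ((g - 1) div (D * D * D))
      else if j = 1 then no_tile D T t (i + 1) ((g - 1) div (D * D) mod D)
      else if j = 2 then no_tile D T t (i + 2) ((g - 1) div D mod D)
      else if j = 3 then no_tile D T (t + 1) (i + 1) ((g - 1) mod D)
      else 0)"

definition clause_lit :: "nat \<Rightarrow> nat \<Rightarrow> (nat \<Rightarrow> nat \<Rightarrow> nat \<Rightarrow> bool) \<Rightarrow> nat \<Rightarrow> nat \<Rightarrow> nat" where
  "clause_lit D T ok c j = tiling_lit D T ok
     (c div (D * D * D * D + 1) div (2 * T + 3)) (c div (D * D * D * D + 1) mod (2 * T + 3))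
     (c mod (D * D * D * D + 1)) j"

text \<open>The summands make room for the literals, for the clause numbers, for the length of a
  clause (\<open>D\<close> or four), and through \<open>b\<close> for the gadgets of the
  graph.\<close>

definition clause_bound :: "nat \<Rightarrow> nat \<Rightarrow> nat \<Rightarrow> nat" where
  "clause_bound b D T = 2 * (1 + (T + 1) * (2 * T + 3) * D) + (T + 1) * (2 * T + 3) * (D * D * D * D + 1) + D + 8 + b"

lemma code_digits:
  assumes "a < D" "b < D" "c < D" "d < D"
  shows "code D a b c d div (D * D * D) = a" "code D a b c d div (D * D) mod D = b"
    "code D a b c d div D mod D = c" "code D a b c d mod D = d"
  using assms by (auto simp: code_def div_mult2_eq)

lemma less_mult_plus:
  assumes "a < (n::nat)" "b < m"
  shows "a * m + b < n * m"
proof -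
  have "Suc a * m \<le> n * m" using assms(1) by (intro mult_le_mono1) simp
  then show ?thesis using assms(2) by simp
qed

lemma div_mod_mult_plus: "b < m \<Longrightarrow> (a * m + b) div m = a \<and> (a * m + b) mod m = (b::nat)"
  by auto

lemma code_less:
  assumes "a < D" "b < D" "c < D" "d < D"
  shows "code D a b c d < D * D * D * D"
  unfolding code_def by (intro less_mult_plus assms)

lemma code_of_digits:
  assumes "g < D * D * D * D"
  shows "code D (g div (D * D * D)) (g div (D * D) mod D) (g div D mod D) (g mod D) = g"
  by (simp add: code_def div_mult2_eq)

context
  fixes D T b :: nat and ok :: "nat \<Rightarrow> nat \<Rightarrow> nat \<Rightarrow> bool"
  assumes D: "D > 0"
begin

abbreviation "B \<equiv> 2 * T + 3"
abbreviation "G \<equiv> D * D * D * D + 1"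
abbreviation "Y \<equiv> clause_bound b D T"

lemma no_tile_less:
  assumes "t \<le> T" "i < B" "a < D"
  shows "no_tile D T t i a + 1 < Y"
proof -
  have "t * B + i < (T + 1) * B" using assms by (intro less_mult_plus) auto
  then have "(t * B + i) * D + a < (T + 1) * B * D" using assms(3) by (rule less_mult_plus)
  then show ?thesis by (simp add: no_tile_def clause_bound_def)
qed

lemma clause_lit_less: "clause_lit D T ok c j < Y"
proof -
  define t where "t = c div G div B"
  define i where "i = c div G mod B"
  define g where "g = c mod G"
  have i: "i < B" by (simp add: i_def)
  have "g < G" unfolding g_def by (rule mod_less_divisor) simp
  moreover have "0 < D * D * D * D" using D by simp
  ultimately have g: "g - 1 < D * D * D * D" by linarith
  have d: "(g - 1) div (D * D * D) < D" using g by (simp add: less_mult_imp_div_less mult.assoc)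
  have Y: "1 < Y" "0 < Y" by (auto simp: clause_bound_def)
  have "tiling_lit D T ok t i g j < Y"
    using no_tile_less[of t i j] no_tile_less[of t i "(g - 1) div (D * D * D)"]
      no_tile_less[of t "i + 1" "(g - 1) div (D * D) mod D"] no_tile_less[of t "i + 2" "(g - 1) div D mod D"]
      no_tile_less[of "t + 1" "i + 1" "(g - 1) mod D"] d i D Y
    unfolding tiling_lit_def by auto
  then show ?thesis by (simp add: clause_lit_def t_def i_def g_def)
qed

lemma clause_number:
  assumes "t \<le> T" "i < B" "g < G"
  obtains c where "c < Y - 2" "\<And>j. clause_lit D T ok c j = tiling_lit D T ok t i g j"
proof
  let ?c = "(t * B + i) * G + g"
  have "t * B + i < (T + 1) * B" using assms by (intro less_mult_plus) auto
  then have "?c < (T + 1) * B * G" using assms(3) by (rule less_mult_plus)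
  then show "?c < Y - 2" by (simp add: clause_bound_def)
  have 1: "?c div G = t * B + i" "?c mod G = g" using div_mod_mult_plus[OF assms(3)] by blast+
  have 2: "(t * B + i) div B = t" "(t * B + i) mod B = i" using assms(2) by auto
  show "clause_lit D T ok ?c j = tiling_lit D T ok t i g j" for j
    unfolding clause_lit_def 1 2 ..
qed

text \<open>At every position some asserted tile is chosen, and its denial is false. A forbidden
  window of chosen tiles would therefore falsify the clause that excludes it.\<close>

lemma satisfiable_imp_tileable:
  assumes "satisfiable Y (clause_lit D T ok)"
  shows "tileable D T ok"
proof -
  obtain \<alpha> where \<alpha>: "\<alpha> 1" "\<not> \<alpha> 0" "\<And>v. 2 * v + 1 < Y \<Longrightarrow> \<alpha> (2 * v) \<noteq> \<alpha> (2 * v + 1)"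
      "\<And>c. c < Y - 2 \<Longrightarrow> \<exists>j<Y - 1. \<alpha> (clause_lit D T ok c j)"
    using assms unfolding satisfiable_def by blast
  have clause: "\<exists>j. \<alpha> (tiling_lit D T ok t i g j)" if tig: "t \<le> T" "i < B" "g < G" for t i g
  proof -
    obtain c where "c < Y - 2" "\<And>j. clause_lit D T ok c j = tiling_lit D T ok t i g j"
      using clause_number[OF tig] by blast
    then show ?thesis using \<alpha>(4)[of c] by auto
  qed
  have "\<exists>a<D. t \<le> T \<and> i < B \<longrightarrow> \<alpha> (no_tile D T t i a + 1)" for t i
  proof (cases "t \<le> T \<and> i < B")
    case True
    then obtain j where "\<alpha> (tiling_lit D T ok t i 0 j)" using clause[of t i 0] by auto
    then show ?thesis
      using \<alpha>(2) True by (auto simp: tiling_lit_def split: if_splits)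
  next
    case False
    then show ?thesis using D by auto
  qed
  then obtain \<tau> where \<tau>: "\<And>t i. \<tau> t i < D \<and> (t \<le> T \<and> i < B \<longrightarrow> \<alpha> (no_tile D T t i (\<tau> t i) + 1))"
    by metis
  have no: "\<not> \<alpha> (no_tile D T t i (\<tau> t i))" if "t \<le> T" "i < B" for t i
    using \<alpha>(3)[of "1 + ((t * B + i) * D + \<tau> t i)"] no_tile_less[OF that, of "\<tau> t i"] \<tau>[of t i] that
    unfolding no_tile_def by auto
  have "ok t i (code D (\<tau> t i) (\<tau> t (i + 1)) (\<tau> t (i + 2)) (\<tau> (t + 1) (i + 1)))" if ti: "t < T" "i < 2 * T + 1" for t i
  proof (rule ccontr)
    define g where "g = code D (\<tau> t i) (\<tau> t (i + 1)) (\<tau> t (i + 2)) (\<tau> (t + 1) (i + 1))"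
    assume "\<not> ok t i (code D (\<tau> t i) (\<tau> t (i + 1)) (\<tau> t (i + 2)) (\<tau> (t + 1) (i + 1)))"
    then have not_ok: "\<not> ok t i g" by (simp add: g_def)
    have d: "g div (D * D * D) = \<tau> t i" "g div (D * D) mod D = \<tau> t (i + 1)"
      "g div D mod D = \<tau> t (i + 2)" "g mod D = \<tau> (t + 1) (i + 1)"
      unfolding g_def using \<tau> by (intro code_digits; blast)+
    have "g + 1 < G" using code_less \<tau> by (simp add: g_def)
    then obtain j where "\<alpha> (tiling_lit D T ok t i (g + 1) j)" using clause[of t i "g + 1"] ti by auto
    then show False
      using no[of t i] no[of t "i + 1"] no[of t "i + 2"] no[of "t + 1" "i + 1"] not_ok ti \<alpha>(2)
      unfolding tiling_lit_def by (simp add: d split: if_splits)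
  qed
  then show ?thesis unfolding tileable_def using \<tau> by blast
qed

lemma tileable_imp_satisfiable:
  assumes "tileable D T ok"
  shows "satisfiable Y (clause_lit D T ok)"
proof -
  obtain \<tau> where \<tau>: "\<And>t i. \<tau> t i < D" "\<And>t i. t < T \<Longrightarrow> i < 2 * T + 1 \<Longrightarrow>
     ok t i (code D (\<tau> t i) (\<tau> t (i + 1)) (\<tau> t (i + 2)) (\<tau> (t + 1) (i + 1)))"
    using assms unfolding tileable_def by blast
  \<comment> \<open>Variable 0 is counted as true, which makes literal 1 true and literal 0 false;
    the other variables are decoded into row, column and tile.\<close>
  define val where "val v \<longleftrightarrow> v = 0 \<or> \<tau> ((v - 1) div D div B) ((v - 1) div D mod B) = (v - 1) mod D" for v
  define \<alpha> where "\<alpha> l = (if odd l then val (l div 2) else \<not> val (l div 2))" for l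
  have no: "\<alpha> (no_tile D T t i a) \<longleftrightarrow> \<tau> t i \<noteq> a" "\<alpha> (Suc (no_tile D T t i a)) \<longleftrightarrow> \<tau> t i = a"
    if "i < B" "a < D" for t i a
  proof -
    have "val (1 + ((t * B + i) * D + a)) \<longleftrightarrow> \<tau> t i = a"
    proof -
      have "((t * B + i) * D + a) div D = t * B + i" "((t * B + i) * D + a) mod D = a" using that(2) by auto
      moreover have "(t * B + i) div B = t" "(t * B + i) mod B = i" using that(1) by auto
      ultimately show ?thesis by (simp only: val_def diff_add_inverse) auto
    qed
    then show "\<alpha> (no_tile D T t i a) \<longleftrightarrow> \<tau> t i \<noteq> a" "\<alpha> (Suc (no_tile D T t i a)) \<longleftrightarrow> \<tau> t i = a"
      unfolding \<alpha>_def no_tile_def by auto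
  qed
  have \<alpha>01: "\<alpha> 1" "\<not> \<alpha> 0" by (auto simp: \<alpha>_def val_def)
  have "\<exists>j<Y - 1. \<alpha> (clause_lit D T ok c j)" for c
  proof -
    define t where "t = c div G div B"
    define i where "i = c div G mod B"
    define g where "g = c mod G"
    have i: "i < B" by (simp add: i_def)
    have gG: "g < G" unfolding g_def by (rule mod_less_divisor) simp
    have lit: "clause_lit D T ok c j = tiling_lit D T ok t i g j" for j
      by (simp add: clause_lit_def t_def i_def g_def)
    have Y: "D < Y - 1" "4 \<le> Y - 1" by (auto simp: clause_bound_def)
    show ?thesis
    proof (cases "T < t \<or> (g \<noteq> 0 \<and> (T \<le> t \<or> 2 * T + 1 \<le> i \<or> ok t i (g - 1)))")
      case True
      then have "clause_lit D T ok c 0 = 1" unfolding lit tiling_lit_def by auto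
      then show ?thesis using \<alpha>01 Y by (intro exI[of _ 0]) auto
    next
      case False
      show ?thesis
      proof (cases "g = 0")
        case True
        then have "clause_lit D T ok c (\<tau> t i) = Suc (no_tile D T t i (\<tau> t i))"
          using False \<tau>(1) unfolding lit tiling_lit_def by auto
        then show ?thesis using no(2)[OF i \<tau>(1)] \<tau>(1)[of t i] Y by (intro exI[of _ "\<tau> t i"]) auto
      next
        case g: False
        then have h: "t < T" "i < 2 * T + 1" "\<not> ok t i (g - 1)" "\<not> T < t" using False by auto
        have g1: "g - 1 < D * D * D * D" using gG g by simp
        let ?a = "(g - 1) div (D * D * D)" and ?b = "(g - 1) div (D * D) mod D" and ?c = "(g - 1) div D mod D"
          and ?d = "(g - 1) mod D"
        have a: "?a < D" using g1 by (simp add: less_mult_imp_div_less mult.assoc)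
        have "\<tau> t i \<noteq> ?a \<or> \<tau> t (i + 1) \<noteq> ?b \<or> \<tau> t (i + 2) \<noteq> ?c \<or> \<tau> (t + 1) (i + 1) \<noteq> ?d"
          using \<tau>(2)[OF h(1,2)] code_of_digits[OF g1] h(3) by metis
        then have "\<alpha> (no_tile D T t i ?a) \<or> \<alpha> (no_tile D T t (i + 1) ?b) \<or> \<alpha> (no_tile D T t (i + 2) ?c) \<or>
            \<alpha> (no_tile D T (t + 1) (i + 1) ?d)"
          using no(1)[of i ?a t] no(1)[of "i + 1" ?b t] no(1)[of "i + 2" ?c t] no(1)[of "i + 1" ?d "t + 1"] a D h(2) by auto
        moreover have "tiling_lit D T ok t i g 0 = no_tile D T t i ?a" "tiling_lit D T ok t i g 1 = no_tile D T t (i + 1) ?b"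
          "tiling_lit D T ok t i g 2 = no_tile D T t (i + 2) ?c" "tiling_lit D T ok t i g 3 = no_tile D T (t + 1) (i + 1) ?d"
          using h g unfolding tiling_lit_def by auto
        ultimately have "\<alpha> (clause_lit D T ok c 0) \<or> \<alpha> (clause_lit D T ok c 1) \<or> \<alpha> (clause_lit D T ok c 2) \<or> \<alpha> (clause_lit D T ok c 3)"
          unfolding lit by simp
        moreover have "0 < Y - 1" "1 < Y - 1" "2 < Y - 1" "3 < Y - 1" using Y by auto
        ultimately show ?thesis by blast
      qed
    qed
  qed
  moreover have "\<alpha> (2 * v) \<noteq> \<alpha> (2 * v + 1)" for v by (simp add: \<alpha>_def)
  ultimately show ?thesis unfolding satisfiable_def using \<alpha>01 by blast
qed

end

section \<open>Tableaux of machines\<close>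

text \<open>A cell shows the state, the symbols under all heads, and what is at one position of each
  tape (the symbol, and whether the head is there). The symbols under the heads are the same in
  all cells of a row, so that the heads may be far away from each other.\<close>

type_synonym cell = "nat \<times> nat list \<times> (nat \<times> bool) list"

definition view :: "config \<Rightarrow> int \<Rightarrow> cell" where
  "view c p = (fst c, map read_tape (snd c), map (\<lambda>a. (fst a p, snd a = p)) (snd c))"

text \<open>The part of the lower cell that a window determines. The symbols under the heads in the
  next row may depend on cells far away and are left to the windows of that row.\<close>

definition core :: "cell \<Rightarrow> nat \<times> (nat \<times> bool) list" where
  "core a = (fst a, snd (snd a))"

definition good :: "tm \<Rightarrow> config \<Rightarrow> bool" where
  "good M c \<longleftrightarrow> fst c < num_states M \<and> length (snd c) = num_tapes M \<and>
     (\<forall>a\<in>set (snd c). \<forall>p. fst a p < num_symbols M)"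

text \<open>Asking for some configuration that looks like this avoids restating the transition
  function for cells; by \<open>step_local\<close> it does not matter which configuration is
  taken.\<close>

definition window :: "tm \<Rightarrow> cell \<Rightarrow> cell \<Rightarrow> cell \<Rightarrow> cell \<Rightarrow> bool" where
  "window M a b c d \<longleftrightarrow> (\<exists>s p. good M s \<and> a = view s (p - 1) \<and> b = view s p \<and> c = view s (p + 1) \<and>
     core d = core (view (step M s) p))"

lemma read_tape_eq: "read_tape a = fst a (snd a)"
  by (cases a) simp

lemma act_on_tape_eq:
  "fst (act_on_tape b a) p = (if snd a = p then fst b else fst a p)"
  "snd (act_on_tape b a) = snd a + offset (snd b)"
  by (cases a; cases b; auto)+

text \<open>Every view contains the state and all scanned symbols, so both configurations take the
  same transition. Heads move by at most one cell, so a head arriving at \<open>p\<close> was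
  visible at \<open>p - 1\<close>, \<open>p\<close> or \<open>p + 1\<close>.\<close>

lemma step_local:
  assumes eq: "view s (p - 1) = view s' (p' - 1)" "view s p = view s' p'" "view s (p + 1) = view s' (p' + 1)"
  shows "core (view (step M s) p) = core (view (step M s') p')"
proof -
  have q: "fst s = fst s'" and ss: "map read_tape (snd s) = map read_tape (snd s')"
    using eq(2) by (auto simp: view_def)
  have len: "length (snd s) = length (snd s')" using ss map_eq_imp_length_eq by blast
  have nth: "fst (snd s ! j) (p + d) = fst (snd s' ! j) (p' + d) \<and> (snd (snd s ! j) = p + d \<longleftrightarrow> snd (snd s' ! j) = p' + d)"
    if "j < length (snd s)" "d \<in> {-1, 0, 1}" for j d
  proof -
    have "map (\<lambda>a. (fst a (p + d), snd a = p + d)) (snd s) = map (\<lambda>a. (fst a (p' + d), snd a = p' + d)) (snd s')"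
      using eq that(2) by (auto simp: view_def)
    then have "map (\<lambda>a. (fst a (p + d), snd a = p + d)) (snd s) ! j = map (\<lambda>a. (fst a (p' + d), snd a = p' + d)) (snd s') ! j"
      by simp
    then show ?thesis using that(1) len by simp
  qed
  show ?thesis
  proof (cases "halted M s")
    case True
    then have "halted M s'" using q by (simp add: halted_def)
    then show ?thesis using True eq(2) by (simp add: step_def)
  next
    case False
    then have h: "\<not> halted M s'" using q by (simp add: halted_def)
    obtain r as where tr: "transition M (fst s) (map read_tape (snd s)) = (r, as)" by fastforce
    have "map (\<lambda>a. (fst a p, snd a = p)) (map2 act_on_tape as (snd s)) =
        map (\<lambda>a. (fst a p', snd a = p')) (map2 act_on_tape as (snd s'))"
    proof (rule nth_equalityI)
      fix j assume "j < length (map (\<lambda>a. (fst a p, snd a = p)) (map2 act_on_tape as (snd s)))"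
      then have j: "j < length as" "j < length (snd s)" "j < length (snd s')" using len by auto
      have off: "snd (snd s ! j) + offset m = p \<longleftrightarrow> snd (snd s' ! j) + offset m = p'" for m
      proof -
        have "- offset m \<in> {-1, 0, 1}" by (cases m) auto
        then show ?thesis using nth[OF j(2), of "- offset m"] by auto
      qed
      show "map (\<lambda>a. (fst a p, snd a = p)) (map2 act_on_tape as (snd s)) ! j =
        map (\<lambda>a. (fst a p', snd a = p')) (map2 act_on_tape as (snd s')) ! j"
        using j nth[OF j(2), of 0] off by (simp add: act_on_tape_eq)
    qed (simp add: len)
    then show ?thesis
      using False h tr q ss by (simp add: step_def core_def view_def)
  qed
qed

lemma wf_transition:
  assumes "wf_tm M" "q < num_states M" "length ss = num_tapes M" "set ss \<subseteq> {..<num_symbols M}"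
    and "transition M q ss = (r, as)"
  shows "r < num_states M \<and> length as = num_tapes M \<and> fst ` set as \<subseteq> {..<num_symbols M}"
proof -
  have H: "\<forall>q ss. q < num_states M \<and> length ss = num_tapes M \<and> set ss \<subseteq> {..<num_symbols M} \<longrightarrow>
      (case transition M q ss of (q', as) \<Rightarrow>
         q' < num_states M \<and> length as = num_tapes M \<and> fst ` set as \<subseteq> {..<num_symbols M})"
    using assms(1) unfolding wf_tm_def by (elim conjE)
  have "case transition M q ss of (q', as) \<Rightarrow>
           q' < num_states M \<and> length as = num_tapes M \<and> fst ` set as \<subseteq> {..<num_symbols M}"
    by (rule mp[OF spec[OF spec[OF H]]]) (intro conjI assms)
  then show ?thesis using assms(5) by simp
qed

lemma map2_actE:
  assumes "a \<in> set (map2 act_on_tape as ts)"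
  obtains b c where "b \<in> set as" "c \<in> set ts" "a = act_on_tape b c"
proof -
  obtain z where "z \<in> set (zip as ts)" "a = (case z of (b, c) \<Rightarrow> act_on_tape b c)"
    using assms unfolding set_map by (rule imageE)
  moreover obtain b c where "z = (b, c)" by (cases z)
  ultimately show thesis using that[of b c] set_zip_leftD[of b c as ts] set_zip_rightD[of b c as ts] by simp
qed

lemma good_step:
  assumes "wf_tm M" "good M s"
  shows "good M (step M s)"
proof (cases "halted M s")
  case False
  obtain r as where tr: "transition M (fst s) (map read_tape (snd s)) = (r, as)" by fastforce
  have "set (map read_tape (snd s)) \<subseteq> {..<num_symbols M}"
    using assms(2) by (auto simp: good_def read_tape_eq)
  then have ras: "r < num_states M" "length as = num_tapes M" "fst ` set as \<subseteq> {..<num_symbols M}"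
    using wf_transition[OF assms(1) _ _ _ tr] assms(2) by (auto simp: good_def)
  have "fst a p < num_symbols M" if a: "a \<in> set (map2 act_on_tape as (snd s))" for a p
  proof -
    obtain b c where bc: "b \<in> set as" "c \<in> set (snd s)" "a = act_on_tape b c"
      using a by (rule map2_actE)
    then show ?thesis using ras(3) assms(2) by (auto simp: act_on_tape_eq good_def)
  qed
  then show ?thesis using False tr ras assms(2) by (simp add: step_def good_def)
qed (use assms in \<open>simp add: step_def\<close>)

text \<open>During the first \<open>T\<close> steps nothing happens beyond distance
  \<open>T\<close>, so the positions at distance \<open>T + 1\<close> can serve as a fixed border
  without symbols and heads.\<close>

definition near :: "nat \<Rightarrow> nat \<Rightarrow> config \<Rightarrow> bool" where
  "near T t s \<longleftrightarrow> (\<forall>a\<in>set (snd s). \<bar>snd a\<bar> \<le> int t \<and> (\<forall>p. \<bar>p\<bar> > int T \<longrightarrow> fst a p = 0))"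

lemma near_step:
  assumes "near T t s" "t \<le> T"
  shows "near T (Suc t) (step M s)"
proof (cases "halted M s")
  case True
  then show ?thesis using assms by (auto simp: step_def near_def)
next
  case False
  obtain r as where tr: "transition M (fst s) (map read_tape (snd s)) = (r, as)" by fastforce
  have "\<bar>snd a\<bar> \<le> int (Suc t) \<and> (\<forall>p. \<bar>p\<bar> > int T \<longrightarrow> fst a p = 0)" if a: "a \<in> set (map2 act_on_tape as (snd s))" for a
  proof -
    obtain b c where bc: "b \<in> set as" "c \<in> set (snd s)" "a = act_on_tape b c"
      using a by (rule map2_actE)
    have "\<bar>offset (snd b)\<bar> \<le> 1" by (cases "snd b") auto
    then show ?thesis using bc assms by (auto simp: act_on_tape_eq near_def)
  qed
  then show ?thesis using False tr by (simp add: step_def near_def)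
qed

lemma length_initial: "length (snd (initial_config M [x, w])) = max 2 (num_tapes M)"
  by (simp add: initial_config_def)

lemma initial_tapes:
  assumes "a \<in> set (snd (initial_config M [x, w]))"
  shows "a = input_tape x \<or> a = input_tape w \<or> a = input_tape []"
  using assms by (auto simp: initial_config_def)

lemma bit_symbol_bounds: "bit_symbol b < 3" "bit_symbol b \<noteq> 0"
  by (cases b; simp)+

lemma good_initial: "wf_tm M \<Longrightarrow> good M (initial_config M [x, w])"
  unfolding good_def
  using initial_tapes[of _ M x w] length_initial[of M x w] bit_symbol_bounds(1)
  by (auto simp: wf_tm_def initial_config_def input_tape_def intro: less_le_trans[of _ 3])

lemma near_initial: "length x \<le> T \<Longrightarrow> length w \<le> T \<Longrightarrow> near T 0 (initial_config M [x, w])"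
  unfolding near_def using initial_tapes[of _ M x w] by (fastforce simp: input_tape_def)

lemma good_after: "wf_tm M \<Longrightarrow> good M (config_after M [x, w] t)"
  by (induction t) (auto simp: config_after_def good_initial good_step)

lemma near_after:
  "length x \<le> T \<Longrightarrow> length w \<le> T \<Longrightarrow> t \<le> T \<Longrightarrow> near T t (config_after M [x, w] t)"
  by (induction t) (auto simp: config_after_def near_initial near_step)

text \<open>The flags say where in the tableau the cells \<open>a\<close>, \<open>b\<close>, \<open>c\<close> (side by side) and \<open>d\<close> (below
  \<open>b\<close>) are, and what the input is: at the left or right border, in the first row, at a position that
  is not negative, in the last row at position 0; with an input bit that is 1, with an input bit,
  at position 0, and at a position that belongs to a certificate of maximal length.\<close>

definition cell_ok :: "tm \<Rightarrow> bool list \<Rightarrow> cell \<Rightarrow> cell \<Rightarrow> cell \<Rightarrow> cell \<Rightarrow> bool" where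
  "cell_ok M fl a b c d \<longleftrightarrow> window M a b c d \<and>
     (fl ! 0 \<longrightarrow> snd (snd a) = replicate (num_tapes M) (0, False)) \<and>
     (fl ! 1 \<longrightarrow> snd (snd c) = replicate (num_tapes M) (0, False)) \<and>
     (fl ! 2 \<longrightarrow> (\<exists>z. (z = 0 \<or> fl ! 8 \<and> z \<in> {1, 2}) \<and>
        core b = (start_state M, (if fl ! 5 then 2 else of_bool (fl ! 6), fl ! 7) # (z, fl ! 7) #
          replicate (num_tapes M - 2) (0, fl ! 7)))) \<and>
     (fl ! 2 \<and> fl ! 3 \<and> fst (snd (snd b) ! 1) = 0 \<longrightarrow> fst (snd (snd c) ! 1) = 0) \<and>
     (fl ! 4 \<longrightarrow> fst d = accept_state M)"

definition flags :: "bool list \<Rightarrow> nat \<Rightarrow> nat \<Rightarrow> nat \<Rightarrow> nat \<Rightarrow> bool list" where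
  "flags x q T t i = [i = 0, i = 2 * T, t = 0, T \<le> i, t + 1 = T \<and> i = T,
     T \<le> i \<and> bit_at x (i - T), T \<le> i \<and> i - T < length x, i = T, T \<le> i \<and> i - T < q]"

lemma cell_ok_flags:
  "cell_ok M (flags x q T t i) a b c d \<longleftrightarrow> window M a b c d \<and>
     (i = 0 \<longrightarrow> snd (snd a) = replicate (num_tapes M) (0, False)) \<and>
     (i = 2 * T \<longrightarrow> snd (snd c) = replicate (num_tapes M) (0, False)) \<and>
     (t = 0 \<longrightarrow> (\<exists>z. (z = 0 \<or> (T \<le> i \<and> i - T < q) \<and> z \<in> {1, 2}) \<and>
        core b = (start_state M, (fst (input_tape x) (int i - int T), i = T) # (z, i = T) #
          replicate (num_tapes M - 2) (0, i = T)))) \<and>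
     (t = 0 \<and> T \<le> i \<and> fst (snd (snd b) ! 1) = 0 \<longrightarrow> fst (snd (snd c) ! 1) = 0) \<and>
     (t + 1 = T \<and> i = T \<longrightarrow> fst d = accept_state M)"
proof -
  have "bit_symbol b = (if b then 2 else 1)" for b by (cases b) auto
  moreover have "nat (int i - int T) = i - T" by simp
  ultimately have "fst (input_tape x) (int i - int T) =
      (if T \<le> i \<and> bit_at x (i - T) then 2 else of_bool (T \<le> i \<and> i - T < length x))"
    by (auto simp: input_tape_def bit_at_def)
  moreover have "flags x q T t i ! 0 \<longleftrightarrow> i = 0" "flags x q T t i ! 1 \<longleftrightarrow> i = 2 * T" "flags x q T t i ! 2 \<longleftrightarrow> t = 0"
    "flags x q T t i ! 3 \<longleftrightarrow> T \<le> i" "flags x q T t i ! 4 \<longleftrightarrow> t + 1 = T \<and> i = T"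
    "flags x q T t i ! 5 \<longleftrightarrow> T \<le> i \<and> bit_at x (i - T)" "flags x q T t i ! 6 \<longleftrightarrow> T \<le> i \<and> i - T < length x"
    "flags x q T t i ! 7 \<longleftrightarrow> i = T" "flags x q T t i ! 8 \<longleftrightarrow> T \<le> i \<and> i - T < q"
    by (simp_all add: flags_def numeral_eq_Suc)
  ultimately show ?thesis unfolding cell_ok_def by (simp only:)
qed

definition cells :: "tm \<Rightarrow> cell set" where
  "cells M = {..<num_states M} \<times> {ss. set ss \<subseteq> {..<num_symbols M} \<and> length ss = num_tapes M} \<times>
     {ls. set ls \<subseteq> {..<num_symbols M} \<times> UNIV \<and> length ls = num_tapes M}"

lemma finite_cells: "finite (cells M)"
  unfolding cells_def by (intro finite_cartesian_product finite_lists_length_eq) auto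

lemma view_in_cells: "good M s \<Longrightarrow> view s p \<in> cells M"
  by (auto simp: good_def view_def cells_def read_tape_eq)

definition tableau :: "tm \<Rightarrow> bool list \<Rightarrow> nat \<Rightarrow> nat \<Rightarrow> (nat \<Rightarrow> nat \<Rightarrow> cell) \<Rightarrow> bool" where
  "tableau M x q T \<tau> \<longleftrightarrow> (\<forall>t<T. \<forall>i<2 * T + 1.
     cell_ok M (flags x q T t i) (\<tau> t i) (\<tau> t (i + 1)) (\<tau> t (i + 2)) (\<tau> (t + 1) (i + 1)))"

lemma view_initial:
  assumes "wf_tm M"
  shows "snd (snd (view (initial_config M [x, w]) p)) =
    (fst (input_tape x) p, 0 = p) # (fst (input_tape w) p, 0 = p) # replicate (num_tapes M - 2) (0, 0 = p)"
proof -
  obtain K where "num_tapes M = Suc (Suc K)"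
    using assms unfolding wf_tm_def by (metis Suc_le_D numeral_2_eq_2 Suc_le_mono)
  then show ?thesis
    by (simp add: view_def initial_config_def) (simp add: input_tape_def map_replicate)
qed

lemma tableau_of_computation:
  assumes wf: "wf_tm M" and T: "length x \<le> T" "length w \<le> q" "q \<le> T" "0 < T"
    and acc: "fst (config_after M [x, w] T) = accept_state M"
  shows "tableau M x q T (\<lambda>t i. view (config_after M [x, w] t) (int i - int T - 1))"
  unfolding tableau_def
proof (intro allI impI)
  fix t i assume ti: "t < T" "i < 2 * T + 1"
  define s where "s = config_after M [x, w] t"
  define p where "p = int i - int T"
  have good: "good M s" unfolding s_def by (rule good_after[OF wf])
  have near: "near T t s" unfolding s_def using T ti by (intro near_after) auto
  have st: "config_after M [x, w] (t + 1) = step M s" by (simp add: s_def config_after_def)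
  have pos: "int i - int T - 1 = p - 1" "int (i + 1) - int T - 1 = p" "int (i + 2) - int T - 1 = p + 1"
    by (auto simp: p_def)
  have win: "window M (view s (p - 1)) (view s p) (view s (p + 1)) (view (step M s) p)"
    unfolding window_def using good by blast
  have border: "snd (snd (view s p')) = replicate (num_tapes M) (0, False)" if "\<bar>p'\<bar> = int T + 1" for p'
  proof -
    have "map (\<lambda>a. (fst a p', snd a = p')) (snd s) = map (\<lambda>a. (0, False)) (snd s)"
      using near that ti by (intro map_cong) (auto simp: near_def)
    then show ?thesis using good by (simp add: view_def good_def map_replicate_const)
  qed
  have pb: "i = 0 \<Longrightarrow> \<bar>p - 1\<bar> = int T + 1" "i = 2 * T \<Longrightarrow> \<bar>p + 1\<bar> = int T + 1" by (auto simp: p_def)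
  have init: "\<exists>z. (z = 0 \<or> (T \<le> i \<and> i - T < q) \<and> z \<in> {1, 2}) \<and>
      core (view s p) = (start_state M, (fst (input_tape x) p, i = T) # (z, i = T) # replicate (num_tapes M - 2) (0, i = T))"
    if "t = 0"
  proof (intro exI conjI)
    have s: "s = initial_config M [x, w]" using that by (simp add: s_def config_after_def)
    let ?z = "fst (input_tape w) p"
    have "bit_symbol b = 1 \<or> bit_symbol b = 2" for b by (cases b) auto
    then show "?z = 0 \<or> (T \<le> i \<and> i - T < q) \<and> ?z \<in> {1, 2}"
      using T(2) by (auto simp: input_tape_def p_def)
    have "0 = p \<longleftrightarrow> i = T" by (auto simp: p_def)
    then show "core (view s p) = (start_state M, (fst (input_tape x) p, i = T) # (?z, i = T) # replicate (num_tapes M - 2) (0, i = T))"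
      using view_initial[OF wf, of x w p] unfolding core_def s by (simp add: view_def initial_config_def)
  qed
  have mono: "fst (snd (snd (view s (p + 1))) ! 1) = 0"
    if "t = 0" "T \<le> i" "fst (snd (snd (view s p)) ! 1) = 0"
  proof -
    have s: "s = initial_config M [x, w]" using that by (simp add: s_def config_after_def)
    have "fst (input_tape w) p = 0" using that(3) view_initial[OF wf, of x w p] by (simp add: s)
    then have "\<not> p < int (length w)" using that(2) by (auto simp: input_tape_def p_def bit_symbol_bounds(2) split: if_splits)
    then have "fst (input_tape w) (p + 1) = 0" by (auto simp: input_tape_def)
    then show ?thesis using view_initial[OF wf, of x w "p + 1"] by (simp add: s)
  qed
  have fin: "fst (view (step M s) p) = accept_state M" if "t + 1 = T"
    using acc st that by (simp add: view_def)
  show "cell_ok M (flags x q T t i) (view (config_after M [x, w] t) (int i - int T - 1))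
     (view (config_after M [x, w] t) (int (i + 1) - int T - 1)) (view (config_after M [x, w] t) (int (i + 2) - int T - 1))
     (view (config_after M [x, w] (t + 1)) (int (i + 1) - int T - 1))"
    unfolding pos st s_def[symmetric] cell_ok_flags p_def[symmetric]
  proof (intro conjI impI, goal_cases)
    case 1
    show ?case by (rule win)
  next
    case 2
    then show ?case by (intro border pb)
  next
    case 3
    then show ?case by (intro border pb)
  next
    case 4
    then show ?case by (rule init)
  next
    case 5
    then show ?case by (elim conjE) (rule mono)
  next
    case 6
    then show ?case by (elim conjE) (rule fin)
  qed
qed

text \<open>The certificate is read off row 0. By induction the cores of a row are those of the
  computation. Overlapping windows keep the state and the scanned symbols constant along the row,
  and the cell where a head stands fixes its scanned symbol; so entire cells agree, and the windows
  determine the cores of the next row.\<close>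

lemma computation_of_tableau:
  assumes wf: "wf_tm M" and T: "length x \<le> T" "q \<le> T" "0 < T"
    and tab: "tableau M x q T \<tau>"
  shows "\<exists>w. length w \<le> q \<and> fst (config_after M [x, w] T) = accept_state M"
proof -
  have ok: "cell_ok M (flags x q T t i) (\<tau> t i) (\<tau> t (i + 1)) (\<tau> t (i + 2)) (\<tau> (t + 1) (i + 1))"
    if "t < T" "i < 2 * T + 1" for t i
    using tab that unfolding tableau_def by blast
  have win: "window M (\<tau> t i) (\<tau> t (i + 1)) (\<tau> t (i + 2)) (\<tau> (t + 1) (i + 1))"
    if "t < T" "i < 2 * T + 1" for t i
    using ok[OF that] unfolding cell_ok_flags by (elim conjE)
  have border: "snd (snd (\<tau> t i)) = replicate (num_tapes M) (0, False)"
    if t: "t < T" and i: "i = 0 \<or> i = 2 * T + 2" for t i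
  proof -
    have "snd (snd (\<tau> t 0)) = replicate (num_tapes M) (0, False)"
      using ok[OF t, of 0] unfolding cell_ok_flags by simp
    moreover have "snd (snd (\<tau> t (2 * T + 2))) = replicate (num_tapes M) (0, False)"
      using ok[OF t, of "2 * T"] unfolding cell_ok_flags by simp
    ultimately show ?thesis using i by auto
  qed
  define z where "z p = fst (snd (snd (\<tau> 0 (T + p + 1))) ! 1)" for p
  have init: "\<exists>z. (z = 0 \<or> (T \<le> i \<and> i - T < q) \<and> z \<in> {1, 2}) \<and>
      core (\<tau> 0 (i + 1)) = (start_state M, (fst (input_tape x) (int i - int T), i = T) # (z, i = T) #
        replicate (num_tapes M - 2) (0, i = T))" if i: "i < 2 * T + 1" for i
    using ok[OF T(3) i] unfolding cell_ok_flags by blast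
  have z: "z p = 0 \<or> p < q \<and> z p \<in> {1, 2}" if p: "p \<le> T" for p
  proof -
    have "T + p < 2 * T + 1" using p by simp
    from init[OF this] obtain z' where z': "z' = 0 \<or> (T \<le> T + p \<and> T + p - T < q) \<and> z' \<in> {1, 2}"
      "snd (core (\<tau> 0 (T + p + 1))) ! 1 = (z', T + p = T)"
      by fastforce
    then have "z p = z'" by (simp add: z_def core_def)
    then show ?thesis using z' by simp
  qed
  have z_mono: "z (Suc p) = 0" if "p < T" "z p = 0" for p
    using ok[OF T(3), of "T + p"] that unfolding cell_ok_flags z_def by simp
  \<comment> \<open>From position 0 on, blanks on tape 1 propagate to the right, so the first of
    them ends the certificate; position \<open>q\<close> is blank at the latest.\<close>
  define l where "l = (LEAST p. z p = 0)"
  have "z q = 0" using z[OF T(2)] by simp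
  then have l: "z l = 0" "l \<le> q" "\<And>p. p < l \<Longrightarrow> z p \<noteq> 0"
    unfolding l_def by (auto intro: LeastI Least_le dest: not_less_Least)
  have z_after: "z p = 0" if "l \<le> p" "p \<le> T" for p
    using that by (induction p rule: dec_induct) (auto intro: l z_mono)
  define w where "w = map (\<lambda>p. z p = 2) [0..<l]"
  have w: "length w = l" by (simp add: w_def)
  have input_w: "fst (input_tape w) (int p) = z p" if "p \<le> T" for p
  proof (cases "p < l")
    case True
    then have "z p = 1 \<or> z p = 2" using z[OF that] l(3) by auto
    then show ?thesis using True by (auto simp: input_tape_def w_def)
  next
    case False
    then show ?thesis using z_after[of p] that w by (auto simp: input_tape_def)
  qed
  define s where "s t = config_after M [x, w] t" for t
  have s_Suc: "s (t + 1) = step M (s t)" for t by (simp add: s_def config_after_def)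
  have good: "good M (s t)" for t unfolding s_def by (rule good_after[OF wf])
  have near: "near T t (s t)" if "t \<le> T" for t
    unfolding s_def using T that w l(2) by (intro near_after) auto
  have row: "\<forall>i<2 * T + 1. core (\<tau> t (i + 1)) = core (view (s t) (int i - int T))" if "t \<le> T" for t
    using that
  proof (induction t)
    case 0
    show ?case
    proof (intro allI impI)
      fix i assume i: "i < 2 * T + 1"
      define p where "p = int i - int T"
      obtain z' where z': "z' = 0 \<or> (T \<le> i \<and> i - T < q) \<and> z' \<in> {1, 2}"
        "core (\<tau> 0 (i + 1)) = (start_state M, (fst (input_tape x) p, i = T) # (z', i = T) # replicate (num_tapes M - 2) (0, i = T))"
        using init[OF i] unfolding p_def by blast
      have "fst (input_tape w) p = z'"
      proof (cases "T \<le> i")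
        case True
        then have "z (i - T) = z'" using z'(2) by (simp add: z_def core_def)
        moreover have "int (i - T) = p" "i - T \<le> T" using True i by (auto simp: p_def)
        ultimately show ?thesis using input_w[of "i - T"] by simp
      next
        case False
        then show ?thesis using z'(1) by (auto simp: input_tape_def p_def)
      qed
      moreover have "0 = p \<longleftrightarrow> i = T" by (auto simp: p_def)
      ultimately show "core (\<tau> 0 (i + 1)) = core (view (s 0) (int i - int T))"
        using view_initial[OF wf, of x w p] z'(2) unfolding p_def[symmetric]
        by (simp add: core_def s_def config_after_def view_def initial_config_def)
    qed
  next
    case (Suc t)
    then have t: "t < T" and IH: "\<And>i. i < 2 * T + 1 \<Longrightarrow> core (\<tau> t (i + 1)) = core (view (s t) (int i - int T))" by auto
    let ?c = "\<lambda>i. (fst (\<tau> t i), fst (snd (\<tau> t i)))"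
    have same: "?c (i + 1) = ?c i \<and> ?c (i + 2) = ?c i" if i: "i < 2 * T + 1" for i
      using win[OF t i] unfolding window_def by (auto simp: view_def)
    have const: "?c i = ?c 0" if "i \<le> 2 * T + 2" for i
      using that
    proof (induction i)
      case (Suc i)
      then show ?case using same[of i] same[of "i - 1"] by (cases "i < 2 * T + 1") auto
    qed simp
    have "fst (\<tau> t 0) = fst (s t)"
      using IH[of 0] const[of 1] by (simp add: core_def view_def)
    moreover have "fst (snd (\<tau> t 0)) = map read_tape (snd (s t))"
    proof (rule nth_equalityI)
      show "length (fst (snd (\<tau> t 0))) = length (map read_tape (snd (s t)))"
        using win[OF t, of 0] good[of t] unfolding window_def by (auto simp: view_def good_def)
      fix j assume "j < length (fst (snd (\<tau> t 0)))"
      then have j: "j < num_tapes M" "j < length (snd (s t))"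
        using win[OF t, of 0] good[of t] unfolding window_def by (auto simp: view_def good_def)
      define a where "a = snd (s t) ! j"
      have "a \<in> set (snd (s t))" using j by (simp add: a_def)
      then have "\<bar>snd a\<bar> \<le> int t" using near[of t] t by (auto simp: near_def)
      define i where "i = nat (snd a + int T)"
      have i: "i < 2 * T + 1" "int i - int T = snd a"
        using \<open>\<bar>snd a\<bar> \<le> int t\<close> t by (auto simp: i_def)
      have 1: "snd (snd (\<tau> t (i + 1))) ! j = (fst a (snd a), True)"
        using IH[OF i(1)] j unfolding i(2) by (simp add: core_def view_def a_def)
      \<comment> \<open>This cell is the view of some configuration and shows the head of tape
        \<open>j\<close>, so the scanned symbol that it lists must be the symbol that it shows
        there.\<close>
      obtain s' p' where s': "good M s'" "\<tau> t (i + 1) = view s' p'"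
        using win[OF t i(1)] unfolding window_def by blast
      then have j': "j < length (snd s')" using j by (simp add: good_def)
      have "fst (snd s' ! j) p' = fst a (snd a)" "snd (snd s' ! j) = p'"
        using 1 j' unfolding s'(2) by (simp_all add: view_def)
      then have "fst (snd (\<tau> t (i + 1))) ! j = fst a (snd a)"
        using j' unfolding s'(2) by (simp add: view_def read_tape_eq)
      then show "fst (snd (\<tau> t 0)) ! j = map read_tape (snd (s t)) ! j"
        using const[of "i + 1"] i(1) j(2) by (simp add: a_def read_tape_eq)
    qed
    moreover have "snd (snd (\<tau> t i)) = snd (snd (view (s t) (int i - int T - 1)))" if "i \<le> 2 * T + 2" for i
    proof (cases "i = 0 \<or> i = 2 * T + 2")
      case True
      then have p: "\<bar>int i - int T - 1\<bar> = int T + 1" by auto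
      have "map (\<lambda>a. (fst a (int i - int T - 1), snd a = int i - int T - 1)) (snd (s t)) = map (\<lambda>a. (0, False)) (snd (s t))"
        using near[of t] p t by (intro map_cong) (auto simp: near_def)
      then show ?thesis using border[OF t True] good[of t] by (simp add: view_def good_def map_replicate_const)
    next
      case False
      then obtain i' where "i = i' + 1" "i' < 2 * T + 1" using \<open>i \<le> 2 * T + 2\<close> by (cases i) auto
      then show ?thesis using IH[of i'] by (simp add: core_def)
    qed
    ultimately have full: "\<tau> t i = view (s t) (int i - int T - 1)" if "i \<le> 2 * T + 2" for i
      using const[OF that] that by (intro prod_eqI) (auto simp: view_def)
    show ?case
    proof (intro allI impI)
      fix i assume i: "i < 2 * T + 1"
      define p where "p = int i - int T"
      have pos: "int i - int T - 1 = p - 1" "int (i + 1) - int T - 1 = p" "int (i + 2) - int T - 1 = p + 1"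
        by (auto simp: p_def)
      obtain s' p' where s': "\<tau> t i = view s' (p' - 1)" "\<tau> t (i + 1) = view s' p'" "\<tau> t (i + 2) = view s' (p' + 1)"
        "core (\<tau> (t + 1) (i + 1)) = core (view (step M s') p')"
        using win[OF t i] unfolding window_def by blast
      have "core (view (step M s') p') = core (view (step M (s t)) p)"
        using full[of i] full[of "i + 1"] full[of "i + 2"] i s'(1-3) unfolding pos
        by (intro step_local) auto
      then show "core (\<tau> (Suc t) (i + 1)) = core (view (s (Suc t)) (int i - int T))"
        using s'(4) s_Suc[of t] by (simp add: p_def)
    qed
  qed
  have "fst (\<tau> (T - 1 + 1) (T + 1)) = accept_state M"
    using ok[of "T - 1" T] T(3) unfolding cell_ok_flags by simp
  then have "fst (s T) = accept_state M"
    using row[of T] T(3) by (auto simp: core_def view_def)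
  then show ?thesis using w l(2) unfolding s_def by blast
qed

section \<open>The reduction\<close>

text \<open>Branching on finitely many tests. Since \<open>P\<close> has to be computable only for
  each fixed list of outcomes, a table indexed by flags may be arbitrary.\<close>

lemma compb_cases:
  assumes "\<And>Q. Q \<in> set Qs \<Longrightarrow> compb d Q" "\<And>bs. compb d (P bs)"
  shows "compb d (\<lambda>x w e. P (map (\<lambda>Q. Q x w e) Qs) x w e)"
  using assms
proof (induction Qs arbitrary: P)
  case Nil
  then show ?case by simp
next
  case (Cons Q Qs)
  have "compb d (\<lambda>x w e. P (Q x w e # bs) x w e)" for bs
  proof (rule compb_cong)
    show "compb d (\<lambda>x w e. if Q x w e then P (True # bs) x w e else P (False # bs) x w e)"
      by (intro compb_if Cons.prems) simp
  qed auto
  from Cons.IH[of "\<lambda>bs x w e. P (Q x w e # bs) x w e", OF _ this] Cons.prems(1)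
  show ?case by simp
qed

lemma compb_subst3:
  assumes "compb 3 (\<lambda>x w e. P x w (e ! 0) (e ! 1) (e ! 2))" "comp d f1" "comp d f2" "comp d f3"
  shows "compb d (\<lambda>x w e. P x w (f1 x w e) (f2 x w e) (f3 x w e))"
  using comp_subst[of "[f1, f2, f3]" "\<lambda>x w e. of_bool (P x w (e ! 0) (e ! 1) (e ! 2))" d] assms
  unfolding compb_def by (auto simp: numeral_eq_Suc)

lemma NP_reduces_to_graph_problem:
  fixes P :: "nat set \<Rightarrow> nat set set \<Rightarrow> bool"
  assumes k: "k \<ge> 3"
    and P: "\<And>n E. simple_graph {..<n::nat} E \<Longrightarrow> P {..<n} E \<longleftrightarrow>
     (\<exists>\<phi>. semi_ok {..<n} (adjacent E) k \<phi> \<and> (tri \<longrightarrow> triangles_ok {..<n} (adjacent E) \<phi>))"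
    and L: "L \<in> NP"
  shows "poly_time_reducible L (graph_problem P)"
proof -
  obtain R q where R: "poly_time_decidable R" and Lq: "\<And>x. x \<in> L \<longleftrightarrow> (\<exists>w. length w \<le> poly q (length x) \<and> R x w)"
    using L unfolding NP_def by blast
  obtain M p where wf: "wf_tm M" and M: "\<And>x w. fst (config_after M [x, w] (poly p (length x + length w))) =
               (if R x w then accept_state M else reject_state M)"
    using R unfolding poly_time_decidable_def by blast
  define Q where "Q x = poly q (length x)" for x :: "bool list"
  \<comment> \<open>Large enough for the input, for every admissible certificate and for the running
    time on them, and positive because of \<open>Suc\<close>. A halted machine does not move, so the
    verdict is still visible at time \<open>T x\<close>.\<close>
  define T where "T x = Suc (length x + Q x + poly p (length x + Q x))" for x :: "bool list"
  have acc: "fst (config_after M [x, w] (T x)) = accept_state M \<longleftrightarrow> R x w" if w: "length w \<le> Q x" for x w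
  proof -
    let ?N = "poly p (length x + length w)"
    have "?N \<le> poly p (length x + Q x)" using w by (intro poly_nat_mono) simp
    then have N: "T x = (T x - ?N) + ?N" by (simp add: T_def)
    have "halted M (config_after M [x, w] ?N)" using M by (simp add: halted_def)
    then have "config_after M [x, w] (T x) = config_after M [x, w] ?N"
      unfolding config_after_def by (subst N) (simp add: funpow_add step_funpow_halted)
    then show ?thesis using M[of x w] wf by (auto simp: wf_tm_def)
  qed
  have xL: "x \<in> L \<longleftrightarrow> (\<exists>\<tau>. (\<forall>t i. \<tau> t i \<in> cells M) \<and> tableau M x (Q x) (T x) \<tau>)" for x
  proof
    assume "x \<in> L"
    then obtain w where w: "length w \<le> Q x" "R x w" using Lq by (auto simp: Q_def)
    have "tableau M x (Q x) (T x) (\<lambda>t i. view (config_after M [x, w] t) (int i - int (T x) - 1))"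
      by (rule tableau_of_computation[OF wf _ w(1)]) (use acc[OF w(1)] w in \<open>auto simp: T_def\<close>)
    then show "\<exists>\<tau>. (\<forall>t i. \<tau> t i \<in> cells M) \<and> tableau M x (Q x) (T x) \<tau>"
      using view_in_cells[OF good_after[OF wf]]
      by (intro exI[of _ "\<lambda>t i. view (config_after M [x, w] t) (int i - int (T x) - 1)"]) simp
  next
    assume "\<exists>\<tau>. (\<forall>t i. \<tau> t i \<in> cells M) \<and> tableau M x (Q x) (T x) \<tau>"
    then obtain \<tau> where "tableau M x (Q x) (T x) \<tau>" by blast
    then obtain w where "length w \<le> Q x" "fst (config_after M [x, w] (T x)) = accept_state M"
      using computation_of_tableau[OF wf, of x "T x" "Q x" \<tau>] by (auto simp: T_def)
    then show "x \<in> L" using acc Lq by (auto simp: Q_def)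
  qed
  define D where "D = card (cells M)"
  obtain h where h: "bij_betw h {..<D} (cells M)"
    using ex_bij_betw_nat_finite[OF finite_cells, of M] by (auto simp: D_def atLeast0LessThan)
  have "cells M \<noteq> {}" using view_in_cells[OF good_initial[OF wf]] by blast
  then have D: "D > 0" using finite_cells by (simp add: D_def card_gt_0_iff)
  \<comment> \<open>For the fixed machine this is a finite set of numbers for each list of flags, so
    membership is computable even though \<open>cell_ok\<close> quantifies over
    configurations.\<close>
  define F where "F bs = {g. g < D * D * D * D \<and> cell_ok M bs (h (g div (D * D * D))) (h (g div (D * D) mod D)) (h (g div D mod D)) (h (g mod D))}" for bs
  define ok where "ok x t i g \<longleftrightarrow> g \<in> F (flags x (Q x) (T x) t i)" for x t i g
  have ok_code: "ok x t i (code D a b c d) \<longleftrightarrow> cell_ok M (flags x (Q x) (T x) t i) (h a) (h b) (h c) (h d)"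
    if "a < D" "b < D" "c < D" "d < D" for x t i a b c d
    using that by (simp add: ok_def F_def code_less code_digits)
  have tile: "x \<in> L \<longleftrightarrow> tileable D (T x) (ok x)" for x
    unfolding xL
  proof
    assume "\<exists>\<tau>. (\<forall>t i. \<tau> t i \<in> cells M) \<and> tableau M x (Q x) (T x) \<tau>"
    then obtain \<tau> where \<tau>: "\<And>t i. \<tau> t i \<in> cells M" "tableau M x (Q x) (T x) \<tau>" by blast
    define \<sigma> where "\<sigma> t i = the_inv_into {..<D} h (\<tau> t i)" for t i
    have \<sigma>: "\<sigma> t i < D \<and> h (\<sigma> t i) = \<tau> t i" for t i
      using \<tau>(1)[of t i] h unfolding \<sigma>_def bij_betw_def
      by (metis f_the_inv_into_f lessThan_iff subset_refl the_inv_into_into)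
    then show "tileable D (T x) (ok x)"
      using \<tau>(2) ok_code unfolding tileable_def tableau_def by (intro exI[of _ \<sigma>]) simp
  next
    assume "tileable D (T x) (ok x)"
    then obtain \<sigma> where \<sigma>: "\<And>t i. \<sigma> t i < D" "\<And>t i. t < T x \<Longrightarrow> i < 2 * T x + 1 \<Longrightarrow>
        ok x t i (code D (\<sigma> t i) (\<sigma> t (i + 1)) (\<sigma> t (i + 2)) (\<sigma> (t + 1) (i + 1)))"
      unfolding tileable_def by blast
    have "h a \<in> cells M" if "a < D" for a using h that by (auto simp: bij_betw_def)
    then show "\<exists>\<tau>. (\<forall>t i. \<tau> t i \<in> cells M) \<and> tableau M x (Q x) (T x) \<tau>"
      using \<sigma> ok_code unfolding tableau_def by (intro exI[of _ "\<lambda>t i. h (\<sigma> t i)"]) simp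
  qed
  have Qc: "comp d (\<lambda>x w e. Q x)" for d
    unfolding Q_def by (intro comp_rules)
  have Tc: "comp d (\<lambda>x w e. T x)" for d
    unfolding T_def by (intro comp_rules Qc)
  have "compb 3 (\<lambda>x w e. ok x (e ! 0) (e ! 1) (e ! 2))"
  proof -
    let ?Qs = "[\<lambda>x w e. e ! 1 = 0, \<lambda>x w e. e ! 1 = 2 * T x, \<lambda>x w e. e ! 0 = 0, \<lambda>x w e. T x \<le> e ! 1,
      \<lambda>x w e. e ! 0 + 1 = T x \<and> e ! 1 = T x, \<lambda>x w e. T x \<le> e ! 1 \<and> bit_at x (e ! 1 - T x),
      \<lambda>x w e. T x \<le> e ! 1 \<and> e ! 1 - T x < length x, \<lambda>x w e. e ! 1 = T x,
      \<lambda>x w e. T x \<le> e ! 1 \<and> e ! 1 - T x < Q x] :: (bool list \<Rightarrow> bool list \<Rightarrow> nat list \<Rightarrow> bool) list"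
    have "compb 3 (\<lambda>x w e. e ! 2 \<in> F (map (\<lambda>Q. Q x w e) ?Qs))"
    proof (rule compb_cases[where P = "\<lambda>bs x w e. e ! 2 \<in> F bs"])
      have "finite (F bs)" for bs unfolding F_def by simp
      then show "compb 3 (\<lambda>x w e. e ! 2 \<in> F bs)" for bs
        by (intro compb_member comp_var) auto
      have v: "comp 3 (\<lambda>x w e. e ! 0)" "comp 3 (\<lambda>x w e. e ! 1)" by (simp_all add: comp_var)
      have "\<forall>Q\<in>set ?Qs. compb 3 Q"
        unfolding list.set ball_simps
        by (intro conjI TrueI comp_rules v Qc Tc)
      then show "compb 3 Q" if "Q \<in> set ?Qs" for Q using that by blast
    qed
    then show ?thesis unfolding ok_def flags_def by simp
  qed
  then have okc: "compb d (\<lambda>x w e. ok x (f1 x w e) (f2 x w e) (f3 x w e))" if "comp d f1" "comp d f2" "comp d f3" for d f1 f2 f3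
    using compb_subst3[of "\<lambda>x w. ok x"] that by blast
  define b where "b = k + 8"
  show ?thesis
  proof (rule reduction_to_graph_problem[OF k P, where Y = "\<lambda>x. clause_bound b D (T x)" and lit = "\<lambda>x. clause_lit D (T x) (ok x)"])
    show "comp 0 (\<lambda>x w e. clause_bound b D (T x))"
      unfolding clause_bound_def by (intro comp_rules Tc)
    show "k + 8 \<le> clause_bound b D (T x)" for x
      by (simp add: clause_bound_def b_def)
    have v: "comp 2 (\<lambda>x w e. e ! 0)" "comp 2 (\<lambda>x w e. e ! 1)" by (simp_all add: comp_var)
    show "comp 2 (\<lambda>x w e. clause_lit D (T x) (ok x) (e ! 0) (e ! 1))"
      unfolding clause_lit_def tiling_lit_def no_tile_def
      by (intro comp_rules okc Tc v)
    show "clause_lit D (T x) (ok x) c j < clause_bound b D (T x)" for x c j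
      by (rule clause_lit_less[OF D])
    show "x \<in> L \<longleftrightarrow> satisfiable (clause_bound b D (T x)) (clause_lit D (T x) (ok x))" for x
      using tile satisfiable_imp_tileable[OF D] tileable_imp_satisfiable[OF D] by blast
  qed
qed

theorem theorem2:
  fixes k :: nat
  assumes "k \<ge> 3"
  shows "NP_complete (local_coloring_problem k) \<and>
         NP_complete (semi_matching_coloring_problem k)"
proof -
  have "NP_hard (local_coloring_problem k)"
    unfolding NP_hard_def local_coloring_problem_def
    by (intro ballI NP_reduces_to_graph_problem[where tri = True, OF assms]) (use local_coloring_iff in blast)+
  moreover have "NP_hard (semi_matching_coloring_problem k)"
    unfolding NP_hard_def semi_matching_coloring_problem_def
    by (intro ballI NP_reduces_to_graph_problem[where tri = False, OF assms]) (use semi_matching_coloring_iff in blast)+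
  ultimately show ?thesis
    unfolding NP_complete_def using problems_in_NP by blast
qed

end
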